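(* Let $D$ be a non-measurable open $SL(n,\mathbb{R})$-orbit in a flag manifold $Z=G/P$ of $G=SL(n,\mathbb{C})$, with base cycle $C_0$, let $\pi:\hat Z=G/\hat P\to Z$ and $\hat D\subset\hat Z$ be its measurable model, and $\hat C_0$ the base cycle of $\hat D$. A Schubert variety $S_{\hat w}\in\mathcal{S}_{\hat C_0}$ is mapped by $\pi$ to a Schubert variety $S_w\in\mathcal{S}_{C_0}$ if and only if all the blocks $C_j$ of $w$ with $t_j>1$ come from groups of blocks arranged in strictly decreasing order in $\hat w$.
   Context: Let $G_0=SL(n,\mathbb{R})$, $K_0=SO(n,\mathbb{R})$, $B\subset G=SL(n,\mathbb{C})$ upper triangular. For a dimension sequence $(c_1,\dots,c_r)$ with sum $n$, the parabolic subgroup is block upper triangular with these block sizes, and the flag manifold consists of flags with $\dim V_i/V_{i-1}=c_i$. An open $G_0$-orbit in $G/P$ is measurable if and only if the dimension sequence of $P$ is symmetric (equal to its reverse). The base cycle of an open $G_0$-orbit is its unique $K_0$-orbit that is a complex submanifold. Measurable model: let $f$ be the (non-symmetric) dimension sequence of $P$. Then $\hat P=P\cap\tau(P^-)$, where $P^-$ is the opposite parabolic and $\tau(P^-)$ has the reversed dimension sequence; $\hat P$ is a parabolic subgroup whose dimension sequence $d=(d_1,\dots,d_s)$ is symmetric and is the common refinement of $f$ and its reverse (e.g. $f=(2,4,3)$ gives $d=(2,1,3,1,2)$). $\pi:G/\hat P\to G/P$ is the projection, and $\hat D$ is the open $G_0$-orbit in $\hat Z$ with $\pi(\hat D)=D$.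 There is a unique sequence $t=(t_1,\dots,t_p)$ of positive integers with $t_1+\dots+t_p=s$ such that, with $\delta_0=0$ and $\delta_j=\sum_{i=1}^jt_i$, one has $f=(f_{\delta_1},\dots,f_{\delta_p})$, $f_{\delta_j}=\sum_{i=\delta_{j-1}+1}^{\delta_j}d_i$. Schubert varieties in a flag manifold $G/Q$ are indexed by minimal representatives, i.e. permutations in one-line notation increasing in each consecutive block of the dimension sequence of $Q$: $S_w$ is the closure of the $B$-orbit of the coordinate flag determined by $w(1),w(2),\dots,w(n)$ in this order. $\mathcal{S}_{C_0}$ is the set of Schubert varieties $S_w\subset Z$ with $\dim S_w+\dim C_0=\dim Z$ and $S_w\cap C_0\ne\emptyset$; $\mathcal{S}_{\hat C_0}$ is defined likewise in $\hat Z$. Write $\hat w$ in blocks $B_1\dots B_s$ of lengths $d_1,\dots,d_s$. If $S_w=\pi(S_{\hat w})$, then $w=C_1\dots C_p$ with $C_j=\bigcup_{i=\delta_{j-1}+1}^{\delta_j}B_i$ arranged in increasing order. The group of blocks $B_{\delta_{j-1}+1},\dots,B_{\delta_j}$ forming $C_j$ is in strictly decreasing order if, for all $\delta_{j-1}+1\le i\le\delta_j-1$, the last element of $B_{i+1}$ is smaller than the first element of $B_i$. *)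

theory Defs
  imports "HOL-Analysis.Analysis"
begin

(* The index type 'n (finite, linearly ordered) plays the role of {1,...,n}, with n = CARD('n). *)

section \<open>Dimension sequences and blocks\<close>

definition dim_seq :: "'n::finite itself \<Rightarrow> nat list \<Rightarrow> bool" where
  "dim_seq _ c \<longleftrightarrow> 0 \<notin> set c \<and> sum_list c = CARD('n)"

definition partial_sum :: "nat list \<Rightarrow> nat \<Rightarrow> nat" where
  "partial_sum c k = sum_list (take k c)"

text \<open>Consecutive pieces of a list, of the prescribed lengths.\<close>

fun blocks :: "nat list \<Rightarrow> 'a list \<Rightarrow> 'a list list" where
  "blocks [] xs = []"
| "blocks (c # cs) xs = take c xs # blocks cs (drop c xs)"

text \<open>A block upper triangular parabolic is determined by the set of partial sums of its
  dimension sequence (the dimensions of the subspaces it stabilizes), and the intersection of two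
  of them corresponds to the union of these sets.\<close>

definition is_common_refinement :: "nat list \<Rightarrow> nat list \<Rightarrow> nat list \<Rightarrow> bool" where
  "is_common_refinement d a b \<longleftrightarrow>
     0 \<notin> set d \<and>
     partial_sum d ` {..length d} =
       partial_sum a ` {..length a} \<union> partial_sum b ` {..length b}"

definition grouping :: "nat list \<Rightarrow> nat list \<Rightarrow> nat list \<Rightarrow> bool" where
  "grouping t d f \<longleftrightarrow>
     0 \<notin> set t \<and> sum_list t = length d \<and> f = map sum_list (blocks t d)"


section \<open>Groups\<close>

type_synonym 'n cmat = "complex^'n^'n"

definition SL_complex :: "'n::finite cmat set" where
  "SL_complex = {A. det A = 1}"

definition SL_real :: "'n::finite cmat set" where
  "SL_real = {A \<in> SL_complex. \<forall>i j. A $ i $ j \<in> \<real>}"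

definition SO_real :: "'n::finite cmat set" where
  "SO_real = {A \<in> SL_real. transpose A ** A = mat 1}"

definition borel_subgroup :: "'n::{finite,linorder} cmat set" where
  "borel_subgroup = {A \<in> SL_complex. \<forall>i j. j < i \<longrightarrow> A $ i $ j = 0}"


section \<open>Flag manifolds\<close>

type_synonym 'n flag = "(complex^'n) set list"

definition flags :: "nat list \<Rightarrow> 'n::finite flag set" where
  "flags c = {V. length V = length c \<and>
     (\<forall>i<length c. vec.subspace (V ! i) \<and> vec.dim (V ! i) = partial_sum c (Suc i)) \<and>
     sorted_wrt (\<subseteq>) V}"

definition act :: "'n cmat \<Rightarrow> 'n::finite flag \<Rightarrow> 'n flag" where
  "act g V = map (\<lambda>S. (\<lambda>v. g *v v) ` S) V"

definition orbit :: "'n::finite cmat set \<Rightarrow> 'n::finite flag \<Rightarrow> 'n flag set" where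
  "orbit H V = (\<lambda>g. act g V) ` H"

definition coord_flag :: "nat list \<Rightarrow> 'n list \<Rightarrow> 'n::finite flag" where
  "coord_flag c w =
     map (\<lambda>i. vec.span ((\<lambda>k. axis k 1) ` set (take (partial_sum c (Suc i)) w))) [0..<length c]"

definition base_flag :: "nat list \<Rightarrow> 'n::{finite,linorder} flag" where
  "base_flag c = coord_flag c (sorted_list_of_set UNIV)"

text \<open>The quotient topology along \<open>g \<mapsto> g F\<close>, where \<open>F\<close> is the base flag.\<close>

definition flag_topology :: "nat list \<Rightarrow> 'n::{finite,linorder} flag topology" where
  "flag_topology c = topology (\<lambda>U. U \<subseteq> flags c \<and>
     openin (top_of_set SL_complex) {g \<in> SL_complex. act g (base_flag c) \<in> U})"

lemma openin_flag_topology: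
  "openin (flag_topology c) U \<longleftrightarrow> U \<subseteq> flags c \<and>
     openin (top_of_set SL_complex) {g \<in> SL_complex. act g (base_flag c) \<in> U}"
proof -
  let ?P = "\<lambda>U. {g \<in> SL_complex. act g (base_flag c) \<in> U}"
  have int: "?P (S \<inter> T) = ?P S \<inter> ?P T" for S T by auto
  have un: "?P (\<Union>\<K>) = \<Union>(?P ` \<K>)" for \<K> by auto
  have "istopology (\<lambda>U. U \<subseteq> flags c \<and> openin (top_of_set SL_complex) (?P U))"
    unfolding istopology_def int un by (auto simp del: mem_Collect_eq)
  then show ?thesis
    unfolding flag_topology_def by (subst topology_inverse') auto
qed

text \<open>\<open>(V\<^sub>1, \<dots>, V\<^sub>s) \<mapsto> (V\<^bsub>\<delta>\<^sub>1\<^esub>, \<dots>, V\<^bsub>\<delta>\<^sub>p\<^esub>)\<close> with \<open>\<delta>\<^sub>j = t\<^sub>1 + \<dots> + t\<^sub>j\<close>.\<close>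

definition flag_proj :: "nat list \<Rightarrow> 'n flag \<Rightarrow> 'n::finite flag" where
  "flag_proj t V = map (\<lambda>j. V ! (partial_sum t (Suc j) - 1)) [0..<length t]"


section \<open>Complex submanifolds and dimension\<close>

definition block_index :: "nat list \<Rightarrow> 'n::{finite,linorder} \<Rightarrow> nat" where
  "block_index c i = (LEAST m. card {k. k < i} < partial_sum c (Suc m))"

text \<open>Strictly block lower triangular matrices, as vectors with coordinates in \<open>'n \<times> 'n\<close>
  so that the library's complex linear algebra applies to them.\<close>

definition nil_lower :: "nat list \<Rightarrow> (complex^('n \<times> 'n::{finite,linorder})) set" where
  "nil_lower c = {x. \<forall>i j. block_index c i \<le> block_index c j \<longrightarrow> x $ (i, j) = 0}"

text \<open>The standard holomorphic chart (inverse of a coordinate map) of the flag manifold, centred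
  at the \<open>g\<close>-translate of the base flag, with domain \<open>nil_lower c\<close>.\<close>

definition flag_chart ::
  "nat list \<Rightarrow> 'n cmat \<Rightarrow> complex^('n \<times> 'n) \<Rightarrow> 'n::{finite,linorder} flag" where
  "flag_chart c g x = act (g ** (mat 1 + (\<chi> i j. x $ (i, j)))) (base_flag c)"

text \<open>To be used for open subsets \<open>W\<close> of a complex subspace of \<open>\<complex>\<^sup>m\<close>: the derivative within
  \<open>W\<close> only matters on that subspace.\<close>

definition holomorphic_map_on :: "(complex^'m \<Rightarrow> complex^'k) \<Rightarrow> (complex^'m) set \<Rightarrow> bool" where
  "holomorphic_map_on h W \<longleftrightarrow> (\<forall>x\<in>W. \<exists>h'. (h has_derivative h') (at x within W) \<and>
     (\<forall>a v. h' (a *s v) = a *s h' v))"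

definition biholomorphic_map ::
  "(complex^'m) set \<Rightarrow> (complex^'m) set \<Rightarrow> (complex^'m \<Rightarrow> complex^'m) \<Rightarrow> bool" where
  "biholomorphic_map W W' h \<longleftrightarrow> bij_betw h W W' \<and>
     holomorphic_map_on h W \<and> holomorphic_map_on (inv_into W h) W'"

text \<open>Embedded, not necessarily closed, complex submanifolds of pure dimension \<open>k\<close>: near each
  point, a holomorphic coordinate change turns \<open>S\<close> into a \<open>k\<close>-dimensional linear subspace.\<close>

definition complex_submanifold :: "nat list \<Rightarrow> nat \<Rightarrow> 'n::{finite,linorder} flag set \<Rightarrow> bool" where
  "complex_submanifold c k S \<longleftrightarrow> S \<subseteq> flags c \<and>
     (\<forall>g\<in>SL_complex. act g (base_flag c) \<in> S \<longrightarrow>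
       (\<exists>W W' h L. 0 \<in> W \<and>
          openin (top_of_set (nil_lower c)) W \<and> openin (top_of_set (nil_lower c)) W' \<and>
          biholomorphic_map W W' h \<and>
          vec.subspace L \<and> L \<subseteq> nil_lower c \<and> vec.dim L = k \<and>
          h ` {x \<in> W. flag_chart c g x \<in> S} = W' \<inter> L))"

text \<open>The dimension of an analytic set: the largest dimension at its regular points, i.e. at the
  points having a relatively open neighbourhood in the set that is a submanifold.\<close>

definition complex_dim :: "nat list \<Rightarrow> 'n::{finite,linorder} flag set \<Rightarrow> nat" where
  "complex_dim c A = Sup {k. \<exists>U. U \<noteq> {} \<and>
     openin (subtopology (flag_topology c) A) U \<and> complex_submanifold c k U}"


section \<open>Open orbits of the real form and their base cycles\<close>

definition open_orbit :: "nat list \<Rightarrow> 'n::{finite,linorder} flag set \<Rightarrow> bool" where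
  "open_orbit c D \<longleftrightarrow> (\<exists>V \<in> flags c. D = orbit SL_real V) \<and> openin (flag_topology c) D"

text \<open>Measurability in the sense of Wolf: existence of an invariant volume element, here expressed
  as a nonzero invariant Borel measure that is finite on compact sets.\<close>

definition measurable_orbit :: "nat list \<Rightarrow> 'n::{finite,linorder} flag set \<Rightarrow> bool" where
  "measurable_orbit c D \<longleftrightarrow> (\<exists>M :: 'n flag measure.
     space M = D \<and>
     sets M = sigma_sets D {U. openin (subtopology (flag_topology c) D) U} \<and>
     emeasure M D \<noteq> 0 \<and>
     (\<forall>K. compactin (subtopology (flag_topology c) D) K \<longrightarrow> emeasure M K < \<infinity>) \<and>
     (\<forall>g\<in>SL_real. \<forall>A\<in>sets M. emeasure M (act g ` A) = emeasure M A))"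

definition base_cycle :: "nat list \<Rightarrow> 'n::{finite,linorder} flag set \<Rightarrow> 'n flag set \<Rightarrow> bool" where
  "base_cycle c D C \<longleftrightarrow> (\<exists>V\<in>D. C = orbit SO_real V) \<and> (\<exists>k. complex_submanifold c k C)"


section \<open>Schubert varieties\<close>

text \<open>Permutations are lists in one-line notation.\<close>

definition min_rep :: "nat list \<Rightarrow> 'n::{finite,linorder} list \<Rightarrow> bool" where
  "min_rep c w \<longleftrightarrow> distinct w \<and> set w = UNIV \<and> (\<forall>b \<in> set (blocks c w). sorted b)"

definition schubert_variety :: "nat list \<Rightarrow> 'n list \<Rightarrow> 'n::{finite,linorder} flag set" where
  "schubert_variety c w = flag_topology c closure_of orbit borel_subgroup (coord_flag c w)"

definition schubert_set ::
  "nat list \<Rightarrow> 'n::{finite,linorder} flag set \<Rightarrow> 'n flag set set" where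
  "schubert_set c C = {schubert_variety c w | w. min_rep c w \<and>
     complex_dim c (schubert_variety c w) + complex_dim c C =
       complex_dim c (flags c :: 'n flag set) \<and>
     schubert_variety c w \<inter> C \<noteq> {}}"

definition strictly_decreasing :: "'n::linorder list list \<Rightarrow> bool" where
  "strictly_decreasing bs \<longleftrightarrow> successively (\<lambda>b b'. last b' < hd b) bs"

end

theory Submission
  imports Defs
begin

text \<open>Write \<open>\<pi>\<close> for the projection. It is closed and equivariant, so it maps \<open>S\<^sub>w\<close> to the Schubert variety of
  the same permutation, sorted within the blocks of \<open>f\<close>. If \<open>\<pi>\<close> maps the base cycle of the measurable
  model bijectively onto the base cycle \<open>C\<^sub>0\<close>, then both have the same dimension, and the image of a
  Schubert variety in the model that meets its base cycle meets \<open>C\<^sub>0\<close>; so the only remaining condition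
  is that \<open>S\<^sub>w\<close> and \<open>\<pi>(S\<^sub>w)\<close> have the same codimension. As \<open>dim S\<^sub>w\<close> counts inversions between
  different blocks, this means that every pair of positions in different blocks of one group is inverted.

  For the base cycles, a moment map argument shows that a flag \<open>V\<close> in an \<open>SO(n,\<real>)\<close>-orbit that is a
  complex submanifold satisfies: the orthogonal projections onto the \<open>V\<^sub>i\<close> and their conjugates preserve
  all \<open>V\<^sub>j\<close>. In an open \<open>SL(n,\<real>)\<close>-orbit the intersections of the \<open>V\<^sub>i\<close> with the conjugates of the
  \<open>V\<^sub>j\<close> have the generic dimension, and therefore \<open>V\<^sub>i\<close> and the complement of \<open>V\<^sub>j\<close> for the bilinear form
  are nested. Adapted unitary bases show that such flags in one open orbit form a single
  \<open>SO(n,\<real>)\<close>-orbit. In the model they are determined by their projection, since their members are the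
  members of the projection and the complements of these.\<close>

section \<open>Linear algebra: coordinate flags, unitary bases, block triangular matrices\<close>

section \<open>Ranks and coordinate subspaces\<close>

text \<open>A base cycle enters only as some \<open>SO_real\<close>-orbit in the open orbit that is
  a complex submanifold; neither its uniqueness nor its shape is given, so everything is drawn from
  the complexity of its tangent spaces. These contain the images of so(n,R), hence of so(n,C), and
  in particular of the matrix \<open>Z\<close> built from imaginary parts of projections, which is i
  times a real skew matrix. The pairing with \<open>Z\<close> is maximal at the given flag by
  Cauchy-Schwarz, while its derivative along \<open>Z\<close> is a sum of squares; so every square
  vanishes.

  Unitary bases yield connecting matrices in O(n), not in SO(n). Determinant -1 can be corrected by
  a reflection fixing the flag unless some member has dimension n/2, and in that case it is excluded
  because both flags lie in one \<open>SL_real\<close>-orbit.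

  \<open>complex_dim\<close> is a supremum over all regular points, so it can be computed only once
  the dimension of a submanifold is known to be a topological invariant. Invariance of domain
  provides that, and therefore a mere homeomorphism between the base cycles suffices to compare
  their dimensions.\<close>

definition rk :: "'n::{finite,linorder} \<Rightarrow> nat" where
  "rk i = card {k. k < i}"

lemma rk_less_iff [simp]: "rk i < rk j \<longleftrightarrow> i < j"
proof -
  have mono: "rk a < rk b" if "a < b" for a b :: 'a
    unfolding rk_def using that by (intro psubset_card_mono) auto
  show ?thesis
    using mono[of i j] mono[of j i] by (cases i j rule: linorder_cases) auto
qed

lemma rk_le_iff [simp]: "rk i \<le> rk j \<longleftrightarrow> i \<le> j"
  by (meson linorder_not_le rk_less_iff)

lemma rk_inject [simp]: "rk i = rk j \<longleftrightarrow> i = j"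
  by (metis order_antisym order_refl rk_le_iff)

lemma rk_less_CARD [simp]: "rk (i::'n::{finite,linorder}) < CARD('n)"
  unfolding rk_def by (intro psubset_card_mono) auto

text \<open>The abstract index type thereby becomes interchangeable with the numbers 0, ..., n-1, so
  that indices can be compared with partial sums of dimension sequences.\<close>

lemma bij_betw_rk: "bij_betw rk (UNIV :: 'n::{finite,linorder} set) {..<CARD('n)}"
proof -
  have "inj_on rk (UNIV :: 'n set)" by (auto simp: inj_on_def)
  moreover have "rk ` (UNIV :: 'n set) \<subseteq> {..<CARD('n)}" by auto
  ultimately show ?thesis
    by (simp add: bij_betw_def card_image card_subset_eq)
qed

lemma rk_surj: "k < CARD('n) \<Longrightarrow> \<exists>i::'n::{finite,linorder}. rk i = k"
  using bij_betw_rk[where 'n='n] unfolding bij_betw_def by (metis imageE lessThan_iff)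

lemma rk_image: "k \<le> CARD('n) \<Longrightarrow> rk ` {i::'n::{finite,linorder}. rk i < k} = {..<k}"
proof (intro subset_antisym subsetI)
  fix x assume "k \<le> CARD('n)" "x \<in> {..<k}"
  moreover from this obtain i :: 'n where "rk i = x" using rk_surj[of x, where 'n='n] by auto
  ultimately show "x \<in> rk ` {i::'n. rk i < k}" by auto
qed auto

lemma card_rk_less: "k \<le> CARD('n) \<Longrightarrow> card {i::'n::{finite,linorder}. rk i < k} = k"
proof -
  assume "k \<le> CARD('n)"
  moreover have "inj_on rk {i::'n. rk i < k}" by (auto simp: inj_on_def)
  ultimately show ?thesis by (metis card_image card_lessThan rk_image)
qed

text \<open>The standard full flag, indexed by dimension. The members of \<open>base_flag\<close>
  are those whose dimension is a partial sum; having all of them at hand lets Gram-Schmidt treat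
  every dimension sequence at once.\<close>

definition coord_space :: "nat \<Rightarrow> (complex^'n::{finite,linorder}) set" where
  "coord_space k = {v. \<forall>i. k \<le> rk i \<longrightarrow> v $ i = 0}"

lemma subspace_coord_space: "vec.subspace (coord_space k)"
  by (auto simp: vec.subspace_def coord_space_def)

lemma coord_space_mono: "k \<le> l \<Longrightarrow> coord_space k \<subseteq> coord_space l"
  by (auto simp: coord_space_def)

lemma span_axes:
  "vec.span ((\<lambda>i. axis i 1) ` A) = {v :: complex^'m. \<forall>i. i \<notin> A \<longrightarrow> v $ i = 0}"
proof (rule subset_antisym)
  have sub: "vec.subspace {v :: complex^'m. \<forall>i. i \<notin> A \<longrightarrow> v $ i = 0}"
    by (auto simp: vec.subspace_def)
  show "vec.span ((\<lambda>i. axis i 1) ` A) \<subseteq> {v :: complex^'m. \<forall>i. i \<notin> A \<longrightarrow> v $ i = 0}"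
    by (rule vec.span_minimal[OF _ sub]) (auto simp: axis_def)
  show "{v :: complex^'m. \<forall>i. i \<notin> A \<longrightarrow> v $ i = 0} \<subseteq> vec.span ((\<lambda>i. axis i 1) ` A)"
  proof
    fix v :: "complex^'m" assume v: "v \<in> {v. \<forall>i. i \<notin> A \<longrightarrow> v $ i = 0}"
    have "(\<Sum>i\<in>UNIV. v $ i *s axis i 1) \<in> vec.span ((\<lambda>i. axis i 1) ` A)"
    proof (rule vec.span_sum)
      fix i show "v $ i *s axis i 1 \<in> vec.span ((\<lambda>i. axis i 1) ` A)"
        using v by (cases "i \<in> A") (auto intro: vec.span_scale vec.span_base simp: vec.span_zero)
    qed
    then show "v \<in> vec.span ((\<lambda>i. axis i 1) ` A)" by (simp add: basis_expansion)
  qed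
qed

lemma coord_space_eq_span:
  "coord_space k = vec.span ((\<lambda>i. axis i 1) ` {i::'a::{finite,linorder}. rk i < k})"
  by (auto simp: span_axes coord_space_def)

lemma axis_in_coord_space: "rk i < k \<Longrightarrow> axis i 1 \<in> coord_space k"
  by (auto simp: coord_space_def axis_def)

lemma dim_axes: "vec.dim (vec.span ((\<lambda>i. axis i (1::complex)) ` (A :: 'm::finite set))) = card A"
proof -
  have inj: "inj_on (\<lambda>i. axis i (1::complex)) A" by (auto simp: inj_on_def axis_eq_axis)
  have "vec.independent ((\<lambda>i. axis i (1::complex)) ` A)"
    by (rule vec.independent_mono[OF independent_cart_basis]) (auto simp: cart_basis_def)
  then show ?thesis using vec.dim_span_eq_card_independent card_image[OF inj] by metis
qed

lemma dim_coord_space: "k \<le> CARD('n) \<Longrightarrow> vec.dim (coord_space k :: (complex^'n::{finite,linorder}) set) = k"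
  unfolding coord_space_eq_span dim_axes by (rule card_rk_less)

lemma coord_space_CARD: "CARD('n) \<le> k \<Longrightarrow> coord_space k = (UNIV :: (complex^'n::{finite,linorder}) set)"
proof -
  assume "CARD('n) \<le> k"
  then have "\<not> k \<le> rk i" for i :: 'n using rk_less_CARD[of i] by linarith
  then show ?thesis by (auto simp: coord_space_def)
qed

lemma mult_axis: "M *v axis j 1 = column j (M :: complex^'n^'m)"
  by (simp add: matrix_vector_mult_def column_def vec_eq_iff axis_def if_distrib cong: if_cong)

lemma subspace_image_mat: "vec.subspace V \<Longrightarrow> vec.subspace ((*v) M ` V)"
  for M :: "complex^'n^'m"
  by (rule vec.subspace_image)

lemma dim_image_mat: "invertible M \<Longrightarrow> vec.dim ((*v) M ` V) = vec.dim V"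
  for M :: "complex^'n^'n"
  by (intro vec.dim_image_eq[OF matrix_vector_mul_linear_gen] inj_on_subset[OF inj_matrix_vector_mult]) auto

lemma image_image_mat: "(*v) M ` (*v) N ` V = (*v) (M ** N) ` V"
  for M :: "complex^'n^'m"
  by (simp add: image_image matrix_vector_mul_assoc)

lemma image_mat_1 [simp]: "(*v) (mat 1) ` V = (V :: (complex^'n) set)"
  by simp

section \<open>Inverses\<close>

lemma invertible_mat_1 [simp]: "invertible (mat 1 :: complex^'n^'n)"
  unfolding invertible_def by (metis matrix_mul_lid)

lemma matrix_inv_right: "invertible M \<Longrightarrow> M ** matrix_inv M = mat 1"
  and matrix_inv_left: "invertible M \<Longrightarrow> matrix_inv M ** M = mat 1"
  for M :: "complex^'n^'n"
  unfolding invertible_def matrix_inv_def by (metis (mono_tags, lifting) someI_ex)+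

lemma invertible_matrix_inv: "invertible M \<Longrightarrow> invertible (matrix_inv M)" for M :: "complex^'n^'n"
  unfolding invertible_def[of "matrix_inv M"] using matrix_inv_left matrix_inv_right by blast

lemma matrix_inv_unique: "M ** N = mat 1 \<Longrightarrow> matrix_inv M = N" for M N :: "complex^'n^'n"
  by (metis invertible_right_inverse matrix_inv_left matrix_mul_assoc matrix_mul_lid matrix_mul_rid)

lemma matrix_inv_mult: "invertible M \<Longrightarrow> invertible N \<Longrightarrow> matrix_inv (M ** N) = matrix_inv N ** matrix_inv M"
  for M N :: "complex^'n^'n"
proof (rule matrix_inv_unique)
  assume "invertible M" "invertible N"
  then show "M ** N ** (matrix_inv N ** matrix_inv M) = mat 1"
    by (metis matrix_inv_right matrix_mul_assoc matrix_mul_rid)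
qed

lemma matrix_inv_inv: "invertible M \<Longrightarrow> matrix_inv (matrix_inv M) = M" for M :: "complex^'n^'n"
  by (rule matrix_inv_unique) (rule matrix_inv_left)

lemma invertible_mult_iff: "invertible (M ** N) \<longleftrightarrow> invertible M \<and> invertible N"
  for M N :: "complex^'n^'n"
  unfolding invertible_det_nz by (simp add: det_mul)

lemma mat_mult_cancel_left: "invertible M \<Longrightarrow> matrix_inv M ** (M ** N) = N"
  "invertible M \<Longrightarrow> M ** (matrix_inv M ** N) = N"
  for M :: "complex^'n^'n"
  by (simp_all add: matrix_mul_assoc matrix_inv_left matrix_inv_right)

lemma image_mat_eq_iff: "invertible M \<Longrightarrow> (*v) M ` A = B \<longleftrightarrow> A = (*v) (matrix_inv M) ` B"
  for M :: "complex^'n^'n"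
  by (metis image_image_mat image_mat_1 matrix_inv_left matrix_inv_right)

section \<open>Conjugation, adjoints and the two bilinear forms\<close>

definition cnjv :: "complex^'n \<Rightarrow> complex^'n" where "cnjv v = (\<chi> i. cnj (v $ i))"
definition cnjm :: "complex^'n^'m \<Rightarrow> complex^'n^'m" where "cnjm A = (\<chi> i j. cnj (A $ i $ j))"
definition adj :: "complex^'n^'m \<Rightarrow> complex^'m^'n" where "adj A = (\<chi> i j. cnj (A $ j $ i))"
definition herm :: "complex^'n \<Rightarrow> complex^'n \<Rightarrow> complex" where "herm x y = (\<Sum>i\<in>UNIV. x $ i * cnj (y $ i))"
definition bil :: "complex^'n \<Rightarrow> complex^'n \<Rightarrow> complex" where "bil x y = (\<Sum>i\<in>UNIV. x $ i * y $ i)"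

lemma cnjv_nth [simp]: "cnjv v $ i = cnj (v $ i)" by (simp add: cnjv_def)
lemma cnjm_nth [simp]: "cnjm A $ i $ j = cnj (A $ i $ j)" by (simp add: cnjm_def)
lemma adj_nth [simp]: "adj A $ i $ j = cnj (A $ j $ i)" by (simp add: adj_def)
lemma cnjv_cnjv [simp]: "cnjv (cnjv v) = v" by (simp add: vec_eq_iff)
lemma adj_adj [simp]: "adj (adj A) = A" by (simp add: vec_eq_iff)
lemma cnjv_scale [simp]: "cnjv (c *s x) = cnj c *s cnjv x" by (simp add: vec_eq_iff)
lemma cnjv_0 [simp]: "cnjv 0 = 0" by (simp add: vec_eq_iff)
lemma cnjv_eq_0 [simp]: "cnjv x = 0 \<longleftrightarrow> x = 0" by (simp add: vec_eq_iff)
lemma cnjm_mult: "cnjm (A ** B) = cnjm A ** cnjm B" by (simp add: vec_eq_iff matrix_matrix_mult_def)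
lemma cnjv_mult: "cnjv (A *v x) = cnjm A *v cnjv x" by (simp add: vec_eq_iff matrix_vector_mult_def)
lemma cnjm_mat [simp]: "cnjm (mat 1) = mat 1" by (simp add: vec_eq_iff mat_def)
lemma adj_mat [simp]: "adj (mat 1) = mat 1" by (auto simp: vec_eq_iff mat_def)
lemma adj_mult: "adj (A ** B) = adj B ** adj A"
  by (simp add: vec_eq_iff matrix_matrix_mult_def mult.commute)
lemma adj_diff: "adj (A - B) = adj A - adj B" by (simp add: vec_eq_iff)
lemma adj_eq: "adj A = transpose (cnjm A)" by (simp add: vec_eq_iff transpose_def)
lemma cnjm_adj: "cnjm (adj A) = adj (cnjm A)" by (simp add: vec_eq_iff)

text \<open>This link between the two forms carries the proof: bilinear orthogonality is Hermitian
  orthogonality to the conjugate, so unitary bases and orthogonal projections also control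
  \<open>bperp\<close>.\<close>

lemma bil_eq_herm: "bil x y = herm x (cnjv y)" by (simp add: herm_def bil_def)
lemma bil_commute: "bil x y = bil y x" by (simp add: bil_def mult.commute)
lemma herm_commute: "herm x y = cnj (herm y x)" by (simp add: herm_def mult.commute)
lemma herm_cnjv: "herm (cnjv x) (cnjv y) = cnj (herm x y)" by (simp add: herm_def)
lemma bil_add_left: "bil (x + y) z = bil x z + bil y z" by (simp add: bil_def distrib_right sum.distrib)
lemma bil_add_right: "bil z (x + y) = bil z x + bil z y" by (simp add: bil_def distrib_left sum.distrib)
lemma bil_scale_left: "bil (c *s x) z = c * bil x z" by (simp add: bil_def sum_distrib_left mult.assoc)
lemma bil_scale_right: "bil z (c *s x) = c * bil z x" by (simp add: bil_def sum_distrib_left mult_ac)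
lemma bil_0 [simp]: "bil 0 z = 0" "bil z 0 = 0" by (simp_all add: bil_def)
lemma herm_diff_left: "herm (x - y) z = herm x z - herm y z" by (simp add: herm_def left_diff_distrib sum_subtractf)
lemma herm_add_right: "herm z (x + y) = herm z x + herm z y" by (simp add: herm_def distrib_left sum.distrib)
lemma herm_scale_left: "herm (c *s x) z = c * herm x z" by (simp add: herm_def sum_distrib_left mult.assoc)
lemma herm_scale_right: "herm z (c *s x) = cnj c * herm z x" by (simp add: herm_def sum_distrib_left mult_ac)
lemma herm_0 [simp]: "herm 0 z = 0" "herm z 0 = 0" by (simp_all add: herm_def)

lemma herm_mult_left: "herm (A *v x) y = herm x (adj A *v y)"
proof -
  have "herm (A *v x) y = (\<Sum>i\<in>UNIV. \<Sum>j\<in>UNIV. A $ i $ j * x $ j * cnj (y $ i))"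
    by (simp add: herm_def matrix_vector_mult_def sum_distrib_right)
  also have "\<dots> = (\<Sum>j\<in>UNIV. \<Sum>i\<in>UNIV. A $ i $ j * x $ j * cnj (y $ i))" by (rule sum.swap)
  also have "\<dots> = herm x (adj A *v y)"
    by (simp add: herm_def matrix_vector_mult_def sum_distrib_left mult_ac)
  finally show ?thesis .
qed

lemma bil_mult_left: "bil (A *v x) y = bil x (transpose A *v y)"
proof -
  have "bil (A *v x) y = (\<Sum>i\<in>UNIV. \<Sum>j\<in>UNIV. A $ i $ j * x $ j * y $ i)"
    by (simp add: bil_def matrix_vector_mult_def sum_distrib_right)
  also have "\<dots> = (\<Sum>j\<in>UNIV. \<Sum>i\<in>UNIV. A $ i $ j * x $ j * y $ i)" by (rule sum.swap)
  also have "\<dots> = bil x (transpose A *v y)"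
    unfolding transpose_matrix_vector by (simp add: bil_def vector_matrix_mult_def sum_distrib_left mult_ac)
  finally show ?thesis .
qed

lemma inner_eq_Re_herm: "x \<bullet> y = Re (herm x y)"
  by (simp add: inner_vec_def herm_def inner_complex_def)

lemma herm_self: "herm x x = of_real ((norm x)\<^sup>2)"
proof -
  have "Im (herm x x) = 0" by (simp add: herm_def)
  moreover have "Re (herm x x) = (norm x)\<^sup>2"
    by (metis inner_eq_Re_herm power2_norm_eq_inner)
  ultimately show ?thesis by (simp add: complex_eq_iff)
qed

lemma herm_self_eq_0 [simp]: "herm x x = 0 \<longleftrightarrow> x = 0"
  by (simp add: herm_self)

text \<open>The real inner product is only the real part of \<open>herm\<close>. A complex subspace
  contains \<open>\<i> *s v\<close> together with v, and this vector supplies the imaginary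
  part.\<close>

lemma herm_eq_0_iff_inner:
  assumes "vec.subspace V"
  shows "(\<forall>v\<in>V. herm x v = 0) \<longleftrightarrow> (\<forall>v\<in>V. x \<bullet> v = 0)"
proof (intro iffI ballI)
  fix v assume *: "\<forall>v\<in>V. x \<bullet> v = 0" and v: "v \<in> V"
  have "\<i> *s v \<in> V" using assms v by (rule vec.subspace_scale)
  with * v have "Re (herm x v) = 0" "Re (herm x (\<i> *s v)) = 0"
    by (auto simp flip: inner_eq_Re_herm)
  then show "herm x v = 0" by (simp add: herm_scale_right complex_eq_iff)
qed (auto simp: inner_eq_Re_herm)

lemma scaleR_eq_scale: "r *\<^sub>R x = complex_of_real r *s (x :: complex^'n)"
  by (simp add: vec_eq_iff complex_eq_iff)

lemma vec_subspace_imp_subspace: "vec.subspace V \<Longrightarrow> subspace (V :: (complex^'n) set)"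
  unfolding subspace_def vec.subspace_def by (auto simp: scaleR_eq_scale)

lemma herm_decomp:
  fixes V :: "(complex^'n) set"
  assumes "vec.subspace V"
  obtains p r where "p \<in> V" "\<And>v. v \<in> V \<Longrightarrow> herm r v = 0" "x = p + r"
proof -
  have sp: "span V = V" using assms vec_subspace_imp_subspace span_eq_iff by blast
  obtain p r where pr: "p \<in> span V" "\<And>v. v \<in> span V \<Longrightarrow> orthogonal r v" "x = p + r"
    using orthogonal_subspace_decomp_exists[of V x] by metis
  have "\<forall>v\<in>V. herm r v = 0"
    unfolding herm_eq_0_iff_inner[OF assms] using pr(2) sp by (auto simp: orthogonal_def)
  then show ?thesis using pr(1,3) sp that by metis
qed

definition unitary :: "complex^'n^'n \<Rightarrow> bool" where
  "unitary u \<longleftrightarrow> adj u ** u = mat 1"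

lemma unitary_invertible: "unitary u \<Longrightarrow> invertible u"
  unfolding unitary_def using invertible_left_inverse by blast

lemma unitary_adj: "unitary u \<Longrightarrow> u ** adj u = mat 1"
  unfolding unitary_def by (rule matrix_left_right_inverse1)

lemma herm_column: "herm (column j A) (column i A) = (adj A ** A) $ i $ j"
  by (simp add: herm_def column_def matrix_matrix_mult_def mult.commute)

lemma unitary_iff_columns:
  "unitary u \<longleftrightarrow> (\<forall>i j. herm (column j u) (column i u) = (if i = j then 1 else 0))"
  by (auto simp: unitary_def herm_column vec_eq_iff mat_def)

lemma unitary_mult: "unitary u \<Longrightarrow> unitary v \<Longrightarrow> unitary (u ** v)"
  unfolding unitary_def by (metis adj_mult matrix_mul_assoc matrix_mul_lid)

lemma mult_coord_space_subset:
  fixes M :: "'n::{finite,linorder} cmat"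
  assumes "vec.subspace V" "\<And>i. rk i < k \<Longrightarrow> column i M \<in> V"
  shows "(*v) M ` coord_space k \<subseteq> V"
proof -
  have "(*v) M ` coord_space k = vec.span ((*v) M ` (\<lambda>i. axis i 1) ` {i. rk i < k})"
    unfolding coord_space_eq_span by (rule vec.span_image[symmetric])
  also have "\<dots> \<subseteq> V"
    by (rule vec.span_minimal) (use assms in \<open>auto simp: mult_axis\<close>)
  finally show ?thesis .
qed

text \<open>Unit vectors r a in F(k+1) orthogonal to F(k), one for each step, are automatically
  orthonormal. Their existence is kept separate, because they are later replaced by vectors that
  satisfy a reality condition as well.\<close>

lemma adapted_unitary:
  fixes F :: "nat \<Rightarrow> (complex^'n::{finite,linorder}) set"
  assumes sub: "\<And>k. vec.subspace (F k)" and mono: "\<And>k. F k \<subseteq> F (Suc k)"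
    and dim: "\<And>k. k \<le> CARD('n) \<Longrightarrow> vec.dim (F k) = k"
    and r: "\<And>a::'n. r a \<in> F (Suc (rk a))" "\<And>a v. v \<in> F (rk a) \<Longrightarrow> herm (r a) v = 0" "\<And>a. norm (r a) = 1"
  obtains u :: "'n cmat" where "unitary u" "\<And>a. column a u = r a"
    "\<And>k. k \<le> CARD('n) \<Longrightarrow> (*v) u ` coord_space k = F k"
proof -
  define u :: "'n cmat" where "u = (\<chi> i j. r j $ i)"
  have col: "column a u = r a" for a by (simp add: u_def column_def)
  have mono': "F k \<subseteq> F l" if "k \<le> l" for k l
    using that by (induction rule: dec_induct) (use mono in auto)
  have lt: "herm (r b) (r a) = 0" if "a < b" for a b
    using r(2)[of "r a" b] r(1)[of a] mono'[of "Suc (rk a)" "rk b"] that by (auto simp: Suc_le_eq)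
  have uni: "unitary u"
    unfolding unitary_iff_columns col
  proof (intro allI)
    fix i j show "herm (r j) (r i) = (if i = j then 1 else 0)"
      using lt[of i j] lt[of j i] herm_commute[of "r j" "r i"] r(3)[of i]
      by (cases i j rule: linorder_cases) (auto simp: herm_self)
  qed
  show ?thesis
  proof (rule that[OF uni col])
    fix k :: nat assume k: "k \<le> CARD('n)"
    have "(*v) u ` coord_space k \<subseteq> F k"
    proof (rule mult_coord_space_subset[OF sub])
      fix i :: 'n assume "rk i < k"
      then show "column i u \<in> F k" using r(1)[of i] mono'[of "Suc (rk i)" k] by (auto simp: col)
    qed
    then show "(*v) u ` coord_space k = F k"
      by (rule vec.subspace_dim_equal[rotated 2])
        (use sub k in \<open>auto simp: subspace_image_mat subspace_coord_space dim dim_image_mat[OF unitary_invertible[OF uni]] dim_coord_space\<close>)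
  qed
qed

lemma orthonormal_adapted:
  fixes F :: "nat \<Rightarrow> (complex^'n::{finite,linorder}) set"
  assumes sub: "\<And>k. vec.subspace (F k)" and mono: "\<And>k. F k \<subseteq> F (Suc k)"
    and dim: "\<And>k. k \<le> CARD('n) \<Longrightarrow> vec.dim (F k) = k"
  obtains r where "\<And>a::'n. r a \<in> F (Suc (rk a))" "\<And>a v. v \<in> F (rk a) \<Longrightarrow> herm (r a) v = 0"
    "\<And>a. norm (r a) = 1"
proof -
  have "\<exists>r. r \<in> F (Suc (rk a)) \<and> (\<forall>v\<in>F (rk a). herm r v = 0) \<and> norm r = 1" for a :: 'n
  proof -
    have c: "Suc (rk a) \<le> CARD('n)" by (simp add: Suc_leI)
    then have "F (Suc (rk a)) \<noteq> F (rk a)" using dim[of "Suc (rk a)"] dim[of "rk a"] by auto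
    then obtain x where x: "x \<in> F (Suc (rk a))" "x \<notin> F (rk a)" using mono by blast
    obtain p r where pr: "p \<in> F (rk a)" "\<And>v. v \<in> F (rk a) \<Longrightarrow> herm r v = 0" "x = p + r"
      using herm_decomp[OF sub] by metis
    have r: "r \<in> F (Suc (rk a))"
      using pr(1,3) x(1) mono sub vec.subspace_diff[of "F (Suc (rk a))" x p] by auto
    have "r \<noteq> 0" using pr x by auto
    show ?thesis
    proof (intro exI conjI ballI)
      show "complex_of_real (inverse (norm r)) *s r \<in> F (Suc (rk a))"
        using r sub by (rule vec.subspace_scale[rotated])
      show "herm (complex_of_real (inverse (norm r)) *s r) v = 0" if "v \<in> F (rk a)" for v
        using pr(2)[OF that] by (simp add: herm_scale_left)
      show "norm (complex_of_real (inverse (norm r)) *s r) = 1"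
        unfolding scaleR_eq_scale[symmetric] using \<open>r \<noteq> 0\<close> by simp
    qed
  qed
  then show ?thesis using that by metis
qed

lemma gram_schmidt:
  fixes M :: "'n::{finite,linorder} cmat"
  assumes M: "invertible M"
  obtains u where "unitary u" "\<And>k. (*v) u ` coord_space k = (*v) M ` coord_space k"
proof -
  let ?F = "\<lambda>k. (*v) M ` coord_space k"
  have F: "vec.subspace (?F k)" "?F k \<subseteq> ?F (Suc k)" "k \<le> CARD('n) \<Longrightarrow> vec.dim (?F k) = k" for k
    by (auto simp: subspace_image_mat subspace_coord_space dim_image_mat[OF M] dim_coord_space
        intro!: imageI coord_space_mono[THEN subsetD, of k "Suc k"])
  obtain r where r: "\<And>a::'n. r a \<in> ?F (Suc (rk a))" "\<And>a v. v \<in> ?F (rk a) \<Longrightarrow> herm (r a) v = 0"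
    "\<And>a. norm (r a) = 1" using orthonormal_adapted[of ?F, OF F] by metis
  obtain u where u: "unitary u" "\<And>k. k \<le> CARD('n) \<Longrightarrow> (*v) u ` coord_space k = ?F k"
    using adapted_unitary[of ?F, OF F r] by metis
  show ?thesis
  proof (rule that[OF u(1)])
    fix k show "(*v) u ` coord_space k = ?F k"
    \<comment> \<open>Above n the coordinate spaces are constant, so the case k = n decides.\<close>
    proof (cases "k \<le> CARD('n)")
      case False
      then have "coord_space k = (coord_space CARD('n) :: (complex^'n::{finite,linorder}) set)"
        by (simp add: coord_space_CARD)
      then show ?thesis using u(2)[of "CARD('n)"] by simp
    qed (rule u(2))
  qed
qed

section \<open>Block triangular matrices\<close>

definition block_space :: "('n \<Rightarrow> nat) \<Rightarrow> nat \<Rightarrow> (complex^'n) set" where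
  "block_space b m = {v. \<forall>i. m < b i \<longrightarrow> v $ i = 0}"

text \<open>The labelling b is arbitrary so that one notion serves three groups: the parabolic
  (\<open>block_index c\<close>), the Borel group (\<open>rk\<close>), and the conjugate of the
  Borel group by a permutation.\<close>

definition upper :: "('n \<Rightarrow> nat) \<Rightarrow> (complex^'n^'n) set" where
  "upper b = {M. \<forall>i j. b j < b i \<longrightarrow> M $ i $ j = 0}"

lemma subspace_block_space: "vec.subspace (block_space b m)"
  by (auto simp: vec.subspace_def block_space_def)

lemma upper_mat_1 [simp]: "mat 1 \<in> upper b"
  by (auto simp: upper_def mat_def)

lemma upper_mult: "M \<in> upper b \<Longrightarrow> N \<in> upper b \<Longrightarrow> M ** N \<in> upper b"
  by (auto simp: upper_def matrix_matrix_mult_def intro!: sum.neutral)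
    (metis (no_types, lifting) linorder_not_less order_less_le_trans)

lemma upper_iff_image_subset: "M \<in> upper b \<longleftrightarrow> (\<forall>m. (*v) M ` block_space b m \<subseteq> block_space b m)"
proof
  assume M: "M \<in> upper b"
  show "\<forall>m. (*v) M ` block_space b m \<subseteq> block_space b m"
  proof (intro allI subsetI, clarsimp simp: block_space_def)
    fix m i and v :: "complex^'a" assume *: "\<forall>i. m < b i \<longrightarrow> v $ i = 0" "m < b i"
    have "M $ i $ j * v $ j = 0" for j
      using * M by (cases "m < b j") (auto simp: upper_def)
    then show "(M *v v) $ i = 0" by (auto simp: matrix_vector_mult_def intro!: sum.neutral simp del: mult_eq_0_iff)
  qed
next
  assume M: "\<forall>m. (*v) M ` block_space b m \<subseteq> block_space b m"
  show "M \<in> upper b"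
    unfolding upper_def
  proof (clarify)
    fix i j assume "b j < b i"
    moreover have "axis j 1 \<in> block_space b (b j)" by (auto simp: block_space_def axis_def)
    ultimately have "column j M \<in> block_space b (b j)" using M by (force simp flip: mult_axis)
    then show "M $ i $ j = 0" using \<open>b j < b i\<close> by (simp add: block_space_def column_def)
  qed
qed

lemma upper_image_eq:
  assumes "invertible M" "M \<in> upper b"
  shows "(*v) M ` block_space b m = block_space b m"
  by (rule vec.subspace_dim_equal)
    (use assms in \<open>auto simp: subspace_block_space subspace_image_mat dim_image_mat upper_iff_image_subset\<close>)

text \<open>Being block upper means preserving every block space. By dimension an invertible matrix
  maps each of them onto itself, hence so does its inverse; no entry of the inverse has to be
  computed.\<close>

lemma upper_matrix_inv:
  assumes "invertible M" "M \<in> upper b"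
  shows "matrix_inv M \<in> upper b"
  unfolding upper_iff_image_subset
  using upper_image_eq[OF assms] image_mat_eq_iff[OF assms(1)] by (metis order_refl)

section \<open>Flag manifolds: transitivity, topology, holomorphic charts\<close>

section \<open>The action on flags\<close>

lemma partial_sum_0 [simp]: "partial_sum c 0 = 0" by (simp add: partial_sum_def)

lemma partial_sum_Suc: "k < length c \<Longrightarrow> partial_sum c (Suc k) = partial_sum c k + c ! k"
  by (simp add: partial_sum_def take_Suc_conv_app_nth)

lemma partial_sum_mono: "k \<le> l \<Longrightarrow> partial_sum c k \<le> partial_sum c l"
proof (induction l rule: dec_induct)
  case (step l)
  have "partial_sum c l \<le> partial_sum c (Suc l)"
    by (cases "l < length c") (simp_all add: partial_sum_Suc, simp add: partial_sum_def)
  with step show ?case by linarith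
qed simp

lemma partial_sum_length: "length c \<le> k \<Longrightarrow> partial_sum c k = sum_list c"
  by (simp add: partial_sum_def)

lemma partial_sum_le_sum: "partial_sum c k \<le> sum_list c"
  by (metis linorder_linear partial_sum_length partial_sum_mono)

lemma partial_sum_strict_mono: "0 \<notin> set c \<Longrightarrow> k < l \<Longrightarrow> l \<le> length c \<Longrightarrow> partial_sum c k < partial_sum c l"
proof -
  assume *: "0 \<notin> set c" "k < l" "l \<le> length c"
  have "partial_sum c k < partial_sum c (Suc k)"
    using * nth_mem[of k c] by (cases "c ! k = 0") (auto simp: partial_sum_Suc)
  also have "\<dots> \<le> partial_sum c l" using * by (intro partial_sum_mono) simp
  finally show ?thesis .
qed

lemma act_length [simp]: "length (act g V) = length V" by (simp add: act_def)
lemma act_nth [simp]: "i < length V \<Longrightarrow> act g V ! i = (*v) g ` (V ! i)" by (simp add: act_def)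

lemma act_act: "act g (act h V) = act (g ** h) V"
  by (auto simp: act_def image_image matrix_vector_mul_assoc)

lemma act_mat_1 [simp]: "act (mat 1) V = V" by (simp add: act_def)

lemma act_in_flags: "invertible g \<Longrightarrow> V \<in> flags c \<Longrightarrow> act g V \<in> flags c"
  by (auto simp: flags_def subspace_image_mat dim_image_mat sorted_wrt_iff_nth_less image_mono)

lemma rk_nth_sorted_list:
  assumes "k < CARD('n)"
  shows "rk (sorted_list_of_set (UNIV :: 'n::{finite,linorder} set) ! k) = k"
proof -
  let ?L = "sorted_list_of_set (UNIV :: 'n set)"
  have s: "sorted_wrt (<) ?L" by simp
  have "{i. i < ?L ! k} = (!) ?L ` {..<k}"
  proof (intro set_eqI iffI)
    fix i :: 'n assume "i \<in> {i. i < ?L ! k}"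
    moreover obtain q where q: "q < length ?L" "i = ?L ! q"
      by (metis UNIV_I finite in_set_conv_nth set_sorted_list_of_set)
    moreover have "\<not> k \<le> q"
      using calculation sorted_nth_mono[of ?L k q] by auto
    ultimately show "i \<in> (!) ?L ` {..<k}" by auto
  qed (use s assms in \<open>auto simp: sorted_wrt_iff_nth_less\<close>)
  moreover have "inj_on ((!) ?L) {..<k}"
    using assms by (intro inj_on_nth) auto
  ultimately show ?thesis by (simp add: rk_def card_image)
qed

lemma set_take_sorted_list:
  assumes "k \<le> CARD('n)"
  shows "set (take k (sorted_list_of_set (UNIV :: 'n::{finite,linorder} set))) = {i. rk i < k}"
proof (rule card_subset_eq)
  let ?L = "sorted_list_of_set (UNIV :: 'n set)"
  show "set (take k ?L) \<subseteq> {i. rk i < k}"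
  proof
    fix x assume "x \<in> set (take k ?L)"
    then obtain q where "q < k" "x = ?L ! q" by (auto simp: in_set_conv_nth)
    then show "x \<in> {i. rk i < k}" using assms rk_nth_sorted_list[of q, where 'n='n] by simp
  qed
  have "card (set (take k ?L)) = k"
    using assms by (subst distinct_card) (auto simp: min_def)
  then show "card (set (take k ?L)) = card {i::'n. rk i < k}" using card_rk_less[OF assms] by simp
qed simp

lemma length_base_flag [simp]: "length (base_flag c) = length c"
  by (simp add: base_flag_def coord_flag_def)

lemma length_coord_flag [simp]: "length (coord_flag c w) = length c"
  by (simp add: coord_flag_def)

lemma dim_seq_sum: "dim_seq TYPE('n::finite) c \<Longrightarrow> sum_list c = CARD('n)"
  and dim_seq_pos: "dim_seq TYPE('n::finite) c \<Longrightarrow> 0 \<notin> set c"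
  by (auto simp: dim_seq_def)

lemma partial_sum_le_CARD: "dim_seq TYPE('n::finite) c \<Longrightarrow> partial_sum c k \<le> CARD('n)"
  by (metis dim_seq_sum partial_sum_le_sum)

lemma base_flag_nth:
  assumes "dim_seq TYPE('n) c" "m < length c"
  shows "(base_flag c :: 'n::{finite,linorder} flag) ! m = coord_space (partial_sum c (Suc m))"
  using assms(2) set_take_sorted_list[OF partial_sum_le_CARD[OF assms(1)]]
  by (simp add: base_flag_def coord_flag_def coord_space_eq_span)

lemma block_index_le_iff:
  fixes i :: "'n::{finite,linorder}"
  assumes "dim_seq TYPE('n) c"
  shows "block_index c i \<le> m \<longleftrightarrow> rk i < partial_sum c (Suc m)"
proof
  have "rk i < partial_sum c (Suc (length c))"
    using assms by (simp add: partial_sum_length dim_seq_sum)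
  then have ex: "rk i < partial_sum c (Suc (block_index c i))"
    unfolding block_index_def rk_def[symmetric] by (rule LeastI)
  show "rk i < partial_sum c (Suc m)" if "block_index c i \<le> m"
    using ex partial_sum_mono[of "Suc (block_index c i)" "Suc m" c] that by simp
  show "block_index c i \<le> m" if "rk i < partial_sum c (Suc m)"
    unfolding block_index_def rk_def[symmetric] using that by (rule Least_le)
qed

lemma block_index_less_length:
  fixes i :: "'n::{finite,linorder}"
  assumes "dim_seq TYPE('n) c"
  shows "block_index c i < length c"
proof -
  have "length c > 0" using assms by (auto simp: dim_seq_def)
  then have "rk i < partial_sum c (Suc (length c - 1))"
    using assms by (simp add: partial_sum_length dim_seq_sum)
  then have "block_index c i \<le> length c - 1" using block_index_le_iff[OF assms] by blast
  then show ?thesis using \<open>length c > 0\<close> by linarith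
qed

lemma coord_space_partial_sum:
  assumes "dim_seq TYPE('n::{finite,linorder}) c"
  shows "coord_space (partial_sum c (Suc m)) = block_space (block_index c :: 'n \<Rightarrow> nat) m"
proof -
  have "m < block_index c i \<longleftrightarrow> partial_sum c (Suc m) \<le> rk i" for i :: 'n
    using block_index_le_iff[OF assms, of i m] by linarith
  then show ?thesis unfolding coord_space_def block_space_def by simp
qed

text \<open>Identifies flags with cosets of the stabilizer of the base flag, taken among all
  invertible matrices rather than in \<open>SL_complex\<close>.\<close>

lemma act_base_flag_eq_iff:
  fixes M N :: "'n::{finite,linorder} cmat"
  assumes c: "dim_seq TYPE('n) c" and M: "invertible M" and N: "invertible N"
  shows "act M (base_flag c) = act N (base_flag c) \<longleftrightarrow> matrix_inv M ** N \<in> upper (block_index c)"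
proof -
  let ?b = "block_index c :: 'n \<Rightarrow> nat"
  have I: "invertible (matrix_inv M ** N)"
    using M N by (simp add: invertible_mult_iff invertible_matrix_inv)
  have "act M (base_flag c) = act N (base_flag c) \<longleftrightarrow>
      (\<forall>m<length c. (*v) M ` block_space ?b m = (*v) N ` block_space ?b m)"
    by (simp add: list_eq_iff_nth_eq base_flag_nth[OF c] coord_space_partial_sum[OF c])
  also have "\<dots> \<longleftrightarrow> (\<forall>m<length c. (*v) (matrix_inv M ** N) ` block_space ?b m = block_space ?b m)"
    by (simp add: image_mat_eq_iff[OF M] image_image_mat eq_commute)
  also have "\<dots> \<longleftrightarrow> matrix_inv M ** N \<in> upper ?b"
  proof
    assume *: "\<forall>m<length c. (*v) (matrix_inv M ** N) ` block_space ?b m = block_space ?b m"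
    show "matrix_inv M ** N \<in> upper ?b"
      unfolding upper_iff_image_subset
    proof
      fix m
      show "(*v) (matrix_inv M ** N) ` block_space ?b m \<subseteq> block_space ?b m"
      \<comment> \<open>Only labels below \<open>length c\<close> occur, so from there on the block
        space is the whole space.\<close>
      proof (cases "m < length c")
        case False
        then have "\<not> m < ?b i" for i using block_index_less_length[OF c, of i] by simp
        then show ?thesis by (auto simp: block_space_def)
      qed (use * in simp)
    qed
  qed (use upper_image_eq[OF I] in auto)
  finally show ?thesis .
qed

lemma act_base_flag_upper:
  fixes M N :: "'n::{finite,linorder} cmat"
  assumes "dim_seq TYPE('n) c" "invertible N" "N \<in> upper (block_index c)"
  shows "act (M ** N) (base_flag c) = act M (base_flag c)"
proof -
  have "act N (base_flag c) = act (mat 1) (base_flag c :: 'n flag)"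
    by (rule act_base_flag_eq_iff[THEN iffD2]) (use assms upper_matrix_inv in auto)
  then show ?thesis by (metis act_act matrix_mul_rid)
qed

lemma base_flag_in_flags:
  assumes "dim_seq TYPE('n) c"
  shows "(base_flag c :: 'n::{finite,linorder} flag) \<in> flags c"
proof -
  have "(base_flag c :: 'n flag) ! i \<subseteq> base_flag c ! j" if "i < j" "j < length c" for i j
    using that by (simp add: base_flag_nth[OF assms] coord_space_mono partial_sum_mono)
  then show ?thesis
    by (simp add: flags_def base_flag_nth[OF assms] subspace_coord_space
        dim_coord_space[OF partial_sum_le_CARD[OF assms]] sorted_wrt_iff_nth_less)
qed

lemma set_take_nth: "k \<le> length xs \<Longrightarrow> set (take k xs) = (!) xs ` {..<k}"
  by (metis atLeast0LessThan nth_image)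

lemma matrix_of_list:
  fixes us :: "(complex^'n::{finite,linorder}) list"
  assumes "length us = CARD('n)" "vec.independent (set us)" "distinct us"
  obtains M :: "'n cmat" where "invertible M" "\<And>k. k \<le> CARD('n) \<Longrightarrow> (*v) M ` coord_space k = vec.span (set (take k us))"
proof -
  define M :: "'n cmat" where "M = (\<chi> i j. (us ! rk j) $ i)"
  have col: "column j M = us ! rk j" for j by (simp add: M_def column_def)
  have im: "(*v) M ` coord_space k = vec.span (set (take k us))" if k: "k \<le> CARD('n)" for k
  proof -
    have "(*v) M ` (\<lambda>i. axis i 1) ` {i. rk i < k} = (!) us ` rk ` {i::'n. rk i < k}"
      by (simp add: image_image mult_axis col)
    also have "\<dots> = set (take k us)" using k assms(1) by (simp add: rk_image set_take_nth)
    finally show ?thesis by (simp add: coord_space_eq_span flip: vec.span_image)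
  qed
  have "vec.dim (vec.span (set us)) = CARD('n)"
    using vec.dim_span_eq_card_independent[OF assms(2)] assms by (simp add: distinct_card)
  then have "vec.span (set us) = UNIV"
    using dim_coord_space[of "CARD('n)", where 'n='n]
    by (intro vec.subspace_dim_equal) (auto simp: coord_space_CARD)
  then have "surj ((*v) M)" using im[of "CARD('n)"] assms(1) by (simp add: coord_space_CARD)
  then have "invertible M"
    by (metis invertible_right_inverse matrix_right_invertible_surjective)
  then show ?thesis using im that by blast
qed

text \<open>A basis of each member is extended to a basis of the next; the vectors obtained, in this
  order, are the columns of M.\<close>

lemma flags_transitive:
  fixes V :: "'n::{finite,linorder} flag"
  assumes c: "dim_seq TYPE('n) c" and V: "V \<in> flags c"
  obtains M where "invertible M" "V = act M (base_flag c)"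
proof -
  have len: "length V = length c" and sub: "\<And>i. i < length c \<Longrightarrow> vec.subspace (V ! i)"
    and dim: "\<And>i. i < length c \<Longrightarrow> vec.dim (V ! i) = partial_sum c (Suc i)"
    and mono: "\<And>i j. i < j \<Longrightarrow> j < length c \<Longrightarrow> V ! i \<subseteq> V ! j"
    using V by (auto simp: flags_def sorted_wrt_iff_nth_less)
  have "i \<le> length c \<Longrightarrow> \<exists>us. distinct us \<and> vec.independent (set us) \<and> length us = partial_sum c i \<and>
      (\<forall>j<i. vec.span (set (take (partial_sum c (Suc j)) us)) = V ! j)" for i
  proof (induction i)
    case 0
    show ?case by (intro exI[of _ "[]"]) (auto simp: vec.independent_empty)
  next
    case (Suc i)
    then obtain us where us: "distinct us" "vec.independent (set us)" "length us = partial_sum c i"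
      "\<And>j. j < i \<Longrightarrow> vec.span (set (take (partial_sum c (Suc j)) us)) = V ! j" by auto
    have i: "i < length c" using Suc by simp
    have "set us \<subseteq> V ! i"
    proof (cases i)
      case 0 then show ?thesis using us(3) by simp
    next
      case (Suc k)
      then have "set us \<subseteq> V ! k" using us(3) us(4)[of k] vec.span_superset[of "set us"] by simp
      then show ?thesis using mono[of k i] Suc i by auto
    qed
    then obtain B where B: "set us \<subseteq> B" "B \<subseteq> V ! i" "vec.independent B" "V ! i \<subseteq> vec.span B"
      using vec.maximal_independent_subset_extend[OF _ us(2)] by metis
    have finB: "finite B" using B(3) by (rule vec.finiteI_independent)
    obtain ws where ws: "set ws = B - set us" "distinct ws"
      using finite_distinct_list[of "B - set us"] finB by auto
    have spB: "vec.span B = V ! i" using B(2,4) sub[OF i] by (rule vec.span_subspace)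
    then have cardB: "card B = partial_sum c (Suc i)"
      using dim[OF i] vec.dim_span_eq_card_independent[OF B(3)] by simp
    have all: "set (us @ ws) = B" "distinct (us @ ws)" using us(1) ws B(1) by auto
    then have lenw: "length (us @ ws) = partial_sum c (Suc i)" using cardB distinct_card by metis
    show ?case
    proof (intro exI conjI allI impI)
      show "vec.independent (set (us @ ws))" using B(3) all(1) by simp
      fix j assume j: "j < Suc i"
      show "vec.span (set (take (partial_sum c (Suc j)) (us @ ws))) = V ! j"
      proof (cases "j = i")
        case True
        then show ?thesis using lenw all(1) spB by simp
      next
        case False
        then have "partial_sum c (Suc j) \<le> length us" using j us(3) by (simp add: partial_sum_mono)
        then show ?thesis using us(4)[of j] False j by simp
      qed
    qed (use all lenw in auto)
  qed
  from this[of "length c"] obtain us where us: "distinct us" "vec.independent (set us)"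
    "length us = partial_sum c (length c)"
    "\<And>j. j < length c \<Longrightarrow> vec.span (set (take (partial_sum c (Suc j)) us)) = V ! j" by auto
  have "length us = CARD('n)" using us(3) c by (simp add: partial_sum_length dim_seq_sum)
  then obtain M :: "'n cmat" where M: "invertible M"
    "\<And>k. k \<le> CARD('n) \<Longrightarrow> (*v) M ` coord_space k = vec.span (set (take k us))"
    using matrix_of_list us(1,2) by metis
  have "V = act M (base_flag c)"
    by (rule nth_equalityI) (auto simp: len base_flag_nth[OF c] M(2) us(4) partial_sum_le_CARD[OF c])
  with M(1) show ?thesis by (rule that)
qed

text \<open>Rescaling the first column normalizes the determinant without moving the base flag.\<close>

definition first_scaling :: "complex \<Rightarrow> 'n::{finite,linorder} cmat" where
  "first_scaling s = (\<chi> i j. if i = j then if rk i = 0 then s else 1 else 0)"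

lemma det_first_scaling: "det (first_scaling s :: 'n::{finite,linorder} cmat) = s"
proof -
  obtain a :: 'n where a: "rk a = 0" using rk_surj[of 0, where 'n='n] by auto
  have "det (first_scaling s :: 'n cmat) = (\<Prod>i\<in>(UNIV::'n set). first_scaling s $ i $ i)"
    by (rule det_diagonal) (simp add: first_scaling_def)
  also have "\<dots> = (\<Prod>i\<in>(UNIV::'n set). if i = a then s else 1)"
    by (rule prod.cong) (auto simp: first_scaling_def a dest: sym, metis a rk_inject)
  finally show ?thesis by simp
qed

lemma first_scaling_upper: "first_scaling s \<in> upper b"
  by (auto simp: first_scaling_def upper_def)

text \<open>Topology and submanifolds are defined through \<open>SL_complex\<close>, whereas
  constructions produce merely invertible matrices. This passes from the latter to the former with
  the same image of the base flag.\<close>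

definition normalize_det :: "'n::{finite,linorder} cmat \<Rightarrow> 'n cmat" where
  "normalize_det M = M ** first_scaling (1 / det M)"

lemma normalize_det_SL: "invertible M \<Longrightarrow> normalize_det M \<in> SL_complex"
  by (simp add: normalize_det_def SL_complex_def det_mul det_first_scaling invertible_det_nz)

lemma SL_invertible: "M \<in> SL_complex \<Longrightarrow> invertible M"
  by (simp add: SL_complex_def invertible_det_nz)

lemma act_normalize_det:
  fixes M :: "'n::{finite,linorder} cmat"
  assumes "dim_seq TYPE('n) c" "invertible M"
  shows "act (normalize_det M) (base_flag c) = act M (base_flag c)"
  unfolding normalize_det_def
  by (rule act_base_flag_upper) (use assms in \<open>auto simp: first_scaling_upper invertible_det_nz det_first_scaling\<close>)

section \<open>Analysis of matrix products and inverses\<close>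

lemma bounded_bilinear_matrix_mult: "bounded_bilinear ((**) :: complex^'n^'n \<Rightarrow> complex^'n^'n \<Rightarrow> complex^'n^'n)"
  unfolding bilinear_conv_bounded_bilinear[symmetric] bilinear_def
  by (auto intro!: linearI simp: matrix_add_ldistrib vec_eq_iff matrix_matrix_mult_def algebra_simps
      sum.distrib scaleR_sum_right)

interpretation matrix_mult: bounded_bilinear "(**) :: complex^'n^'n \<Rightarrow> complex^'n^'n \<Rightarrow> complex^'n^'n"
  by (rule bounded_bilinear_matrix_mult)

lemma bounded_linear_matrix: "linear f \<Longrightarrow> bounded_linear f"
  for f :: "'a::euclidean_space \<Rightarrow> 'b::euclidean_space"
  by (simp add: linear_conv_bounded_linear)

lemma continuous_on_det: "continuous_on A (det :: complex^'n^'n \<Rightarrow> complex)"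
  unfolding det_def by (intro continuous_intros)

lemma open_invertible: "open {M :: complex^'n^'n. invertible M}"
proof -
  have "{M :: complex^'n^'n. invertible M} = det -` (- {0}) \<inter> UNIV"
    by (auto simp: invertible_det_nz)
  then show ?thesis
    using continuous_open_preimage[OF continuous_on_det open_UNIV, of "- {0 :: complex}"] by (simp add: open_Compl)
qed

text \<open>With N the inverse of M one has N = 1 - N(M - 1). Near the identity this bounds N, and
  then N - 1 is a bounded factor times a null one.\<close>

lemma tendsto_matrix_inv_1:
  fixes M :: "'a \<Rightarrow> complex^'n^'n"
  assumes M: "(M \<longlongrightarrow> mat 1) F"
  shows "((\<lambda>t. matrix_inv (M t)) \<longlongrightarrow> mat 1) F"
proof -
  obtain K where K: "K > 0" "\<And>(a :: complex^'n^'n) (b :: complex^'n^'n). norm (a ** b) \<le> norm a * norm b * K"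
    using matrix_mult.pos_bounded by metis
  have inv: "\<forall>\<^sub>F t in F. invertible (M t)"
    using topological_tendstoD[OF M open_invertible] by (simp add: invertible_mat_1)
  \<comment> \<open>K bounds matrix multiplication as a bilinear map; the radius is chosen so that
    the term N(M - 1) has at most half the norm of N and can be absorbed.\<close>
  have "\<forall>\<^sub>F t in F. dist (M t) (mat 1) < 1 / (2 * K)"
    using M K(1) by (intro tendstoD) auto
  then have near: "\<forall>\<^sub>F t in F. norm (M t - mat 1) * K \<le> 1 / 2"
    by eventually_elim (use K(1) in \<open>simp add: dist_norm field_simps\<close>)
  have bound: "\<forall>\<^sub>F t in F. norm (matrix_inv (M t)) \<le> 2 * norm (mat 1 :: complex^'n^'n)"
    using inv near
  proof eventually_elim
    fix t assume t: "invertible (M t)" "norm (M t - mat 1) * K \<le> 1 / 2"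
    have "matrix_inv (M t) = mat 1 - matrix_inv (M t) ** (M t - mat 1)"
      using t(1) by (simp add: matrix_mult.diff_right matrix_inv_left)
    then have "norm (matrix_inv (M t)) \<le> norm (mat 1 :: complex^'n^'n) + norm (matrix_inv (M t) ** (M t - mat 1))"
      by (metis norm_triangle_ineq4)
    also have "norm (matrix_inv (M t) ** (M t - mat 1)) \<le> norm (matrix_inv (M t)) * (norm (M t - mat 1) * K)"
      using K(2) by (simp add: mult.assoc)
    also have "\<dots> \<le> norm (matrix_inv (M t)) * (1 / 2)"
      using t(2) by (intro mult_left_mono) auto
    finally show "norm (matrix_inv (M t)) \<le> 2 * norm (mat 1 :: complex^'n^'n)" by simp
  qed
  have "Bfun (\<lambda>t. matrix_inv (M t)) F" using bound by (rule BfunI)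
  moreover have "((\<lambda>t. M t - mat 1) \<longlongrightarrow> 0) F" using M by (simp add: LIM_zero_iff)
  ultimately have "((\<lambda>t. matrix_inv (M t) ** (M t - mat 1)) \<longlongrightarrow> 0) F"
    unfolding tendsto_Zfun_iff diff_zero by (rule matrix_mult.Bfun_prod_Zfun)
  then have "((\<lambda>t. mat 1 - matrix_inv (M t) ** (M t - mat 1)) \<longlongrightarrow> mat 1 - 0) F"
    by (intro tendsto_intros)
  then have "((\<lambda>t. mat 1 - matrix_inv (M t) ** (M t - mat 1)) \<longlongrightarrow> mat 1) F" by simp
  then show ?thesis
    by (rule Lim_transform_eventually)
      (use inv in \<open>eventually_elim, simp add: matrix_mult.diff_right matrix_inv_left\<close>)
qed

lemma tendsto_matrix_inv:
  fixes M :: "'a \<Rightarrow> complex^'n^'n"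
  assumes M: "(M \<longlongrightarrow> N) F" and N: "invertible N"
  shows "((\<lambda>t. matrix_inv (M t)) \<longlongrightarrow> matrix_inv N) F"
proof -
  have inv: "\<forall>\<^sub>F t in F. invertible (M t)"
    using topological_tendstoD[OF M open_invertible] N by simp
  have "((\<lambda>t. matrix_inv N ** M t) \<longlongrightarrow> matrix_inv N ** N) F"
    by (intro matrix_mult.tendsto tendsto_const M)
  then have "((\<lambda>t. matrix_inv (matrix_inv N ** M t) ** matrix_inv N) \<longlongrightarrow> mat 1 ** matrix_inv N) F"
    using N by (intro matrix_mult.tendsto tendsto_const tendsto_matrix_inv_1) (simp add: matrix_inv_left)
  then have "((\<lambda>t. matrix_inv (matrix_inv N ** M t) ** matrix_inv N) \<longlongrightarrow> matrix_inv N) F" by simp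
  then show ?thesis
  proof (rule Lim_transform_eventually)
    show "\<forall>\<^sub>F t in F. matrix_inv (matrix_inv N ** M t) ** matrix_inv N = matrix_inv (M t)"
      using inv
    proof eventually_elim
      fix t assume "invertible (M t)"
      then have "matrix_inv (matrix_inv N ** M t) = matrix_inv (M t) ** N"
        using N by (simp add: matrix_inv_mult invertible_matrix_inv matrix_inv_inv)
      then show "matrix_inv (matrix_inv N ** M t) ** matrix_inv N = matrix_inv (M t)"
        using N by (simp add: matrix_mul_assoc[symmetric] matrix_inv_right)
    qed
  qed
qed

lemma continuous_on_matrix_inv: "continuous_on {M :: complex^'n^'n. invertible M} matrix_inv"
  by (auto simp: continuous_on intro!: tendsto_matrix_inv)

section \<open>Block LU factorization\<close>

definition lower :: "('n \<Rightarrow> nat) \<Rightarrow> (complex^'n^'n) set" where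
  "lower b = {X. \<forall>i j. b i \<le> b j \<longrightarrow> X $ i $ j = 0}"

text \<open>The projection onto \<open>lower b\<close> along \<open>upper b\<close>. It will turn
  out to be the derivative at the identity of the unipotent factor of the block LU
  factorization.\<close>

definition low :: "('n \<Rightarrow> nat) \<Rightarrow> complex^'n^'n \<Rightarrow> complex^'n^'n" where
  "low b M = (\<chi> i j. if b j < b i then M $ i $ j else 0)"

lemma low_in_lower [simp]: "low b M \<in> lower b" by (simp add: low_def lower_def)
lemma low_lower [simp]: "X \<in> lower b \<Longrightarrow> low b X = X" by (auto simp: low_def lower_def vec_eq_iff)
lemma low_upper [simp]: "M \<in> upper b \<Longrightarrow> low b M = 0" by (auto simp: low_def upper_def vec_eq_iff)
lemma diff_low_upper: "M - low b M \<in> upper b" by (auto simp: low_def upper_def)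
lemma linear_low: "linear (low b)" by (rule linearI) (auto simp: low_def vec_eq_iff)
lemma bounded_linear_low: "bounded_linear (low b)" by (rule bounded_linear_matrix[OF linear_low])
lemma low_add: "low b (M + N) = low b M + low b N" by (rule linear_add[OF linear_low])
lemma lower_0 [simp]: "0 \<in> lower b" by (simp add: lower_def)
lemma lower_add: "X \<in> lower b \<Longrightarrow> Y \<in> lower b \<Longrightarrow> X + Y \<in> lower b" by (simp add: lower_def)
lemma lower_diff: "X \<in> lower b \<Longrightarrow> Y \<in> lower b \<Longrightarrow> X - Y \<in> lower b" by (simp add: lower_def)
lemma upper_add: "X \<in> upper b \<Longrightarrow> Y \<in> upper b \<Longrightarrow> X + Y \<in> upper b" by (simp add: upper_def)
lemma upper_diff: "X \<in> upper b \<Longrightarrow> Y \<in> upper b \<Longrightarrow> X - Y \<in> upper b" by (simp add: upper_def)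

lemma lower_mult:
  assumes "X \<in> lower b" "Y \<in> lower b" shows "X ** Y \<in> lower b"
proof -
  have "X $ i $ k * Y $ k $ j = 0" if "b i \<le> b j" for i j k
    using assms that by (cases "b i \<le> b k") (auto simp: lower_def)
  then show ?thesis by (auto simp: lower_def matrix_matrix_mult_def intro!: sum.neutral simp del: mult_eq_0_iff)
qed

lemma lower_upper_disjoint: "X \<in> lower b \<Longrightarrow> X \<in> upper b \<Longrightarrow> X = 0"
  by (metis low_lower low_upper)

text \<open>The entries of a vector in the kernel vanish block by block, starting from the smallest
  label.\<close>

lemma invertible_unipotent:
  assumes X: "X \<in> lower b" shows "invertible (mat 1 + X)"
proof -
  have "v = 0" if v: "(mat 1 + X) *v v = 0" for v
  proof -
    have "\<forall>i. b i = m \<longrightarrow> v $ i = 0" for m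
    proof (induction m rule: less_induct)
      case (less m)
      show ?case
      proof (intro allI impI)
        fix i assume i: "b i = m"
        have "X $ i $ j * v $ j = 0" for j
          using X less i by (cases "b j < b i") (auto simp: lower_def)
        then have "(X *v v) $ i = 0" by (auto simp: matrix_vector_mult_def intro!: sum.neutral simp del: mult_eq_0_iff)
        moreover have "((mat 1 + X) *v v) $ i = v $ i + (X *v v) $ i"
          by (simp add: matrix_vector_mult_add_rdistrib)
        ultimately show "v $ i = 0" using v by simp
      qed
    qed
    then show ?thesis by (simp add: vec_eq_iff)
  qed
  then show ?thesis by (metis invertible_left_inverse matrix_left_invertible_ker)
qed

text \<open>The inverse Y satisfies Y = 1 - XY. Row i of XY involves only rows of Y with a smaller
  label, so the vanishing of entries propagates by induction on the label of the row.\<close>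

lemma unipotent_inverse:
  assumes X: "X \<in> lower b" shows "matrix_inv (mat 1 + X) - mat 1 \<in> lower b"
proof -
  define Y where "Y = matrix_inv (mat 1 + X)"
  have Y: "Y = mat 1 - X ** Y"
    using matrix_inv_right[OF invertible_unipotent[OF X]]
    by (simp add: Y_def matrix_mult.add_left algebra_simps)
  have "\<forall>i j. b i = m \<longrightarrow> b i \<le> b j \<longrightarrow> (X ** Y) $ i $ j = 0" for m
  proof (induction m rule: less_induct)
    case (less m)
    show ?case
    proof (intro allI impI)
      fix i j assume i: "b i = m" "b i \<le> b j"
      have "X $ i $ k * Y $ k $ j = 0" for k
      proof (cases "b k < b i")
        case True
        then have "(X ** Y) $ k $ j = 0" using less i by auto
        moreover have "Y $ k $ j = mat 1 $ k $ j - (X ** Y) $ k $ j" by (subst Y) simp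
        moreover have "k \<noteq> j" using True i by auto
        ultimately show ?thesis by (simp add: mat_def)
      qed (use X in \<open>auto simp: lower_def\<close>)
      then show "(X ** Y) $ i $ j = 0" by (auto simp: matrix_matrix_mult_def intro!: sum.neutral simp del: mult_eq_0_iff)
    qed
  qed
  then have "X ** Y \<in> lower b" by (auto simp: lower_def)
  moreover have "Y - mat 1 = 0 - X ** Y" by (subst Y) simp
  ultimately show ?thesis using lower_diff[of 0] by (simp add: Y_def)
qed

text \<open>The quotient of the two unipotent factors equals a quotient of the two upper ones. It is
  thus block lower unipotent and block upper at once, hence the identity.\<close>

lemma unipotent_upper_unique:
  assumes X: "X \<in> lower b" "X' \<in> lower b" and p: "p \<in> upper b" "p' \<in> upper b" "invertible p"
    and eq: "(mat 1 + X) ** p = (mat 1 + X') ** p'"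
  shows "X = X'"
proof -
  define Z where "Z = matrix_inv (mat 1 + X') - mat 1"
  have Z: "Z \<in> lower b" unfolding Z_def by (rule unipotent_inverse[OF X(2)])
  have "(mat 1 + Z) ** (mat 1 + X') = mat 1"
    by (simp add: Z_def matrix_inv_left invertible_unipotent[OF X(2)])
  then have ZX: "(mat 1 + Z) ** ((mat 1 + X') ** W) = W" for W by (simp add: matrix_mul_assoc)
  have "(mat 1 + Z) ** (mat 1 + X) = (mat 1 + Z) ** (mat 1 + X) ** p ** matrix_inv p"
    using p(3) by (simp add: matrix_mul_assoc[symmetric] matrix_inv_right)
  also have "\<dots> = p' ** matrix_inv p"
    by (simp add: matrix_mul_assoc[symmetric] eq ZX)
  also have "\<dots> \<in> upper b" by (intro upper_mult upper_matrix_inv p)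
  finally have U: "(mat 1 + Z) ** (mat 1 + X) - mat 1 \<in> upper b" by (simp add: upper_diff)
  have "(mat 1 + Z) ** (mat 1 + X) - mat 1 = Z + X + Z ** X"
    by (simp add: matrix_mult.add_left matrix_mult.add_right)
  moreover have "Z + X + Z ** X \<in> lower b" using Z X by (intro lower_add lower_mult)
  ultimately have "(mat 1 + Z) ** (mat 1 + X) = mat 1"
    using U lower_upper_disjoint by (metis eq_iff_diff_eq_0)
  then show ?thesis using ZX[of "mat 1"]
    by (metis add_left_imp_eq matrix_left_right_inverse matrix_mul_rid matrix_mul_assoc matrix_mul_lid)
qed

definition big_cell :: "('n \<Rightarrow> nat) \<Rightarrow> (complex^'n^'n) set" where
  "big_cell b = {(mat 1 + X) ** p | X p. X \<in> lower b \<and> p \<in> upper b \<and> invertible p}"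

definition low_factor :: "('n \<Rightarrow> nat) \<Rightarrow> complex^'n^'n \<Rightarrow> complex^'n^'n" where
  "low_factor b M = (THE X. X \<in> lower b \<and> (\<exists>p. p \<in> upper b \<and> invertible p \<and> M = (mat 1 + X) ** p))"

lemma low_factor_eq:
  assumes "X \<in> lower b" "p \<in> upper b" "invertible p"
  shows "low_factor b ((mat 1 + X) ** p) = X"
  unfolding low_factor_def
proof (rule the_equality)
  fix X' assume "X' \<in> lower b \<and> (\<exists>q. q \<in> upper b \<and> invertible q \<and> (mat 1 + X) ** p = (mat 1 + X') ** q)"
  then show "X' = X" using unipotent_upper_unique[OF assms(1) _ assms(2) _ assms(3)] by metis
qed (use assms in blast)

lemma big_cellI:
  "X \<in> lower b \<Longrightarrow> p \<in> upper b \<Longrightarrow> invertible p \<Longrightarrow> (mat 1 + X) ** p \<in> big_cell b"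
  unfolding big_cell_def by blast

lemma big_cellE:
  assumes "M \<in> big_cell b"
  obtains p where "low_factor b M \<in> lower b" "p \<in> upper b" "invertible p" "M = (mat 1 + low_factor b M) ** p"
  using assms low_factor_eq unfolding big_cell_def by fastforce

lemma big_cell_invertible: "M \<in> big_cell b \<Longrightarrow> invertible M"
  by (auto simp: big_cell_def invertible_mult_iff invertible_unipotent)

text \<open>\<Phi> multiplies the two pieces of the additive decomposition of M into 1 plus its
  lower part and its upper part. Its derivative at the identity is the identity, so its image
  contains a neighbourhood of 1. Its inverse g is explicit: it adds the lower part and the upper
  factor of N. The inverse function theorem differentiates g, and the lower part of g N is
  \<open>low_factor b N\<close>.\<close>

lemma low_factor_local:
  "\<exists>U. open U \<and> mat 1 \<in> U \<and> U \<subseteq> big_cell b" "(low_factor b has_derivative low b) (at (mat 1))"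
proof -
  let ?u = "\<lambda>M. M - low b M"
  define \<Phi> where "\<Phi> M = (mat 1 + low b M) ** ?u M" for M
  define g where "g N = low_factor b N + matrix_inv (mat 1 + low_factor b N) ** N" for N
  define S where "S = {M. invertible (?u M)}"
  have contl: "continuous_on A (low b)" for A
    by (rule linear_continuous_on[OF bounded_linear_low])
  have S: "open S"
  proof -
    have "S = ?u -` {M. invertible M}" by (auto simp: S_def)
    moreover have "continuous_on UNIV ?u" by (intro continuous_intros contl)
    ultimately show ?thesis using open_invertible open_vimage by blast
  qed
  have S1: "mat 1 \<in> S" by (simp add: S_def)
  have gN: "g N = X + p" if "N = (mat 1 + X) ** p" "X \<in> lower b" "p \<in> upper b" "invertible p" for N X p
    using that by (simp add: g_def low_factor_eq mat_mult_cancel_left(1) invertible_unipotent)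
  have g\<Phi>: "g (\<Phi> M) = M" if "M \<in> S" for M
    using that gN[OF \<Phi>_def low_in_lower diff_low_upper] by (simp add: S_def)
  have \<Phi>S: "\<Phi> ` S \<subseteq> big_cell b"
    by (auto simp: \<Phi>_def S_def intro!: big_cellI diff_low_upper)
  have cont: "continuous_on S \<Phi>"
    unfolding \<Phi>_def by (intro matrix_mult.continuous_on continuous_intros contl)
  have hl: "(low b has_derivative low b) (at M)" for M
    by (rule bounded_linear_imp_has_derivative[OF bounded_linear_low])
  have hd1: "((\<lambda>M. mat 1 + low b M) has_derivative low b) (at (mat 1))"
    using has_derivative_add[OF has_derivative_const hl] by simp
  have hd2: "(?u has_derivative ?u) (at (mat 1))"
    by (intro has_derivative_diff has_derivative_ident hl)
  have "(\<Phi> has_derivative (\<lambda>H. (mat 1 + low b (mat 1)) ** ?u H + low b H ** ?u (mat 1))) (at (mat 1))"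
    unfolding \<Phi>_def using matrix_mult.FDERIV[OF hd1 hd2] .
  then have d\<Phi>: "(\<Phi> has_derivative id) (at (mat 1))" by (simp add: id_def)
  have \<Phi>1: "\<Phi> (mat 1) = mat 1" by (simp add: \<Phi>_def)
  have dg: "(g has_derivative id) (at (mat 1))"
    using has_derivative_inverse_strong[OF S S1 cont g\<Phi> d\<Phi>, of id] \<Phi>1 by simp
  have "mat 1 \<in> interior (\<Phi> ` S)"
    using sussmann_open_mapping[OF S cont S1 d\<Phi>, of id S] \<Phi>1 S S1
    by (simp add: interior_open bounded_linear_ident id_def o_def)
  then have int: "mat 1 \<in> interior (big_cell b)" using interior_mono[OF \<Phi>S] by blast
  then show "\<exists>U. open U \<and> mat 1 \<in> U \<and> U \<subseteq> big_cell b"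
    by (meson interior_subset open_interior)
  have "((\<lambda>N. low b (g N)) has_derivative (\<lambda>H. low b (id H))) (at (mat 1))"
    using has_derivative_compose[OF dg hl] .
  then have "((\<lambda>N. low b (g N)) has_derivative low b) (at (mat 1))" by simp
  then show "(low_factor b has_derivative low b) (at (mat 1))"
  proof (rule has_derivative_transform_within_open[OF _ open_interior int])
    fix N assume "N \<in> interior (big_cell b)"
    then have "N \<in> big_cell b" using interior_subset by blast
    then obtain p where p: "low_factor b N \<in> lower b" "p \<in> upper b" "invertible p" "N = (mat 1 + low_factor b N) ** p"
      by (rule big_cellE)
    then have "g N = low_factor b N + p" using gN by blast
    then show "low b (g N) = low_factor b N" using p by (simp add: low_add)
  qed
qed

text \<open>Lower unipotent matrices on the left and upper ones on the right preserve the big cell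
  and change the unipotent factor by an affine map; this carries statements at the identity to every
  point of the cell.\<close>

lemma big_cell_translate:
  assumes X: "X \<in> lower b" and p: "p \<in> upper b" "invertible p" and N: "N \<in> big_cell b"
  shows "(mat 1 + X) ** N ** p \<in> big_cell b"
    "low_factor b ((mat 1 + X) ** N ** p) = X + (mat 1 + X) ** low_factor b N"
proof -
  obtain q where q: "low_factor b N \<in> lower b" "q \<in> upper b" "invertible q" "N = (mat 1 + low_factor b N) ** q"
    using N by (rule big_cellE)
  let ?Y = "X + (mat 1 + X) ** low_factor b N"
  have "(mat 1 + X) ** N ** p = (mat 1 + ?Y) ** (q ** p)"
    by (subst q(4)) (simp add: matrix_mult.add_left matrix_mult.add_right matrix_mul_assoc)
  moreover have "?Y \<in> lower b"
    using X q(1) by (auto simp: matrix_mult.add_left intro!: lower_add lower_mult)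
  moreover have "q ** p \<in> upper b" "invertible (q ** p)"
    using p q by (auto simp: upper_mult invertible_mult_iff)
  ultimately show "(mat 1 + X) ** N ** p \<in> big_cell b"
    "low_factor b ((mat 1 + X) ** N ** p) = X + (mat 1 + X) ** low_factor b N"
    by (simp_all only: big_cellI low_factor_eq)
qed

text \<open>Multiplication by \<open>mat c\<close> plays the role of the complex scalar c on
  matrices; complex linearity of derivatives is expressed with it.\<close>

lemma matrix_scale_commute: "mat c ** A = A ** mat c" for A :: "complex^'n^'n"
  by (simp add: vec_eq_iff matrix_matrix_mult_def mat_def if_distrib if_distribR mult.commute cong: if_cong)

lemma matrix_scale_nth: "(mat c ** A) $ i $ j = c * A $ i $ j" for A :: "complex^'n^'n"
  by (simp add: matrix_matrix_mult_def mat_def if_distrib if_distribR cong: if_cong)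

lemma low_scale: "low b (mat c ** M) = mat c ** low b M"
  by (simp add: vec_eq_iff matrix_scale_nth low_def)

text \<open>Translation of the statement at the identity. Complex linearity of the derivative is
  recorded because it is what makes changes of charts holomorphic.\<close>

lemma low_factor_at:
  assumes M: "M \<in> big_cell b"
  shows "\<exists>U. open U \<and> M \<in> U \<and> U \<subseteq> big_cell b"
    "\<exists>f'. (low_factor b has_derivative f') (at M) \<and> (\<forall>c H. f' (mat c ** H) = mat c ** f' H)"
proof -
  obtain p where p: "low_factor b M \<in> lower b" "p \<in> upper b" "invertible p" "M = (mat 1 + low_factor b M) ** p"
    using M by (rule big_cellE)
  define X where "X = low_factor b M"
  have X: "X \<in> lower b" and iX: "invertible (mat 1 + X)"
    using p(1) by (auto simp: X_def invertible_unipotent)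
  define \<Psi> where "\<Psi> N = matrix_inv (mat 1 + X) ** N ** matrix_inv p" for N
  have \<Psi>M: "\<Psi> M = mat 1"
    using p iX unfolding \<Psi>_def X_def
    by (metis mat_mult_cancel_left(1) matrix_inv_right)
  have bl: "bounded_linear \<Psi>"
    unfolding \<Psi>_def
    by (intro bounded_linear_compose[OF matrix_mult.bounded_linear_left] matrix_mult.bounded_linear_right)
  have bck: "N = (mat 1 + X) ** \<Psi> N ** p" for N
    using p(3) iX by (simp add: \<Psi>_def matrix_mul_assoc matrix_inv_right)
      (simp add: matrix_mul_assoc[symmetric] matrix_inv_left)
  obtain U where U: "open U" "mat 1 \<in> U" "U \<subseteq> big_cell b" using low_factor_local(1) by blast
  define V where "V = \<Psi> -` U"
  have V: "open V" "M \<in> V" "V \<subseteq> big_cell b"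
  proof -
    show "open V" unfolding V_def
      by (rule open_vimage[OF U(1)]) (rule linear_continuous_on[OF bl])
    show "M \<in> V" using U \<Psi>M by (simp add: V_def)
    show "V \<subseteq> big_cell b"
      using big_cell_translate(1)[OF X p(2,3)] bck U(3) by (auto simp: V_def subset_iff) metis
  qed
  then show "\<exists>U. open U \<and> M \<in> U \<and> U \<subseteq> big_cell b" by blast
  have eq: "low_factor b N = X + (mat 1 + X) ** low_factor b (\<Psi> N)" if "N \<in> V" for N
    using big_cell_translate(2)[OF X p(2,3), of "\<Psi> N"] bck[of N] U(3) that by (auto simp: V_def)
  have "(\<Psi> has_derivative \<Psi>) (at M)" by (rule bounded_linear_imp_has_derivative[OF bl])
  then have "((\<lambda>N. low_factor b (\<Psi> N)) has_derivative (\<lambda>H. low b (\<Psi> H))) (at M)"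
    by (rule has_derivative_compose) (simp add: \<Psi>M low_factor_local(2))
  then have "((\<lambda>N. X + (mat 1 + X) ** low_factor b (\<Psi> N)) has_derivative
      (\<lambda>H. (mat 1 + X) ** low b (\<Psi> H))) (at M)"
    using has_derivative_add[OF has_derivative_const bounded_linear.has_derivative[OF matrix_mult.bounded_linear_right]]
    by fastforce
  then have "(low_factor b has_derivative (\<lambda>H. (mat 1 + X) ** low b (\<Psi> H))) (at M)"
    by (rule has_derivative_transform_within_open[OF _ V(1,2)]) (simp add: eq)
  moreover have "(mat 1 + X) ** low b (\<Psi> (mat c ** H)) = mat c ** ((mat 1 + X) ** low b (\<Psi> H))" for c H
  proof -
    have "\<Psi> (mat c ** H) = mat c ** \<Psi> H"
      unfolding \<Psi>_def by (metis matrix_mul_assoc matrix_scale_commute)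
    then show ?thesis by (metis low_scale matrix_mul_assoc matrix_scale_commute)
  qed
  ultimately show "\<exists>f'. (low_factor b has_derivative f') (at M) \<and> (\<forall>c H. f' (mat c ** H) = mat c ** f' H)"
    by blast
qed

lemma open_big_cell: "open (big_cell b)"
  using low_factor_at(1) by (subst open_subopen) blast

lemma continuous_on_low_factor: "continuous_on (big_cell b) (low_factor b)"
  using low_factor_at(2) by (meson continuous_at_imp_continuous_on has_derivative_continuous)

section \<open>The flag topology\<close>

lemma continuous_on_normalize_det:
  "continuous_on {M :: 'n::{finite,linorder} cmat. invertible M} normalize_det"
proof -
  have "continuous_on {M :: 'n cmat. invertible M} (\<lambda>M. first_scaling (1 / det M) :: 'n cmat)"
  proof -
    have "continuous_on {M :: 'n cmat. invertible M} (\<lambda>M. 1 / det M)"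
      by (intro continuous_intros continuous_on_det) (auto simp: invertible_det_nz)
    then have "continuous_on {M :: 'n cmat. invertible M}
        (\<lambda>M. if i = j then if rk i = 0 then 1 / det M else 1 else 0)" for i j :: 'n
      by (cases "i = j"; cases "rk i = 0") simp_all
    then show ?thesis
      unfolding first_scaling_def by (intro continuous_on_vec_lambda)
  qed
  then show ?thesis
    unfolding normalize_det_def by (intro matrix_mult.continuous_on continuous_on_id)
qed

text \<open>Replaces the relative topology of \<open>SL_complex\<close> by the open set of
  invertible matrices, where openness is that of a Euclidean space. The nontrivial direction pulls
  back along the continuous map \<open>normalize_det\<close>.\<close>

lemma openin_flag_topology_iff:
  assumes c: "dim_seq TYPE('n) c"
  shows "openin (flag_topology c) U \<longleftrightarrow>
    U \<subseteq> flags c \<and> open {M :: 'n::{finite,linorder} cmat. invertible M \<and> act M (base_flag c) \<in> U}"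
proof -
  let ?G = "{M :: 'n cmat. invertible M}"
  let ?A = "{M \<in> ?G. act M (base_flag c) \<in> U}"
  let ?B = "{g \<in> SL_complex. act g (base_flag c) \<in> U}"
  have B: "?B = SL_complex \<inter> ?A" by (auto simp: SL_invertible)
  have "openin (top_of_set SL_complex) ?B \<longleftrightarrow> open ?A"
  proof
    assume "open ?A"
    then show "openin (top_of_set SL_complex) ?B" unfolding B by (rule openin_open_Int)
  next
    assume "openin (top_of_set SL_complex) ?B"
    then obtain T where T: "open T" "?B = SL_complex \<inter> T" unfolding openin_open by blast
    have "?A = ?G \<inter> normalize_det -` T"
    proof (intro set_eqI)
      fix M :: "'n cmat"
      show "M \<in> ?A \<longleftrightarrow> M \<in> ?G \<inter> normalize_det -` T"
      proof (cases "invertible M")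
        case True
        have "M \<in> ?A \<longleftrightarrow> normalize_det M \<in> ?B"
          using True by (simp add: normalize_det_SL act_normalize_det[OF c])
        also have "\<dots> \<longleftrightarrow> normalize_det M \<in> T"
          using True T(2) normalize_det_SL by blast
        finally show ?thesis using True by simp
      qed simp
    qed
    then show "open ?A"
      using continuous_open_preimage[OF continuous_on_normalize_det open_invertible T(1)] by simp
  qed
  then show ?thesis by (simp add: openin_flag_topology)
qed

lemma topspace_flag_topology:
  assumes c: "dim_seq TYPE('n) c"
  shows "topspace (flag_topology c) = (flags c :: 'n::{finite,linorder} flag set)"
proof (rule subset_antisym)
  show "topspace (flag_topology c) \<subseteq> (flags c :: 'n flag set)"
    using openin_flag_topology_iff[OF c] openin_topspace by blast
  have "{M :: 'n cmat. invertible M \<and> act M (base_flag c) \<in> flags c} = {M. invertible M}"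
    using act_in_flags base_flag_in_flags[OF c] by blast
  then have "openin (flag_topology c) (flags c :: 'n flag set)"
    by (simp add: openin_flag_topology_iff[OF c] open_invertible)
  then show "(flags c :: 'n flag set) \<subseteq> topspace (flag_topology c)" by (rule openin_subset)
qed

lemma continuous_map_act_base:
  fixes m :: "'a::topological_space \<Rightarrow> 'n::{finite,linorder} cmat"
  assumes c: "dim_seq TYPE('n) c" and m: "continuous_on S m" "\<And>x. x \<in> S \<Longrightarrow> invertible (m x)"
  shows "continuous_map (top_of_set S) (flag_topology c) (\<lambda>x. act (m x) (base_flag c))"
  unfolding continuous_map topspace_flag_topology[OF c]
proof (intro conjI allI impI)
  show "(\<lambda>x. act (m x) (base_flag c)) ` topspace (top_of_set S) \<subseteq> flags c"
    using m(2) act_in_flags base_flag_in_flags[OF c] by auto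
  fix U :: "'n flag set" assume "openin (flag_topology c) U"
  then have o: "open {M :: 'n cmat. invertible M \<and> act M (base_flag c) \<in> U}"
    by (simp add: openin_flag_topology_iff[OF c])
  have "{x \<in> topspace (top_of_set S). act (m x) (base_flag c) \<in> U} =
      S \<inter> m -` {M. invertible M \<and> act M (base_flag c) \<in> U}" using m(2) by auto
  then show "openin (top_of_set S) {x \<in> topspace (top_of_set S). act (m x) (base_flag c) \<in> U}"
    using continuous_openin_preimage_gen[OF m(1) o] by simp
qed

text \<open>The quotient map is open: the preimage of the image of A is the union of the right
  translates of A by the parabolic.\<close>

lemma openin_act_base_image:
  fixes A :: "'n::{finite,linorder} cmat set"
  assumes c: "dim_seq TYPE('n) c" and A: "open A" "\<And>M. M \<in> A \<Longrightarrow> invertible M"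
  shows "openin (flag_topology c) ((\<lambda>M. act M (base_flag c)) ` A)"
  unfolding openin_flag_topology_iff[OF c]
proof
  let ?P = "{p :: 'n cmat. invertible p \<and> p \<in> upper (block_index c)}"
  show "(\<lambda>M. act M (base_flag c)) ` A \<subseteq> flags c"
    using A(2) act_in_flags base_flag_in_flags[OF c] by auto
  have "{M. invertible M \<and> act M (base_flag c) \<in> (\<lambda>M. act M (base_flag c)) ` A} =
      (\<Union>p\<in>?P. (\<lambda>M. M ** p) -` A)" (is "?L = ?R")
  proof (intro set_eqI iffI)
    fix M assume "M \<in> ?L"
    then obtain N where N: "invertible M" "N \<in> A" "act M (base_flag c) = act N (base_flag c)" by auto
    then have "matrix_inv M ** N \<in> upper (block_index c)"
      using act_base_flag_eq_iff[OF c] A(2) by blast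
    moreover have "M ** (matrix_inv M ** N) = N" using N by (simp add: mat_mult_cancel_left)
    moreover have "invertible (matrix_inv M ** N)"
      using N A(2) by (simp add: invertible_mult_iff invertible_matrix_inv)
    ultimately show "M \<in> ?R" using N(2) by force
  next
    fix M assume "M \<in> ?R"
    then obtain p where p: "invertible p" "p \<in> upper (block_index c)" "M ** p \<in> A" by auto
    then have "act M (base_flag c) = act (M ** p) (base_flag c)" using act_base_flag_upper[OF c] by metis
    moreover have "invertible M" using A(2)[OF p(3)] by (simp add: invertible_mult_iff)
    ultimately show "M \<in> ?L" using p by auto
  qed
  moreover have "open ((\<lambda>M. M ** p) -` A)" for p :: "'n cmat"
    by (rule open_vimage[OF A(1)]) (intro matrix_mult.continuous_on continuous_intros)
  ultimately show "open ?L" by auto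
qed

lemma closed_upper:
  fixes b :: "'n::finite \<Rightarrow> nat"
  shows "closed (upper b)"
proof -
  have "upper b = (\<Inter>i. \<Inter>j. {M. b j < b i \<longrightarrow> M $ i $ j = 0})" by (auto simp: upper_def)
  moreover have "closed {M :: complex^'n^'n. b j < b i \<longrightarrow> M $ i $ j = 0}" for i j
    by (cases "b j < b i") (auto intro!: closed_Collect_eq continuous_intros)
  ultimately show ?thesis by (simp only:) (intro closed_INT ballI)
qed

text \<open>Equality of two flags is the closed condition that \<open>matrix_inv g ** g'\<close> be
  block upper. Representatives of distinct flags thus have neighbourhoods that avoid it, and their
  images are open.\<close>

lemma Hausdorff_flag_topology:
  assumes c: "dim_seq TYPE('n) c"
  shows "Hausdorff_space (flag_topology c :: 'n::{finite,linorder} flag topology)"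
  unfolding Hausdorff_space_def topspace_flag_topology[OF c]
proof (intro allI impI)
  let ?G = "{M :: 'n cmat. invertible M}"
  let ?q = "\<lambda>M :: 'n cmat. act M (base_flag c)"
  fix V V' :: "'n flag"
  assume *: "V \<in> flags c \<and> V' \<in> flags c \<and> V \<noteq> V'"
  then obtain g g' where g: "invertible g" "V = ?q g" "invertible g'" "V' = ?q g'"
    using flags_transitive[OF c] by metis
  let ?\<kappa> = "\<lambda>z :: 'n cmat \<times> 'n cmat. matrix_inv (fst z) ** snd z"
  have "continuous_on (?G \<times> ?G) ?\<kappa>"
    by (intro matrix_mult.continuous_on continuous_on_compose2[OF continuous_on_matrix_inv] continuous_intros) auto
  then have "open ((?G \<times> ?G) \<inter> ?\<kappa> -` (- upper (block_index c)))"
    using closed_upper open_invertible by (intro continuous_open_preimage open_Times) (auto simp: open_Compl)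
  moreover have "(g, g') \<in> (?G \<times> ?G) \<inter> ?\<kappa> -` (- upper (block_index c))"
    using g * act_base_flag_eq_iff[OF c g(1,3)] by auto
  ultimately obtain A B where AB: "open A" "open B" "(g, g') \<in> A \<times> B"
    "A \<times> B \<subseteq> (?G \<times> ?G) \<inter> ?\<kappa> -` (- upper (block_index c))"
    by (rule open_prod_elim)
  have iA: "invertible M" if "M \<in> A" for M using AB(3,4) that by auto
  have iB: "invertible M" if "M \<in> B" for M using AB(3,4) that by auto
  have "?q M \<noteq> ?q N" if "M \<in> A" "N \<in> B" for M N
    using act_base_flag_eq_iff[OF c iA[OF that(1)] iB[OF that(2)]] AB(4) that by auto
  then have "disjnt (?q ` A) (?q ` B)" by (auto simp: disjnt_iff)
  then show "\<exists>U U'. openin (flag_topology c) U \<and> openin (flag_topology c) U' \<and> V \<in> U \<and> V' \<in> U' \<and> disjnt U U'"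
    using openin_act_base_image[OF c AB(1) iA] openin_act_base_image[OF c AB(2) iB] g AB(3) by blast
qed

lemma compact_unitary: "compact {u :: complex^'n^'n. unitary u}"
  unfolding compact_eq_bounded_closed
proof
  have "norm (u $ i) = 1" if "unitary u" for u :: "complex^'n^'n" and i
  proof -
    have "herm (u $ i) (u $ i) = (u ** adj u) $ i $ i"
      by (simp add: herm_def matrix_matrix_mult_def)
    then have "(norm (u $ i))\<^sup>2 = 1"
      using unitary_adj[OF that] by (simp add: herm_self mat_def) (metis of_real_eq_1_iff of_real_power)
    then show ?thesis using norm_ge_zero[of "u $ i"] by (auto simp: power2_eq_1_iff)
  qed
  then have "norm u = L2_set (\<lambda>_::'n. 1) UNIV" if "unitary u" for u :: "complex^'n^'n"
    using that by (simp add: norm_vec_def)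
  then show "bounded {u :: complex^'n^'n. unitary u}"
    by (intro boundedI[where B="L2_set (\<lambda>_::'n. 1) UNIV"]) auto
  have "continuous_on UNIV (\<lambda>u :: complex^'n^'n. adj u ** u)"
    unfolding adj_def
    by (intro matrix_mult.continuous_on continuous_on_vec_lambda continuous_intros)
  then show "closed {u :: complex^'n^'n. unitary u}"
    unfolding unitary_def by (intro closed_Collect_eq) auto
qed

text \<open>By Gram-Schmidt every flag is the image of the base flag under a unitary matrix, so the
  space is a continuous image of a compact group.\<close>

lemma compact_flag_topology:
  assumes c: "dim_seq TYPE('n) c"
  shows "compact_space (flag_topology c :: 'n::{finite,linorder} flag topology)"
proof -
  let ?q = "\<lambda>M :: 'n cmat. act M (base_flag c)"
  let ?U = "{u :: 'n cmat. unitary u}"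
  have "continuous_map (top_of_set ?U) (flag_topology c) ?q"
    by (rule continuous_map_act_base[OF c]) (auto simp: unitary_invertible)
  then have "compactin (flag_topology c) (?q ` ?U)"
    by (rule image_compactin[rotated]) (simp add: compactin_subtopology compact_unitary)
  moreover have "?q ` ?U = flags c"
  proof (rule subset_antisym)
    show "?q ` ?U \<subseteq> flags c" using act_in_flags base_flag_in_flags[OF c] unitary_invertible by blast
    show "flags c \<subseteq> ?q ` ?U"
    proof
      fix V :: "'n flag" assume "V \<in> flags c"
      then obtain M where M: "invertible M" "V = act M (base_flag c)" by (rule flags_transitive[OF c])
      obtain u where u: "unitary u" "\<And>k. (*v) u ` coord_space k = (*v) M ` coord_space k"
        using gram_schmidt[OF M(1)] by metis
      have "?q u = V" by (rule nth_equalityI) (auto simp: M(2) base_flag_nth[OF c] u(2))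
      then show "V \<in> ?q ` ?U" using u(1) by blast
    qed
  qed
  ultimately show ?thesis by (simp add: compact_space_def topspace_flag_topology[OF c])
qed

section \<open>Charts\<close>

definition vmat :: "complex^('n \<times> 'n) \<Rightarrow> complex^'n^'n" where
  "vmat x = (\<chi> i j. x $ (i, j))"

definition mvec :: "complex^'n^'n \<Rightarrow> complex^('n \<times> 'n)" where
  "mvec M = (\<chi> p. M $ fst p $ snd p)"

lemma vmat_mvec [simp]: "vmat (mvec M) = M" by (simp add: vmat_def mvec_def vec_eq_iff)
lemma mvec_vmat [simp]: "mvec (vmat x) = x" by (simp add: vmat_def mvec_def vec_eq_iff)
lemma linear_vmat: "linear vmat" by (rule linearI) (auto simp: vmat_def vec_eq_iff)
lemma linear_mvec: "linear mvec" by (rule linearI) (auto simp: mvec_def vec_eq_iff)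
lemma bounded_linear_vmat: "bounded_linear vmat" by (rule bounded_linear_matrix[OF linear_vmat])
lemma bounded_linear_mvec: "bounded_linear mvec" by (rule bounded_linear_matrix[OF linear_mvec])
lemma vmat_0 [simp]: "vmat 0 = 0" by (rule linear_0[OF linear_vmat])
lemma vmat_scale: "vmat (c *s x) = mat c ** vmat x" by (simp add: vec_eq_iff matrix_scale_nth vmat_def)
lemma mvec_scale: "mvec (mat c ** M) = c *s mvec M" by (simp add: vec_eq_iff matrix_scale_nth mvec_def)
lemma continuous_on_vmat: "continuous_on A vmat" by (rule linear_continuous_on[OF bounded_linear_vmat])
lemma continuous_on_mvec: "continuous_on A mvec" by (rule linear_continuous_on[OF bounded_linear_mvec])

lemma nil_lower_iff: "x \<in> nil_lower c \<longleftrightarrow> vmat x \<in> lower (block_index c)"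
  by (simp add: nil_lower_def lower_def vmat_def)

lemma mvec_nil_lower: "X \<in> lower (block_index c) \<Longrightarrow> mvec X \<in> nil_lower c"
  by (simp add: nil_lower_iff)

lemma subspace_nil_lower: "vec.subspace (nil_lower c)"
  by (auto simp: vec.subspace_def nil_lower_def)

lemma flag_chart_eq: "flag_chart c g x = act (g ** (mat 1 + vmat x)) (base_flag c)"
  by (simp add: flag_chart_def vmat_def)

lemma flag_chart_0 [simp]: "flag_chart c g 0 = act g (base_flag c)"
  by (simp add: flag_chart_eq)

text \<open>In other words \<open>low_factor\<close>, after translation by g, is the inverse of the
  chart. Injectivity and openness of the charts are both read off from this.\<close>

lemma act_base_eq_flag_chart_iff:
  fixes g M :: "'n::{finite,linorder} cmat"
  assumes c: "dim_seq TYPE('n) c" and g: "invertible g" and M: "invertible M" and x: "x \<in> nil_lower c"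
  shows "act M (base_flag c) = flag_chart c g x \<longleftrightarrow>
    matrix_inv g ** M \<in> big_cell (block_index c) \<and> x = mvec (low_factor (block_index c) (matrix_inv g ** M))"
proof -
  let ?b = "block_index c :: 'n \<Rightarrow> nat"
  let ?X = "mat 1 + vmat x"
  have X: "vmat x \<in> lower ?b" "invertible ?X"
    using x by (auto simp: nil_lower_iff invertible_unipotent)
  then have "act M (base_flag c) = flag_chart c g x \<longleftrightarrow> matrix_inv (g ** ?X) ** M \<in> upper ?b"
    unfolding flag_chart_eq using act_base_flag_eq_iff[OF c, of "g ** ?X" M] g M
    by (auto simp: invertible_mult_iff)
  also have "matrix_inv (g ** ?X) ** M = matrix_inv ?X ** (matrix_inv g ** M)"
    using g X by (simp add: matrix_inv_mult matrix_mul_assoc)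
  also have "\<dots> \<in> upper ?b \<longleftrightarrow> matrix_inv g ** M \<in> big_cell ?b \<and> x = mvec (low_factor ?b (matrix_inv g ** M))"
  proof
    assume U: "matrix_inv ?X ** (matrix_inv g ** M) \<in> upper ?b"
    let ?p = "matrix_inv ?X ** (matrix_inv g ** M)"
    have "invertible ?p" using g M X by (simp add: invertible_mult_iff invertible_matrix_inv)
    moreover have "matrix_inv g ** M = ?X ** ?p" using X by (simp add: mat_mult_cancel_left)
    ultimately show "matrix_inv g ** M \<in> big_cell ?b \<and> x = mvec (low_factor ?b (matrix_inv g ** M))"
      using low_factor_eq[OF X(1) U] big_cellI[OF X(1) U] by (metis mvec_vmat)
  next
    assume B: "matrix_inv g ** M \<in> big_cell ?b \<and> x = mvec (low_factor ?b (matrix_inv g ** M))"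
    then obtain p where "p \<in> upper ?b" "matrix_inv g ** M = ?X ** p"
      using big_cellE[of "matrix_inv g ** M" ?b] by (metis vmat_mvec)
    then show "matrix_inv ?X ** (matrix_inv g ** M) \<in> upper ?b" using X by (simp add: mat_mult_cancel_left)
  qed
  finally show ?thesis .
qed

lemma flag_chart_open_embedding:
  fixes g :: "'n::{finite,linorder} cmat"
  assumes c: "dim_seq TYPE('n) c" and g: "invertible g"
  shows "continuous_map (top_of_set (nil_lower c)) (flag_topology c) (flag_chart c g)"
    "open_map (top_of_set (nil_lower c)) (flag_topology c) (flag_chart c g)"
    "inj_on (flag_chart c g) (nil_lower c)"
proof -
  let ?b = "block_index c :: 'n \<Rightarrow> nat"
  have inv: "invertible (g ** (mat 1 + vmat x))" if "x \<in> nil_lower c" for x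
    using that g by (simp add: invertible_mult_iff invertible_unipotent[of _ ?b] nil_lower_iff)
  show "continuous_map (top_of_set (nil_lower c)) (flag_topology c) (flag_chart c g)"
    unfolding flag_chart_eq[abs_def]
    by (rule continuous_map_act_base[OF c])
      (auto intro!: matrix_mult.continuous_on continuous_intros continuous_on_vmat inv)
  show "inj_on (flag_chart c g) (nil_lower c)"
  proof (rule inj_onI)
    fix x y assume xy: "x \<in> nil_lower c" "y \<in> nil_lower c" "flag_chart c g x = flag_chart c g y"
    then show "x = y"
      using act_base_eq_flag_chart_iff[OF c g inv[OF xy(1)], of x]
        act_base_eq_flag_chart_iff[OF c g inv[OF xy(1)], of y] unfolding flag_chart_eq by metis
  qed
  show "open_map (top_of_set (nil_lower c)) (flag_topology c) (flag_chart c g)"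
    unfolding open_map_def
  proof (intro allI impI)
    fix A :: "(complex^('n \<times> 'n)) set" assume "openin (top_of_set (nil_lower c)) A"
    then obtain T where T: "open T" "A = nil_lower c \<inter> T" unfolding openin_open by blast
    let ?f = "\<lambda>M. mvec (low_factor ?b M)"
    have eq: "{M. invertible M \<and> act M (base_flag c) \<in> flag_chart c g ` A} =
        (\<lambda>M. matrix_inv g ** M) -` (big_cell ?b \<inter> ?f -` T)" (is "?L = ?R")
    proof (intro set_eqI iffI)
      fix M assume "M \<in> ?L"
      then obtain x where x: "invertible M" "x \<in> A" "act M (base_flag c) = flag_chart c g x" by auto
      then show "M \<in> ?R" using act_base_eq_flag_chart_iff[OF c g x(1), of x] T(2) by auto
    next
      fix M assume M: "M \<in> ?R"
      then have "invertible (matrix_inv g ** M)" using big_cell_invertible by blast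
      then have iM: "invertible M" by (simp add: invertible_mult_iff)
      have "low_factor ?b (matrix_inv g ** M) \<in> lower ?b" using M big_cellE by blast
      then have "?f (matrix_inv g ** M) \<in> A" using M T(2) by (auto intro: mvec_nil_lower)
      then show "M \<in> ?L"
        using M T(2) iM act_base_eq_flag_chart_iff[OF c g iM, of "?f (matrix_inv g ** M)"] by blast
    qed
    have "continuous_on (big_cell ?b) ?f"
      by (rule continuous_on_compose2[OF continuous_on_mvec continuous_on_low_factor]) auto
    then have "open (big_cell ?b \<inter> ?f -` T)" using open_big_cell T(1) by (rule continuous_open_preimage)
    then have "open ?R" by (rule open_vimage) (intro matrix_mult.continuous_on continuous_intros)
    moreover have "flag_chart c g ` A \<subseteq> flags c"
      unfolding flag_chart_eq[abs_def] using T(2) inv act_in_flags base_flag_in_flags[OF c] by blast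
    ultimately show "openin (flag_topology c) (flag_chart c g ` A)"
      unfolding openin_flag_topology_iff[OF c] eq by blast
  qed
qed

lemma homeomorphic_map_flag_chart:
  fixes g :: "'n::{finite,linorder} cmat"
  assumes c: "dim_seq TYPE('n) c" and g: "invertible g" and A: "A \<subseteq> nil_lower c"
  shows "homeomorphic_map (top_of_set A) (subtopology (flag_topology c) (flag_chart c g ` A)) (flag_chart c g)"
proof -
  note ch = flag_chart_open_embedding[OF c g]
  have "embedding_map (top_of_set (nil_lower c)) (flag_topology c) (flag_chart c g)"
    using ch by (intro injective_open_imp_embedding_map) auto
  then have "homeomorphic_map (top_of_set (nil_lower c))
      (subtopology (flag_topology c) (flag_chart c g ` nil_lower c)) (flag_chart c g)"
    by (simp add: embedding_map_def)
  then have "homeomorphic_map (subtopology (top_of_set (nil_lower c)) A)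
      (subtopology (subtopology (flag_topology c) (flag_chart c g ` nil_lower c)) (flag_chart c g ` A)) (flag_chart c g)"
  proof (rule homeomorphic_map_subtopologies)
    show "flag_chart c g ` (topspace (top_of_set (nil_lower c)) \<inter> A) =
      topspace (subtopology (flag_topology c) (flag_chart c g ` nil_lower c)) \<inter> flag_chart c g ` A"
      using A continuous_map_image_subset_topspace[OF ch(1)] by auto
  qed
  moreover have "flag_chart c g ` nil_lower c \<inter> flag_chart c g ` A = flag_chart c g ` A" using A by auto
  ultimately show ?thesis using A by (simp add: subtopology_subtopology inf.absorb2)
qed

section \<open>Dimension, projections and Schubert cells\<close>

section \<open>Dimension\<close>

text \<open>Purely topological, so that invariance of domain applies and homeomorphisms transport
  it; the complex structure is forgotten on purpose.\<close>

definition locally_modelled :: "'a topology \<Rightarrow> 'a \<Rightarrow> 'b::euclidean_space set \<Rightarrow> bool" where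
  "locally_modelled X p L \<longleftrightarrow> (\<exists>U A. openin X U \<and> p \<in> U \<and> openin (top_of_set L) A \<and>
     subtopology X U homeomorphic_space top_of_set A)"

text \<open>Following one local model by the other gives a continuous injection of a nonempty open
  subset of L into L'; invariance of dimension does the rest.\<close>

lemma locally_modelled_dim_le:
  fixes L :: "'b::euclidean_space set" and L' :: "'c::euclidean_space set"
  assumes "locally_modelled X p L" "locally_modelled X p L'" "subspace L" "subspace L'"
  shows "dim L \<le> dim L'"
proof -
  obtain U A where U: "openin X U" "p \<in> U" "openin (top_of_set L) A"
    "subtopology X U homeomorphic_space top_of_set A"
    using assms(1) by (auto simp: locally_modelled_def)
  obtain V B where V: "openin X V" "p \<in> V" "openin (top_of_set L') B"
    "subtopology X V homeomorphic_space top_of_set B"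
    using assms(2) by (auto simp: locally_modelled_def)
  obtain \<phi> \<psi> where \<phi>: "homeomorphic_maps (top_of_set A) (subtopology X U) \<phi> \<psi>"
    using U(4) homeomorphic_space_sym unfolding homeomorphic_space_def by blast
  obtain \<theta> where \<theta>: "homeomorphic_map (subtopology X V) (top_of_set B) \<theta>"
    using V(4) unfolding homeomorphic_space by blast
  have UX: "U \<subseteq> topspace X" "V \<subseteq> topspace X" using U(1) V(1) openin_subset by auto
  have \<phi>m: "homeomorphic_map (top_of_set A) (subtopology X U) \<phi>"
    using \<phi> homeomorphic_maps_map by blast
  have \<phi>A: "\<phi> ` A = U"
    using homeomorphic_imp_surjective_map[OF \<phi>m] UX(1) by (simp add: inf.absorb2)
  \<comment> \<open>The part of the first model whose points also lie in the domain of the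
    second.\<close>
  define S where "S = {x \<in> A. \<phi> x \<in> V}"
  have "openin (top_of_set A) {x \<in> topspace (top_of_set A). \<phi> x \<in> U \<inter> V}"
    by (rule openin_continuous_map_preimage[OF homeomorphic_imp_continuous_map[OF \<phi>m]])
      (rule openin_subtopology_Int2[OF V(1)])
  moreover have "{x \<in> topspace (top_of_set A). \<phi> x \<in> U \<inter> V} = S"
    using \<phi>A by (auto simp: S_def)
  ultimately have SA: "openin (top_of_set A) S" by simp
  have oS: "openin (top_of_set L) S" using SA U(3) openin_trans by blast
  have c1: "continuous_map (top_of_set S) (subtopology X (U \<inter> V)) \<phi>"
  proof -
    have "continuous_map (subtopology (top_of_set A) S) (subtopology X U) \<phi>"
      by (rule continuous_map_from_subtopology[OF homeomorphic_imp_continuous_map[OF \<phi>m]])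
    moreover have "S \<subseteq> A" by (auto simp: S_def)
    ultimately have "continuous_map (top_of_set S) (subtopology X U) \<phi>"
      by (simp add: subtopology_subtopology inf.absorb2)
    then show ?thesis by (auto simp: continuous_map_in_subtopology S_def)
  qed
  have c2: "continuous_map (subtopology X (U \<inter> V)) (top_of_set B) \<theta>"
    using continuous_map_from_subtopology_mono[OF homeomorphic_imp_continuous_map[OF \<theta>], of "U \<inter> V"] by auto
  have c3: "continuous_map (top_of_set S) (top_of_set B) (\<theta> \<circ> \<phi>)"
    using c1 c2 by (rule continuous_map_compose)
  have fim: "\<theta> \<circ> \<phi> \<in> S \<rightarrow> L'"
    using continuous_map_image_subset_topspace[OF c3] openin_subset[OF V(3)]
    by (auto simp: image_subset_iff)
  have inj\<phi>: "inj_on \<phi> A" using homeomorphic_imp_injective_map[OF \<phi>m] by simp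
  have inj\<theta>: "inj_on \<theta> V"
    using homeomorphic_imp_injective_map[OF \<theta>] UX(2) by (simp add: inf.absorb2)
  have inj: "inj_on (\<theta> \<circ> \<phi>) S"
    by (rule comp_inj_on) (use inj\<phi> inj\<theta> in \<open>auto simp: S_def intro: inj_on_subset\<close>)
  have "S \<noteq> {}" using \<phi>A U(2) V(2) by (auto simp: S_def)
  then show ?thesis
    using invariance_of_dimension_subspaces[OF oS assms(3,4) _ fim inj] c3 by simp
qed

lemma locally_modelled_open_subspace:
  assumes "openin X V" "locally_modelled (subtopology X V) p L"
  shows "locally_modelled X p L"
proof -
  obtain U A where U: "openin (subtopology X V) U" "p \<in> U" "openin (top_of_set L) A"
    "subtopology (subtopology X V) U homeomorphic_space top_of_set A"
    using assms(2) by (auto simp: locally_modelled_def)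
  have "U \<subseteq> V" using openin_subset[OF U(1)] by simp
  then have "subtopology (subtopology X V) U = subtopology X U"
    by (simp add: subtopology_subtopology inf.absorb2)
  moreover have "openin X U" using openin_trans_full[OF U(1) assms(1)] .
  ultimately show ?thesis using U unfolding locally_modelled_def by metis
qed

lemma locally_modelled_homeomorphic:
  assumes f: "homeomorphic_map X Y f" and "locally_modelled X p L"
  shows "locally_modelled Y (f p) L"
proof -
  obtain U A where U: "openin X U" "p \<in> U" "openin (top_of_set L) A"
    "subtopology X U homeomorphic_space top_of_set A"
    using assms(2) by (auto simp: locally_modelled_def)
  have UX: "U \<subseteq> topspace X" using openin_subset[OF U(1)] .
  have o: "openin Y (f ` U)" using homeomorphic_map_openness[OF f UX] U(1) by simp
  have "homeomorphic_map (subtopology X U) (subtopology Y (f ` U)) f"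
    using f by (rule homeomorphic_map_subtopologies) (use UX openin_subset[OF o] in auto)
  then have "subtopology Y (f ` U) homeomorphic_space top_of_set A"
    using U(4) homeomorphic_map_imp_homeomorphic_space homeomorphic_space_sym homeomorphic_space_trans by blast
  then show ?thesis using o U unfolding locally_modelled_def by blast
qed

text \<open>Invariance of domain speaks of real dimensions. A complex isomorphic copy of L is a
  proper subspace of L', so strict inequality passes from complex to real dimension; this is all
  that is needed to recover the complex one.\<close>

lemma complex_dim_less_imp_dim_less:
  fixes L L' :: "(complex^'m) set"
  assumes L: "vec.subspace L" "vec.subspace L'" and less: "vec.dim L < vec.dim L'"
  shows "dim L < dim L'"
proof -
  obtain T where T: "vec.subspace T" "T \<subseteq> vec.span L'" "vec.dim T = vec.dim L"
    using vec.choose_subspace_of_subspace[of "vec.dim L" L'] less by auto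
  then have TL: "T \<subseteq> L'" using L(2) by (metis vec.span_eq_iff)
  obtain h where h: "Vector_Spaces.linear (*s) (*s) h" "h ` L = T" "inj_on h L"
    using vec.subspace_isomorphism[OF L(1) T(1)] T(3) by auto
  have lin: "linear h"
  proof (rule linearI)
    interpret h: Vector_Spaces.linear "(*s)" "(*s)" h by (rule h(1))
    show "h (x + y) = h x + h y" for x y by (rule h.add)
    show "h (r *\<^sub>R x) = r *\<^sub>R h x" for r x unfolding scaleR_eq_scale by (rule h.scale)
  qed
  have "dim (h ` L) = dim L"
    using lin h(3) L(1) by (intro dim_image_eq) (auto simp: vec_subspace_imp_subspace span_eq_iff[THEN iffD2])
  then have "dim T = dim L" using h(2) by simp
  moreover have "dim T < dim L'"
  proof (rule dim_psubset)
    have "T \<noteq> L'" using T(3) less by auto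
    then show "span T \<subset> span L'"
      using TL T(1) L(2) vec_subspace_imp_subspace span_eq_iff by blast
  qed
  ultimately show ?thesis by simp
qed

lemma holomorphic_map_on_imp_continuous_on: "holomorphic_map_on h W \<Longrightarrow> continuous_on W h"
  unfolding holomorphic_map_on_def continuous_on_eq_continuous_within
  using has_derivative_continuous by blast

lemma complex_submanifoldE:
  assumes S: "complex_submanifold c k S" and g: "g \<in> SL_complex" "act g (base_flag c) \<in> S"
  obtains W W' h L where "0 \<in> W" "openin (top_of_set (nil_lower c)) W"
      "openin (top_of_set (nil_lower c)) W'" "biholomorphic_map W W' h"
      "vec.subspace L" "L \<subseteq> nil_lower c" "vec.dim L = k"
      "h ` {x \<in> W. flag_chart c g x \<in> S} = W' \<inter> L"
  using conjunct2[OF S[unfolded complex_submanifold_def], rule_format, OF g] by (elim exE conjE)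

lemma complex_submanifold_locally_modelled:
  fixes S :: "'n::{finite,linorder} flag set"
  assumes c: "dim_seq TYPE('n) c" and S: "complex_submanifold c k S" and V: "V \<in> S"
  obtains L :: "(complex^('n \<times> 'n)) set" where "vec.subspace L" "vec.dim L = k"
    "locally_modelled (subtopology (flag_topology c) S) V L"
proof -
  have Sf: "S \<subseteq> flags c" using S by (simp add: complex_submanifold_def)
  obtain M where M: "invertible M" "V = act M (base_flag c)"
    using flags_transitive[OF c] V Sf by blast
  define g where "g = normalize_det M"
  have g: "g \<in> SL_complex" "act g (base_flag c) = V" "invertible g"
    using M by (auto simp: g_def normalize_det_SL act_normalize_det[OF c] SL_invertible)
  have gS: "act g (base_flag c) \<in> S" using g(2) V by simp
  obtain W W' h L where W: "0 \<in> W" "openin (top_of_set (nil_lower c)) W"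
      "openin (top_of_set (nil_lower c)) W'" "biholomorphic_map W W' h"
      "vec.subspace L" "L \<subseteq> nil_lower c" "vec.dim L = k"
      "h ` {x \<in> W. flag_chart c g x \<in> S} = W' \<inter> L"
    by (rule complex_submanifoldE[OF S g(1) gS])
  let ?ch = "flag_chart c g"
  define Q where "Q = {x \<in> W. ?ch x \<in> S}"
  have WN: "W \<subseteq> nil_lower c" "W' \<subseteq> nil_lower c" using W(2,3) openin_subset by fastforce+
  then have QN: "Q \<subseteq> nil_lower c" by (auto simp: Q_def)
  have "openin (flag_topology c) (?ch ` W)"
    using flag_chart_open_embedding(2)[OF c g(3)] W(2) by (simp add: open_map_def)
  then have oU: "openin (subtopology (flag_topology c) S) (?ch ` Q)"
    by (auto simp: openin_subtopology Q_def)
  have oA: "openin (top_of_set L) (W' \<inter> L)"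
    using W(3,6) unfolding openin_open by auto
  have h: "bij_betw h W W'" "continuous_on W h" "continuous_on W' (inv_into W h)"
    using W(4) holomorphic_map_on_imp_continuous_on by (auto simp: biholomorphic_map_def)
  have QW: "Q \<subseteq> W" "h ` Q = W' \<inter> L" using W(8) by (auto simp: Q_def)
  have "homeomorphic_maps (top_of_set Q) (top_of_set (W' \<inter> L)) h (inv_into W h)"
    unfolding homeomorphic_maps_def
  proof (intro conjI ballI)
    have left: "inv_into W h (h x) = x" if "x \<in> Q" for x
      using that QW(1) h(1) by (meson bij_betw_inv_into_left subsetD)
    then show "\<And>x. x \<in> topspace (top_of_set Q) \<Longrightarrow> inv_into W h (h x) = x" by simp
    have "inv_into W h ` (W' \<inter> L) = Q" using left QW(2) by (auto simp: image_image simp flip: QW(2))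
    then show "continuous_map (top_of_set (W' \<inter> L)) (top_of_set Q) (inv_into W h)"
      using h(3) by (auto intro: continuous_on_subset)
    show "continuous_map (top_of_set Q) (top_of_set (W' \<inter> L)) h"
      using h(2) QW by (auto intro: continuous_on_subset)
    show "h (inv_into W h y) = y" if "y \<in> topspace (top_of_set (W' \<inter> L))" for y
      using that h(1) by (auto simp: bij_betw_inv_into_right)
  qed
  then have "top_of_set Q homeomorphic_space top_of_set (W' \<inter> L)"
    using homeomorphic_space_def by blast
  moreover have "top_of_set Q homeomorphic_space subtopology (flag_topology c) (?ch ` Q)"
    using homeomorphic_map_flag_chart[OF c g(3) QN] homeomorphic_map_imp_homeomorphic_space by blast
  ultimately have "subtopology (flag_topology c) (?ch ` Q) homeomorphic_space top_of_set (W' \<inter> L)"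
    using homeomorphic_space_sym homeomorphic_space_trans by blast
  moreover have "S \<inter> ?ch ` Q = ?ch ` Q" by (auto simp: Q_def)
  ultimately have "subtopology (subtopology (flag_topology c) S) (?ch ` Q) homeomorphic_space top_of_set (W' \<inter> L)"
    by (simp add: subtopology_subtopology)
  moreover have "V \<in> ?ch ` Q" using g(2) V W(1) by (auto simp: Q_def image_iff intro!: bexI[of _ 0])
  ultimately have "locally_modelled (subtopology (flag_topology c) S) V L"
    using oU oA unfolding locally_modelled_def by blast
  then show ?thesis by (rule that[OF W(5,7)])
qed

text \<open>The map f is only a homeomorphism: it gives equal real dimensions, which determine the
  complex ones.\<close>

lemma complex_submanifold_dim_unique:
  fixes S S' :: "'n::{finite,linorder} flag set"
  assumes c: "dim_seq TYPE('n) c" "dim_seq TYPE('n) c'"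
    and S: "complex_submanifold c k S" "V \<in> S" and S': "complex_submanifold c' k' S'" "V' \<in> S'"
    and f: "homeomorphic_map (subtopology (flag_topology c) S) (subtopology (flag_topology c') S') f" "f V = V'"
  shows "k = k'"
proof -
  obtain L :: "(complex^('n \<times> 'n)) set" where L: "vec.subspace L" "vec.dim L = k"
    "locally_modelled (subtopology (flag_topology c) S) V L"
    using complex_submanifold_locally_modelled[OF c(1) S] by metis
  obtain L' :: "(complex^('n \<times> 'n)) set" where L': "vec.subspace L'" "vec.dim L' = k'"
    "locally_modelled (subtopology (flag_topology c') S') V' L'"
    using complex_submanifold_locally_modelled[OF c(2) S'] by metis
  have "locally_modelled (subtopology (flag_topology c') S') V' L"
    using locally_modelled_homeomorphic[OF f(1) L(3)] f(2) by simp
  then have "dim L = dim L'"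
    using L L' vec_subspace_imp_subspace locally_modelled_dim_le by (meson order_antisym)
  then show ?thesis using complex_dim_less_imp_dim_less L L' by (metis linorder_neqE_nat order_less_irrefl)
qed

text \<open>Density of U makes every other relatively open submanifold U' meet U. At a common point
  both describe the same neighbourhood, so their dimensions agree and the supremum is over a
  singleton.\<close>

lemma complex_dim_eq:
  fixes A U :: "'n::{finite,linorder} flag set"
  assumes c: "dim_seq TYPE('n) c" and U: "complex_submanifold c k U"
    "openin (subtopology (flag_topology c) A) U" "U \<noteq> {}" "A \<subseteq> flag_topology c closure_of U"
  shows "complex_dim c A = k"
proof -
  have "k' = k" if U': "U' \<noteq> {}" "openin (subtopology (flag_topology c) A) U'" "complex_submanifold c k' U'" for U' k'
  proof -
    have UA: "U \<subseteq> A" "U' \<subseteq> A" using openin_subset[OF U(2)] openin_subset[OF U'(2)] by auto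
    obtain T where T: "openin (flag_topology c) T" "U' = A \<inter> T"
      using U'(2) unfolding openin_subtopology_alt by blast
    obtain x where x: "x \<in> U'" using U'(1) by blast
    then have "x \<in> flag_topology c closure_of U" using U(4) UA by blast
    then obtain V where V: "V \<in> U" "V \<in> T" using T x by (auto simp: in_closure_of)
    then have V': "V \<in> U'" using T UA by blast
    have loc: "locally_modelled (subtopology (flag_topology c) A) V L"
      if "locally_modelled (subtopology (flag_topology c) Y) V L" "openin (subtopology (flag_topology c) A) Y"
      for Y and L :: "(complex^('n \<times> 'n)) set"
    proof (rule locally_modelled_open_subspace[OF that(2)])
      have "A \<inter> Y = Y" using openin_subset[OF that(2)] by auto
      then show "locally_modelled (subtopology (subtopology (flag_topology c) A) Y) V L"
        using that(1) by (simp add: subtopology_subtopology)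
    qed
    obtain L :: "(complex^('n \<times> 'n)) set" where L: "vec.subspace L" "vec.dim L = k"
      "locally_modelled (subtopology (flag_topology c) U) V L"
      using complex_submanifold_locally_modelled[OF c U(1) V(1)] by metis
    obtain L' :: "(complex^('n \<times> 'n)) set" where L': "vec.subspace L'" "vec.dim L' = k'"
      "locally_modelled (subtopology (flag_topology c) U') V L'"
      using complex_submanifold_locally_modelled[OF c U'(3) V'] by metis
    have "dim L = dim L'"
      using loc[OF L(3) U(2)] loc[OF L'(3) U'(2)] L(1) L'(1) vec_subspace_imp_subspace
        locally_modelled_dim_le by (meson order_antisym)
    then show ?thesis using complex_dim_less_imp_dim_less L L' by (metis linorder_neqE_nat order_less_irrefl)
  qed
  then have "{k. \<exists>U. U \<noteq> {} \<and> openin (subtopology (flag_topology c) A) U \<and> complex_submanifold c k U} = {k}"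
    using U by blast
  then show ?thesis by (simp add: complex_dim_def)
qed

lemma complex_dim_submanifold:
  fixes S :: "'n::{finite,linorder} flag set"
  assumes c: "dim_seq TYPE('n) c" and S: "complex_submanifold c k S" "S \<noteq> {}"
  shows "complex_dim c S = k"
proof (rule complex_dim_eq[OF c S(1)])
  have "S \<subseteq> topspace (flag_topology c)"
    using S(1) by (simp add: topspace_flag_topology[OF c] complex_submanifold_def)
  then show "openin (subtopology (flag_topology c) S) S" "S \<subseteq> flag_topology c closure_of S"
    by (auto simp: closure_of_subset openin_subtopology_refl)
qed (rule S(2))

lemma complex_submanifold_flags:
  assumes c: "dim_seq TYPE('n) c"
  shows "complex_submanifold c (vec.dim (nil_lower c :: (complex^('n \<times> 'n)) set))
     (flags c :: 'n::{finite,linorder} flag set)"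
  unfolding complex_submanifold_def
proof (intro conjI ballI impI)
  fix g :: "'n cmat" assume g: "g \<in> SL_complex" and "act g (base_flag c) \<in> flags c"
  let ?N = "nil_lower c :: (complex^('n \<times> 'n)) set"
  have hol: "holomorphic_map_on (\<lambda>x. x) ?N"
    unfolding holomorphic_map_on_def by (auto intro!: exI[of _ "\<lambda>x. x"] has_derivative_ident)
  have "holomorphic_map_on (inv_into ?N id) ?N"
    unfolding holomorphic_map_on_def
  proof (intro ballI exI conjI allI)
    fix x assume x: "x \<in> ?N"
    show "(inv_into ?N id has_derivative (\<lambda>x. x)) (at x within ?N)"
      by (rule has_derivative_transform[OF x _ has_derivative_ident]) (metis id_apply inj_on_id inv_into_f_f)
  qed simp
  then have bih: "biholomorphic_map ?N ?N id"
    using hol by (simp add: biholomorphic_map_def id_def bij_betw_def)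
  have ch: "flag_chart c g x \<in> flags c" if "x \<in> ?N" for x
    using continuous_map_image_subset_topspace[OF flag_chart_open_embedding(1)[OF c SL_invertible[OF g]]] that
    by (auto simp: topspace_flag_topology[OF c])
  show "\<exists>W W' h L. 0 \<in> W \<and> openin (top_of_set ?N) W \<and> openin (top_of_set ?N) W' \<and>
      biholomorphic_map W W' h \<and> vec.subspace L \<and> L \<subseteq> ?N \<and> vec.dim L = vec.dim ?N \<and>
      h ` {x \<in> W. flag_chart c g x \<in> flags c} = W' \<inter> L"
    by (rule exI[of _ ?N], rule exI[of _ ?N], rule exI[of _ id], rule exI[of _ ?N])
      (use bih ch vec.subspace_0[OF subspace_nil_lower] in \<open>auto simp: subspace_nil_lower\<close>)
qed simp

lemma complex_dim_flags:
  assumes c: "dim_seq TYPE('n) c"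
  shows "complex_dim c (flags c :: 'n::{finite,linorder} flag set) = vec.dim (nil_lower c :: (complex^('n \<times> 'n)) set)"
  using complex_dim_submanifold[OF c complex_submanifold_flags[OF c]] base_flag_in_flags[OF c] by blast

section \<open>Projections between flag manifolds\<close>

lemma length_blocks [simp]: "length (blocks t xs) = length t"
  by (induction t arbitrary: xs) auto

lemma partial_sum_blocks:
  "partial_sum (map sum_list (blocks t d)) j = partial_sum d (partial_sum t j)"
proof (induction t arbitrary: d j)
  case (Cons a t)
  show ?case
  proof (cases j)
    case (Suc k)
    have "partial_sum (map sum_list (blocks (a # t) d)) j =
        sum_list (take a d) + partial_sum (map sum_list (blocks t (drop a d))) k"
      using Suc by (simp add: partial_sum_def)
    also have "\<dots> = sum_list (take a d) + sum_list (take (partial_sum t k) (drop a d))"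
      unfolding Cons.IH by (simp add: partial_sum_def)
    also have "\<dots> = partial_sum d (a + partial_sum t k)"
      unfolding partial_sum_def by (simp add: take_add)
    also have "a + partial_sum t k = partial_sum (a # t) j" using Suc by (simp add: partial_sum_def)
    finally show ?thesis .
  qed simp
qed (simp add: partial_sum_def)

text \<open>Any projection that forgets members of a flag; that d refines both f and its reverse is
  added only in \<open>measurable_model\<close>.\<close>

locale flag_fibration =
  fixes f d t :: "nat list" and type :: "'n::{finite,linorder} itself"
  assumes f: "dim_seq TYPE('n) f" and d_pos: "0 \<notin> set d" and grouping: "grouping t d f"
begin

lemma t_pos: "0 \<notin> set t" and sum_t: "sum_list t = length d" and f_eq: "f = map sum_list (blocks t d)"
  using grouping by (auto simp: grouping_def)

lemma length_f: "length f = length t" by (simp add: f_eq)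

lemma partial_sum_f: "partial_sum f j = partial_sum d (partial_sum t j)"
  unfolding f_eq by (rule partial_sum_blocks)

lemma d: "dim_seq TYPE('n) d"
proof -
  have "sum_list f = sum_list d"
    using partial_sum_f[of "length t"] by (simp add: partial_sum_length length_f sum_t)
  then show ?thesis using f d_pos by (simp add: dim_seq_def)
qed

lemma partial_sum_t_bounds:
  assumes "j < length t" shows "0 < partial_sum t (Suc j)" "partial_sum t (Suc j) \<le> length d"
  using partial_sum_strict_mono[OF t_pos, of 0 "Suc j"] partial_sum_le_sum[of t "Suc j"] assms sum_t by auto

lemma flag_proj_nth: "j < length t \<Longrightarrow> flag_proj t V ! j = V ! (partial_sum t (Suc j) - 1)"
  by (simp add: flag_proj_def)

lemma length_flag_proj [simp]: "length (flag_proj t V) = length t"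
  by (simp add: flag_proj_def)

lemma flag_proj_act:
  assumes "length V = length d" shows "flag_proj t (act g V) = act g (flag_proj t V)"
proof (rule nth_equalityI)
  fix j assume "j < length (flag_proj t (act g V))"
  then have j: "j < length t" by simp
  then have "partial_sum t (Suc j) - 1 < length V" using partial_sum_t_bounds[OF j] assms by linarith
  then show "flag_proj t (act g V) ! j = act g (flag_proj t V) ! j"
    using j by (simp add: flag_proj_nth)
qed simp

lemma flag_proj_coord_flag: "flag_proj t (coord_flag d w :: 'n flag) = coord_flag f w"
proof (rule nth_equalityI)
  fix j assume "j < length (flag_proj t (coord_flag d w :: 'n flag))"
  then have j: "j < length t" by simp
  then have "partial_sum t (Suc j) - 1 < length d" "Suc (partial_sum t (Suc j) - 1) = partial_sum t (Suc j)"
    using partial_sum_t_bounds[OF j] by linarith+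
  then show "flag_proj t (coord_flag d w :: 'n flag) ! j = coord_flag f w ! j"
    using j by (simp add: flag_proj_nth coord_flag_def length_f partial_sum_f)
qed (simp add: length_f)

lemma flag_proj_act_base: "flag_proj t (act M (base_flag d :: 'n flag)) = act M (base_flag f)"
  by (simp add: flag_proj_act flag_proj_coord_flag base_flag_def)

lemma flag_proj_in_flags: "(V :: 'n flag) \<in> flags d \<Longrightarrow> flag_proj t V \<in> flags f"
  using flags_transitive[OF d] flag_proj_act_base act_in_flags base_flag_in_flags[OF f] by metis

lemma continuous_map_flag_proj:
  "continuous_map (flag_topology d) (flag_topology f) (flag_proj t :: 'n flag \<Rightarrow> 'n flag)"
  unfolding continuous_map topspace_flag_topology[OF d] topspace_flag_topology[OF f]
proof (intro conjI allI impI)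
  show "flag_proj t ` flags d \<subseteq> (flags f :: 'n flag set)" using flag_proj_in_flags by blast
  fix U :: "'n flag set" assume "openin (flag_topology f) U"
  then have "open {M :: 'n cmat. invertible M \<and> act M (base_flag f) \<in> U}"
    by (simp add: openin_flag_topology_iff[OF f])
  moreover have "{M :: 'n cmat. invertible M \<and> act M (base_flag d) \<in> {V \<in> flags d. flag_proj t V \<in> U}} =
      {M. invertible M \<and> act M (base_flag f) \<in> U}"
    using act_in_flags base_flag_in_flags[OF d] by (auto simp: flag_proj_act_base)
  ultimately show "openin (flag_topology d) {V \<in> flags d. flag_proj t V \<in> U}"
    by (simp add: openin_flag_topology_iff[OF d])
qed

lemma flag_proj_closure:
  assumes S: "(S :: 'n flag set) \<subseteq> flags d"
  shows "flag_proj t ` (flag_topology d closure_of S) = flag_topology f closure_of (flag_proj t ` S)"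
proof (rule subset_antisym)
  show "flag_proj t ` (flag_topology d closure_of S) \<subseteq> flag_topology f closure_of (flag_proj t ` S)"
    by (rule continuous_map_image_closure_subset[OF continuous_map_flag_proj])
  have "closed_map (flag_topology d) (flag_topology f) (flag_proj t :: 'n flag \<Rightarrow> 'n flag)"
    by (rule continuous_imp_closed_map[OF continuous_map_flag_proj compact_flag_topology[OF d]
          Hausdorff_flag_topology[OF f]])
  then show "flag_topology f closure_of (flag_proj t ` S) \<subseteq> flag_proj t ` (flag_topology d closure_of S)"
    using S unfolding closed_map_closure_of_image topspace_flag_topology[OF d] by blast
qed

lemma flag_proj_orbit:
  assumes "length V = length d"
  shows "flag_proj t ` orbit H (V :: 'n flag) = orbit H (flag_proj t V)"
  by (simp add: orbit_def image_image flag_proj_act[OF assms])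

lemma flag_proj_schubert_variety:
  assumes "(coord_flag d w :: 'n flag) \<in> flags d"
  shows "flag_proj t ` (schubert_variety d w :: 'n flag set) = schubert_variety f w"
proof -
  have "orbit borel_subgroup (coord_flag d w :: 'n flag) \<subseteq> flags d"
    using assms act_in_flags SL_invertible by (auto simp: orbit_def borel_subgroup_def)
  then show ?thesis
    by (simp add: schubert_variety_def flag_proj_closure flag_proj_orbit flag_proj_coord_flag)
qed

end

section \<open>Schubert cells\<close>

text \<open>The inverse is triangular as well, so in the sum for the diagonal entry of M times its
  inverse only the product of the two diagonal entries survives.\<close>

lemma triangular_diag_nonzero:
  fixes M :: "complex^'n^'n"
  assumes s: "inj s" and M: "M \<in> upper s" "invertible M"
  shows "M $ i $ i \<noteq> 0"
proof -
  let ?N = "matrix_inv M"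
  have N: "?N \<in> upper s" using M by (intro upper_matrix_inv)
  have z: "M $ i $ k * ?N $ k $ i = 0" if "k \<noteq> i" for k
    using M(1) N that injD[OF s, of i k] by (cases "s i" "s k" rule: linorder_cases) (auto simp: upper_def)
  have "(\<Sum>k\<in>UNIV - {i}. M $ i $ k * ?N $ k $ i) = 0"
    by (rule sum.neutral) (use z in blast)
  then have "(M ** ?N) $ i $ i = M $ i $ i * ?N $ i $ i"
    by (simp add: matrix_matrix_mult_def sum.remove[of UNIV i])
  then show ?thesis using matrix_inv_right[OF M(2)] by (auto simp: mat_def)
qed

text \<open>The factor is found row by row: the entries of row \<open>a\<close> of its inverse solve a linear system
  that is triangular for the order given by \<open>s\<close>.\<close>

lemma triangular_factorization:
  fixes M :: "complex^'n^'n" and s b :: "'n \<Rightarrow> nat"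
  assumes s: "inj s" and M: "M \<in> upper s" "invertible M"
  obtains X p where "X \<in> lower b" "X \<in> upper s" "p \<in> upper b" "invertible p" "M = (mat 1 + X) ** p"
proof -
  have "\<exists>y. (\<forall>j. \<not> (b j < b a \<and> s a < s j) \<longrightarrow> y j = 0) \<and>
      (\<forall>c. b c < b a \<and> s a < s c \<longrightarrow> (\<Sum>j\<in>UNIV. y j * M $ j $ c) = - M $ a $ c)" for a
  proof -
    \<comment> \<open>The positions where row a of \<open>Y\<close> may be nonzero. Requiring s a <
      s j keeps the factor triangular for s as well as strictly lower for b.\<close>
    define I where "I = {j. b j < b a \<and> s a < s j}"
    \<comment> \<open>The matrix of the linear system, padded with the identity outside
      \<open>I\<close> to a square matrix on the full index type. Its kernel is trivial by induction
      on s, because the diagonal of M does not vanish.\<close>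
    define N :: "complex^'n^'n" where
      "N = (\<chi> c j. if c \<in> I then if j \<in> I then M $ j $ c else 0 else if j = c then 1 else 0)"
    have Ny: "(N *v y) $ c = (if c \<in> I then \<Sum>j\<in>UNIV. (if j \<in> I then y $ j else 0) * M $ j $ c else y $ c)" for y c
    proof (cases "c \<in> I")
      case True
      then have "(N *v y) $ c = (\<Sum>j\<in>UNIV. (if j \<in> I then M $ j $ c else 0) * y $ j)"
        by (simp add: N_def matrix_vector_mult_def)
      also have "\<dots> = (\<Sum>j\<in>UNIV. (if j \<in> I then y $ j else 0) * M $ j $ c)"
        by (rule sum.cong) auto
      finally show ?thesis using True by simp
    next
      case False
      then have "(N *v y) $ c = (\<Sum>j\<in>UNIV. (if j = c then 1 else 0) * y $ j)"
        by (simp add: N_def matrix_vector_mult_def)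
      also have "\<dots> = (\<Sum>j\<in>UNIV. if j = c then y $ j else 0)" by (rule sum.cong) auto
      finally show ?thesis using False by simp
    qed
    have "y = 0" if y: "N *v y = 0" for y
    proof -
      have out: "y $ c = 0" if "c \<notin> I" for c using Ny[of y c] y that by simp
      have "\<forall>c. s c = m \<longrightarrow> y $ c = 0" for m
      proof (induction m rule: less_induct)
        case (less m)
        show ?case
        proof (intro allI impI)
          fix c assume c: "s c = m"
          show "y $ c = 0"
          proof (cases "c \<in> I")
            case True
            have z: "(if j \<in> I then y $ j else 0) * M $ j $ c = 0" if "j \<noteq> c" for j
              using that less c M(1) injD[OF s, of j c] by (cases "s j" "s c" rule: linorder_cases) (auto simp: upper_def)
            have "(\<Sum>j\<in>UNIV - {c}. (if j \<in> I then y $ j else 0) * M $ j $ c) = 0"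
              by (rule sum.neutral) (use z in blast)
            then have "(\<Sum>j\<in>UNIV. (if j \<in> I then y $ j else 0) * M $ j $ c) = y $ c * M $ c $ c"
              using True by (simp add: sum.remove[of UNIV c])
            then show ?thesis using Ny[of y c] y True triangular_diag_nonzero[OF s M] by simp
          qed (rule out)
        qed
      qed
      then show ?thesis by (simp add: vec_eq_iff)
    qed
    then obtain N' where "N' ** N = mat 1" using matrix_left_invertible_ker by blast
    then have N': "N ** N' = mat 1" by (rule matrix_left_right_inverse1)
    define y where "y = N' *v (\<chi> c. if c \<in> I then - M $ a $ c else 0)"
    have "N *v y = (\<chi> c. if c \<in> I then - M $ a $ c else 0)"
      using N' by (simp add: y_def matrix_vector_mul_assoc)
    then have *: "(if c \<in> I then \<Sum>j\<in>UNIV. (if j \<in> I then y $ j else 0) * M $ j $ c else y $ c) =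
        (if c \<in> I then - M $ a $ c else 0)" for c
      using Ny[of y c] by simp
    have "(\<Sum>j\<in>UNIV. (if j \<in> I then y $ j else 0) * M $ j $ c) = - M $ a $ c" if "b c < b a \<and> s a < s c" for c
    proof -
      have "c \<in> I" using that by (simp add: I_def)
      then show ?thesis using *[of c] by simp
    qed
    then show ?thesis
      by (intro exI[of _ "\<lambda>j. if j \<in> I then y $ j else 0"]) (simp add: I_def)
  qed
  then obtain y where y0: "\<And>a j. \<not> (b j < b a \<and> s a < s j) \<Longrightarrow> y a j = 0"
    and y: "\<And>a c. b c < b a \<Longrightarrow> s a < s c \<Longrightarrow> (\<Sum>j\<in>UNIV. y a j * M $ j $ c) = - M $ a $ c" by metis
  define Y :: "complex^'n^'n" where "Y = (\<chi> a j. y a j)"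
  have Y: "Y \<in> lower b" "Y \<in> upper s" using y0 by (auto simp: Y_def lower_def upper_def)
  let ?U = "mat 1 + Y"
  have iU: "invertible ?U" by (rule invertible_unipotent[OF Y(1)])
  define p where "p = ?U ** M"
  have YM: "(Y ** M) $ a $ c = (\<Sum>j\<in>UNIV. y a j * M $ j $ c)" for a c
    by (simp add: Y_def matrix_matrix_mult_def)
  \<comment> \<open>For columns not covered by the linear system one has s c < s a, and
    triangularity for s makes both sides zero.\<close>
  have "(Y ** M) $ a $ c = - M $ a $ c" if "b c < b a" for a c
  proof (cases "s a < s c")
    case True then show ?thesis using y that by (simp add: YM)
  next
    case False
    then have "s c < s a" using that injD[OF s, of a c] by (cases "s a = s c") auto
    then have z: "y a j * M $ j $ c = 0" for j
      using y0[of j a] M(1) by (cases "s a < s j") (auto simp: upper_def)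
    have "(Y ** M) $ a $ c = 0" unfolding YM by (rule sum.neutral) (use z in blast)
    then show ?thesis using \<open>s c < s a\<close> M(1) by (simp add: upper_def)
  qed
  then have p: "p \<in> upper b" by (simp add: p_def upper_def matrix_mult.add_left)
  have ip: "invertible p" using iU M(2) by (simp add: p_def invertible_mult_iff)
  let ?X = "matrix_inv ?U - mat 1"
  have "?X \<in> lower b" by (rule unipotent_inverse[OF Y(1)])
  moreover have "?X \<in> upper s"
    using iU Y(2) by (intro upper_diff upper_matrix_inv upper_add) auto
  moreover have "M = (mat 1 + ?X) ** p" using iU by (simp add: p_def mat_mult_cancel_left)
  ultimately show ?thesis using p ip that by blast
qed

lemma dim_supported: "vec.dim {v :: complex^'m. \<forall>i. i \<notin> A \<longrightarrow> v $ i = 0} = card A"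
  using dim_axes[of A] by (simp only: span_axes)

lemma dim_nil_lower:
  "vec.dim (nil_lower c :: (complex^('n \<times> 'n)) set) =
    card {(i :: 'n::{finite,linorder}, j :: 'n). block_index c j < block_index c i}"
proof -
  have "(nil_lower c :: (complex^('n \<times> 'n)) set) =
      {v. \<forall>p. p \<notin> {(i :: 'n, j :: 'n). block_index c j < block_index c i} \<longrightarrow> v $ p = 0}"
    by (auto simp: nil_lower_def not_less)
  then show ?thesis by (simp only: dim_supported)
qed

text \<open>A change of charts is the map that extracts the unipotent factor after left multiplication.\<close>

definition transition :: "nat list \<Rightarrow> 'n::{finite,linorder} cmat \<Rightarrow> complex^('n \<times> 'n) \<Rightarrow> complex^('n \<times> 'n)" where
  "transition c A x = mvec (low_factor (block_index c) (A ** (mat 1 + vmat x)))"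

definition transition_domain :: "nat list \<Rightarrow> 'n::{finite,linorder} cmat \<Rightarrow> (complex^('n \<times> 'n)) set" where
  "transition_domain c A = {x \<in> nil_lower c. A ** (mat 1 + vmat x) \<in> big_cell (block_index c)}"

lemma openin_transition_domain: "openin (top_of_set (nil_lower c)) (transition_domain c A)"
proof -
  have "open ((\<lambda>x. A ** (mat 1 + vmat x)) -` big_cell (block_index c))"
    by (intro open_vimage open_big_cell matrix_mult.continuous_on continuous_intros continuous_on_vmat)
  then show ?thesis
    unfolding openin_open transition_domain_def by (intro exI conjI) auto
qed

text \<open>The last claim carries its hypothesis as a disjunct, because the first two hold for
  every list c and are used in that generality.\<close>

lemma transition_inverse:
  fixes A :: "'n::{finite,linorder} cmat"
  assumes A: "invertible A" and x: "x \<in> transition_domain c A"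
  shows "transition c A x \<in> transition_domain c (matrix_inv A)" "transition c (matrix_inv A) (transition c A x) = x"
    "flag_chart c (g ** A) x = flag_chart c g (transition c A x) \<or> \<not> dim_seq TYPE('n) c"
proof -
  let ?b = "block_index c :: 'n \<Rightarrow> nat"
  define Y where "Y = low_factor ?b (A ** (mat 1 + vmat x))"
  have X: "vmat x \<in> lower ?b" using x by (simp add: transition_domain_def nil_lower_iff)
  obtain q where q: "Y \<in> lower ?b" "q \<in> upper ?b" "invertible q" "A ** (mat 1 + vmat x) = (mat 1 + Y) ** q"
    using x big_cellE[of "A ** (mat 1 + vmat x)" ?b] unfolding Y_def transition_domain_def by blast
  have tr: "transition c A x = mvec Y" by (simp add: transition_def Y_def)
  have "matrix_inv A ** (mat 1 + Y) = matrix_inv A ** ((mat 1 + Y) ** q) ** matrix_inv q"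
    using q(3) by (simp add: matrix_mul_assoc[symmetric] matrix_inv_right)
  also have "\<dots> = (mat 1 + vmat x) ** matrix_inv q"
    using A by (simp add: q(4)[symmetric] mat_mult_cancel_left)
  finally have eq: "matrix_inv A ** (mat 1 + Y) = (mat 1 + vmat x) ** matrix_inv q" .
  have q': "matrix_inv q \<in> upper ?b" "invertible (matrix_inv q)"
    using q by (auto simp: upper_matrix_inv invertible_matrix_inv)
  show "transition c A x \<in> transition_domain c (matrix_inv A)"
    using big_cellI[OF X q'] q(1) by (simp add: tr transition_domain_def eq mvec_nil_lower)
  show "transition c (matrix_inv A) (transition c A x) = x"
    using low_factor_eq[OF X q'] by (simp add: tr transition_def[of c "matrix_inv A"] eq)
  show "flag_chart c (g ** A) x = flag_chart c g (transition c A x) \<or> \<not> dim_seq TYPE('n) c"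
    using act_base_flag_upper[of c q "g ** (mat 1 + Y)"] q
    by (auto simp: flag_chart_eq tr matrix_mul_assoc[symmetric])
qed

lemma holomorphic_transition: "holomorphic_map_on (transition c A) (transition_domain c A)"
  unfolding holomorphic_map_on_def
proof
  fix x assume x: "x \<in> transition_domain c A"
  let ?b = "block_index c"
  let ?m = "\<lambda>x. A ** (mat 1 + vmat x)"
  obtain f' where f': "(low_factor ?b has_derivative f') (at (?m x))" "\<And>c H. f' (mat c ** H) = mat c ** f' H"
    using low_factor_at(2) x unfolding transition_domain_def by blast
  have "((\<lambda>x. mat 1 + vmat x) has_derivative vmat) (at x)"
    using has_derivative_add[OF has_derivative_const bounded_linear_imp_has_derivative[OF bounded_linear_vmat]]
    by simp
  then have "(?m has_derivative (\<lambda>v. A ** vmat v)) (at x)"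
    by (rule bounded_linear.has_derivative[OF matrix_mult.bounded_linear_right])
  then have "((\<lambda>x. low_factor ?b (?m x)) has_derivative (\<lambda>v. f' (A ** vmat v))) (at x)"
    using f'(1) by (rule has_derivative_compose)
  then have "(transition c A has_derivative (\<lambda>v. mvec (f' (A ** vmat v)))) (at x)"
    unfolding transition_def[abs_def] by (rule bounded_linear.has_derivative[OF bounded_linear_mvec])
  then have "(transition c A has_derivative (\<lambda>v. mvec (f' (A ** vmat v)))) (at x within transition_domain c A)"
    by (rule has_derivative_at_withinI)
  moreover have "mvec (f' (A ** vmat (a *s v))) = a *s mvec (f' (A ** vmat v))" for a v
  proof -
    have "A ** vmat (a *s v) = mat a ** (A ** vmat v)"
      unfolding vmat_scale by (metis matrix_mul_assoc matrix_scale_commute)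
    then show ?thesis by (simp add: f'(2) mvec_scale)
  qed
  ultimately show "\<exists>h'. (transition c A has_derivative h') (at x within transition_domain c A) \<and>
      (\<forall>a v. h' (a *s v) = a *s h' v)" by blast
qed

lemma biholomorphic_transition:
  assumes A: "invertible A"
  shows "biholomorphic_map (transition_domain c A) (transition_domain c (matrix_inv A)) (transition c A)"
proof -
  let ?W = "transition_domain c A" and ?W' = "transition_domain c (matrix_inv A)"
  note tr = transition_inverse[OF A]
  note tr' = transition_inverse[OF invertible_matrix_inv[OF A], unfolded matrix_inv_inv[OF A]]
  have bij: "bij_betw (transition c A) ?W ?W'"
    by (rule bij_betw_byWitness[where f'="transition c (matrix_inv A)"]) (use tr tr' in auto)
  have inv: "inv_into ?W (transition c A) y = transition c (matrix_inv A) y" if "y \<in> ?W'" for y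
    using bij tr'(1,2)[OF that] by (metis bij_betw_inv_into_left)
  have "holomorphic_map_on (inv_into ?W (transition c A)) ?W'"
    unfolding holomorphic_map_on_def
  proof
    fix y assume y: "y \<in> ?W'"
    obtain h' where h': "(transition c (matrix_inv A) has_derivative h') (at y within ?W')"
      "\<forall>a v. h' (a *s v) = a *s h' v"
      using holomorphic_transition y unfolding holomorphic_map_on_def by blast
    then show "\<exists>h'. (inv_into ?W (transition c A) has_derivative h') (at y within ?W') \<and>
        (\<forall>a v. h' (a *s v) = a *s h' v)"
      using has_derivative_transform[OF y inv h'(1)] by blast
  qed
  then show ?thesis using bij holomorphic_transition by (simp add: biholomorphic_map_def)
qed

definition perm_matrix :: "'n::{finite,linorder} list \<Rightarrow> 'n cmat" where
  "perm_matrix w = (\<chi> i j. if i = w ! rk j then 1 else 0)"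

text \<open>The Schubert cell in the chart centred at its own coordinate flag. The free coordinates
  are the inversions between different blocks: i stands in a later block than j and carries the
  smaller value.\<close>

definition schubert_space :: "nat list \<Rightarrow> 'n::{finite,linorder} list \<Rightarrow> (complex^('n \<times> 'n)) set" where
  "schubert_space c w = {x \<in> nil_lower c. \<forall>i j. \<not> w ! rk i < w ! rk j \<longrightarrow> x $ (i, j) = 0}"

context
  fixes c :: "nat list" and w :: "'n::{finite,linorder} list"
  assumes c: "dim_seq TYPE('n) c" and w: "distinct w" "set w = UNIV"
begin

lemma length_perm: "length w = CARD('n)"
  using w by (metis distinct_card)

lemma inj_perm: "inj (\<lambda>i::'n. w ! rk i)"
  using w(1) length_perm by (auto intro!: injI simp: nth_eq_iff_index_eq)

lemma bij_perm: "bij (\<lambda>i::'n. w ! rk i)"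
  using inj_perm by (simp add: bij_def finite_UNIV_inj_surj)

lemma column_perm_matrix: "column j (perm_matrix w) = axis (w ! rk j) 1"
  by (auto simp: perm_matrix_def column_def axis_def vec_eq_iff)

lemma perm_matrix_mult_left: "(perm_matrix w ** M) $ (w ! rk i) $ j = M $ i $ j"
  by (simp add: perm_matrix_def matrix_matrix_mult_def if_distribR if_distrib inj_eq[OF inj_perm] cong: if_cong)

lemma perm_matrix_mult_right: "(M ** perm_matrix w) $ i $ j = M $ i $ (w ! rk j)"
  by (simp add: perm_matrix_def matrix_matrix_mult_def if_distribR if_distrib cong: if_cong)

lemma perm_matrix_image: 
  assumes "k \<le> CARD('n)" shows "(*v) (perm_matrix w) ` coord_space k = vec.span ((\<lambda>i. axis i 1) ` set (take k w))"
proof -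
  have "set (take k w) = (!) w ` rk ` {j::'n. rk j < k}"
    using assms length_perm by (simp add: set_take_nth rk_image)
  then show ?thesis
    by (simp add: coord_space_eq_span image_image mult_axis column_perm_matrix flip: vec.span_image)
qed

lemma invertible_perm_matrix: "invertible (perm_matrix w)"
proof -
  have "(*v) (perm_matrix w) ` coord_space CARD('n) = UNIV"
    using w(2) length_perm by (subst perm_matrix_image) (auto simp: span_axes)
  then have "surj ((*v) (perm_matrix w))" by (simp add: coord_space_CARD)
  then show ?thesis by (metis invertible_right_inverse matrix_right_invertible_surjective)
qed

lemma coord_flag_eq: "coord_flag c w = act (perm_matrix w) (base_flag c)"
  by (rule nth_equalityI)
    (simp_all add: base_flag_nth[OF c] perm_matrix_image partial_sum_le_CARD[OF c], simp add: coord_flag_def)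

lemma coord_flag_in_flags: "coord_flag c w \<in> flags c"
  unfolding coord_flag_eq by (rule act_in_flags[OF invertible_perm_matrix base_flag_in_flags[OF c]])

text \<open>Conjugation by the permutation matrix turns the Borel group into the matrices that are
  triangular for \<open>?s\<close>. \<open>triangular_factorization\<close> splits such a matrix
  into an element of \<open>schubert_space\<close> and a block upper factor, and the latter fixes
  the base flag.\<close>

lemma schubert_cell_eq:
  "orbit borel_subgroup (coord_flag c w) = flag_chart c (perm_matrix w) ` schubert_space c w"
proof -
  let ?P = "perm_matrix w" and ?s = "\<lambda>i::'n. rk (w ! rk i)" and ?b = "block_index c :: 'n \<Rightarrow> nat"
  have s: "inj ?s" using inj_perm by (auto simp: inj_def)
  have conj: "M \<in> upper ?s" if "N \<in> upper rk" "?P ** M = N ** ?P" for M N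
  proof -
    have "M $ i $ j = N $ (w ! rk i) $ (w ! rk j)" for i j
      using perm_matrix_mult_left[of M i j] perm_matrix_mult_right[of N "w ! rk i" j] that(2) by simp
    then show ?thesis using that(1) by (auto simp: upper_def)
  qed
  have conj': "N \<in> upper rk" if "M \<in> upper ?s" "?P ** M = N ** ?P" for M N
    unfolding upper_def
  proof clarify
    fix i j :: 'n assume ij: "rk j < rk i"
    obtain i' :: 'n where "i = w ! rk i'" using surjD[OF bij_is_surj[OF bij_perm], of i] by blast
    moreover obtain j' :: 'n where "j = w ! rk j'" using surjD[OF bij_is_surj[OF bij_perm], of j] by blast
    ultimately show "N $ i $ j = 0"
      using perm_matrix_mult_left[of M i' j'] perm_matrix_mult_right[of N "w ! rk i'" j'] that ij
      by (simp add: upper_def)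
  qed
  have sp: "x \<in> schubert_space c w \<longleftrightarrow> vmat x \<in> lower ?b \<and> mat 1 + vmat x \<in> upper ?s" for x
    by (auto simp: schubert_space_def nil_lower_def lower_def upper_def vmat_def mat_def not_less
        order.order_iff_strict dest: injD[OF inj_perm]) (metis linorder_less_linear)+
  show ?thesis
  proof (intro set_eqI iffI)
    fix V assume "V \<in> orbit borel_subgroup (coord_flag c w)"
    then obtain g where g: "g \<in> borel_subgroup" "V = act (g ** ?P) (base_flag c)"
      by (auto simp: orbit_def coord_flag_eq act_act)
    define M where "M = matrix_inv ?P ** (g ** ?P)"
    have PM: "?P ** M = g ** ?P" by (simp add: M_def mat_mult_cancel_left invertible_perm_matrix)
    have "g \<in> upper rk" "invertible g" using g(1) by (auto simp: borel_subgroup_def upper_def SL_invertible)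
    then have M: "M \<in> upper ?s" "invertible M"
      using conj[OF _ PM] invertible_perm_matrix
      by (auto simp: M_def invertible_mult_iff invertible_matrix_inv)
    obtain X p where X: "X \<in> lower ?b" "X \<in> upper ?s" "p \<in> upper ?b" "invertible p" "M = (mat 1 + X) ** p"
      using triangular_factorization[OF s M] by metis
    have "V = act (?P ** (mat 1 + X) ** p) (base_flag c)" using g(2) PM X(5) by (simp add: matrix_mul_assoc)
    also have "\<dots> = flag_chart c ?P (mvec X)" using act_base_flag_upper[OF c X(4,3)] by (simp add: flag_chart_eq)
    finally show "V \<in> flag_chart c ?P ` schubert_space c w"
      using X by (auto simp: sp upper_add intro!: imageI)
  next
    fix V assume "V \<in> flag_chart c ?P ` schubert_space c w"
    then obtain x where x: "x \<in> schubert_space c w" "V = flag_chart c ?P x" by blast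
    let ?X = "mat 1 + vmat x"
    define N where "N = ?P ** ?X ** matrix_inv ?P"
    have PN: "?P ** ?X = N ** ?P"
      using invertible_perm_matrix by (simp add: N_def matrix_mul_assoc[symmetric] matrix_inv_left)
    have N: "N \<in> upper rk" using conj'[OF _ PN] x sp by blast
    have iN: "invertible N"
      using x sp invertible_unipotent[of "vmat x" ?b] invertible_perm_matrix
      by (simp add: N_def invertible_mult_iff invertible_matrix_inv)
    have NB: "normalize_det N \<in> borel_subgroup"
      using normalize_det_SL[OF iN] upper_mult[OF N first_scaling_upper]
      by (auto simp: borel_subgroup_def normalize_det_def upper_def)
    \<comment> \<open>The determinant correction of N, moved past the permutation matrix; it is
      still diagonal, so it fixes the base flag.\<close>
    define D where "D = matrix_inv ?P ** (first_scaling (1 / det N) ** ?P)"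
    have PD: "?P ** D = first_scaling (1 / det N) ** ?P"
      by (simp add: D_def mat_mult_cancel_left invertible_perm_matrix)
    have "D $ i $ j = first_scaling (1 / det N) $ (w ! rk i) $ (w ! rk j)" for i j
      using perm_matrix_mult_left[of D i j] perm_matrix_mult_right[of "first_scaling (1 / det N)" "w ! rk i" j] PD
      by simp
    then have D: "D \<in> upper ?b" by (auto simp: upper_def first_scaling_def dest: injD[OF inj_perm])
    have iD: "invertible D"
      using iN invertible_perm_matrix
      by (simp add: D_def invertible_mult_iff invertible_matrix_inv)
        (simp add: invertible_det_nz det_first_scaling)
    have "act (normalize_det N) (coord_flag c w) = act (N ** ?P ** D) (base_flag c)"
      by (simp add: coord_flag_eq act_act normalize_det_def PD matrix_mul_assoc[symmetric])
    also have "\<dots> = V" using act_base_flag_upper[OF c iD D] x(2) by (simp add: flag_chart_eq PN)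
    finally show "V \<in> orbit borel_subgroup (coord_flag c w)"
      using NB by (auto simp: orbit_def)
  qed
qed

lemma subspace_schubert_space: "vec.subspace (schubert_space c w)"
  by (auto simp: vec.subspace_def schubert_space_def nil_lower_def)

lemma dim_schubert_space:
  "vec.dim (schubert_space c w) =
    card {(i :: 'n, j :: 'n). block_index c j < block_index c i \<and> w ! rk i < w ! rk j}"
proof -
  have "schubert_space c w =
      {v. \<forall>p. p \<notin> {(i :: 'n, j :: 'n). block_index c j < block_index c i \<and> w ! rk i < w ! rk j} \<longrightarrow> v $ p = 0}"
    by (auto simp: schubert_space_def nil_lower_def not_less)
  then show ?thesis by (simp only: dim_supported)
qed

text \<open>The transition from the chart at any point of the cell to the chart at the coordinate
  flag straightens the cell to the linear space \<open>schubert_space c w\<close>.\<close>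

lemma schubert_cell_submanifold:
  "complex_submanifold c (vec.dim (schubert_space c w)) (orbit borel_subgroup (coord_flag c w))"
  unfolding complex_submanifold_def
proof (intro conjI ballI impI)
  let ?P = "perm_matrix w" and ?S = "orbit borel_subgroup (coord_flag c w)"
  have LN: "schubert_space c w \<subseteq> nil_lower c" by (auto simp: schubert_space_def)
  show "?S \<subseteq> flags c"
    using coord_flag_in_flags act_in_flags SL_invertible by (auto simp: orbit_def borel_subgroup_def)
  fix g :: "'n cmat" assume g: "g \<in> SL_complex" and gS: "act g (base_flag c) \<in> ?S"
  have ig: "invertible g" using g by (rule SL_invertible)
  obtain y where y: "y \<in> schubert_space c w" "act g (base_flag c) = flag_chart c ?P y"
    using gS unfolding schubert_cell_eq by blast
  define A where "A = matrix_inv ?P ** g"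
  have iA: "invertible A" using ig invertible_perm_matrix by (simp add: A_def invertible_mult_iff invertible_matrix_inv)
  have PA: "?P ** A = g" by (simp add: A_def mat_mult_cancel_left invertible_perm_matrix)
  have "A \<in> big_cell (block_index c)"
    using act_base_eq_flag_chart_iff[OF c invertible_perm_matrix ig] y LN by (auto simp: A_def)
  then have W0: "0 \<in> transition_domain c A"
    using vec.subspace_0[OF subspace_nil_lower] by (simp add: transition_domain_def)
  note tr = transition_inverse[OF iA]
  note tr' = transition_inverse[OF invertible_matrix_inv[OF iA], unfolded matrix_inv_inv[OF iA]]
  have ch: "flag_chart c g x \<in> ?S \<longleftrightarrow> transition c A x \<in> schubert_space c w" if x: "x \<in> transition_domain c A" for x
  proof -
    have "flag_chart c g x = flag_chart c ?P (transition c A x)" using tr(3)[OF x, of ?P] c PA by simp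
    moreover have "transition c A x \<in> nil_lower c" using tr(1)[OF x] by (simp add: transition_domain_def)
    ultimately show ?thesis
      unfolding schubert_cell_eq
      using flag_chart_open_embedding(3)[OF c invertible_perm_matrix] LN by (auto dest: inj_onD)
  qed
  have "transition c A ` {x \<in> transition_domain c A. flag_chart c g x \<in> ?S} =
      transition_domain c (matrix_inv A) \<inter> schubert_space c w"
  proof (intro set_eqI iffI)
    fix z assume z: "z \<in> transition_domain c (matrix_inv A) \<inter> schubert_space c w"
    then show "z \<in> transition c A ` {x \<in> transition_domain c A. flag_chart c g x \<in> ?S}"
      using tr'(1,2)[of z] ch[of "transition c (matrix_inv A) z"]
      by (intro image_eqI[of _ _ "transition c (matrix_inv A) z"]) auto
  qed (use tr(1) ch in auto)
  then show "\<exists>W W' h L. 0 \<in> W \<and> openin (top_of_set (nil_lower c)) W \<and> openin (top_of_set (nil_lower c)) W' \<and>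
      biholomorphic_map W W' h \<and> vec.subspace L \<and> L \<subseteq> nil_lower c \<and> vec.dim L = vec.dim (schubert_space c w) \<and>
      h ` {x \<in> W. flag_chart c g x \<in> ?S} = W' \<inter> L"
    by (intro exI[of _ "transition_domain c A"] exI[of _ "transition_domain c (matrix_inv A)"]
        exI[of _ "transition c A"] exI[of _ "schubert_space c w"] conjI W0 openin_transition_domain
        biholomorphic_transition[OF iA] subspace_schubert_space LN refl)
qed

text \<open>The cell is linear, hence closed, inside the domain of its chart, so the variety meets
  that open domain in the cell alone. The cell is therefore open and dense in the variety. The
  formula holds for every permutation, sorted in the blocks or not.\<close>

lemma complex_dim_schubert_variety:
  "complex_dim c (schubert_variety c w) =
    card {(i :: 'n, j :: 'n). block_index c j < block_index c i \<and> w ! rk i < w ! rk j}"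
  unfolding dim_schubert_space[symmetric]
proof (rule complex_dim_eq[OF c schubert_cell_submanifold])
  let ?P = "perm_matrix w" and ?S = "orbit borel_subgroup (coord_flag c w)"
  let ?ch = "flag_chart c ?P" and ?N = "nil_lower c :: (complex^('n \<times> 'n)) set"
  note ch = flag_chart_open_embedding[OF c invertible_perm_matrix]
  have LN: "schubert_space c w \<subseteq> nil_lower c" by (auto simp: schubert_space_def)
  have "0 \<in> schubert_space c w" by (rule vec.subspace_0[OF subspace_schubert_space])
  then show "?S \<noteq> {}" unfolding schubert_cell_eq by blast
  show "schubert_variety c w \<subseteq> flag_topology c closure_of ?S" by (simp add: schubert_variety_def)
  have Sf: "?S \<subseteq> flags c" using schubert_cell_submanifold by (simp add: complex_submanifold_def)
  have "?S = schubert_variety c w \<inter> ?ch ` ?N"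
  proof (intro set_eqI iffI)
    fix V assume "V \<in> ?S"
    then show "V \<in> schubert_variety c w \<inter> ?ch ` ?N"
      using closure_of_subset[of ?S "flag_topology c"] Sf LN
      by (auto simp: schubert_variety_def topspace_flag_topology[OF c] schubert_cell_eq)
  next
    fix V assume V: "V \<in> schubert_variety c w \<inter> ?ch ` ?N"
    then obtain y where y: "y \<in> ?N" "V = ?ch y" by blast
    show "V \<in> ?S"
    proof (rule ccontr)
      assume "V \<notin> ?S"
      then have "y \<in> ?N - schubert_space c w" using y unfolding schubert_cell_eq by blast
      \<comment> \<open>A point of the chart domain off the linear space has an open neighbourhood
        disjoint from the cell, so it cannot lie in the closure.\<close>
      moreover have "openin (top_of_set ?N) (?N - schubert_space c w)"
        using closed_subspace[OF vec_subspace_imp_subspace[OF subspace_schubert_space]]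
        by (simp add: Diff_eq open_Compl openin_open_Int)
      then have o: "openin (flag_topology c) (?ch ` (?N - schubert_space c w))"
        using ch(2) by (simp add: open_map_def)
      ultimately have VT: "V \<in> ?ch ` (?N - schubert_space c w)" using y(2) by blast
      have "V \<in> flag_topology c closure_of ?S" using V by (simp add: schubert_variety_def)
      then obtain V' where V': "V' \<in> ?S" "V' \<in> ?ch ` (?N - schubert_space c w)"
        using conjunct2[OF in_closure_of[THEN iffD1], rule_format, OF _ conjI[OF VT o]] by metis
      then show False
        unfolding schubert_cell_eq using LN inj_on_image_Int[OF ch(3) LN, of "?N - schubert_space c w"] by blast
    qed
  qed
  moreover have "openin (flag_topology c) (?ch ` ?N)"
    using ch(2) by (simp add: open_map_def)
  ultimately show "openin (subtopology (flag_topology c) (schubert_variety c w)) ?S"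
    by (metis openin_subtopology_Int2)
qed

end

section \<open>Isotropic chains and unitary bases adapted to them\<close>

section \<open>Orthogonal complements for the bilinear form\<close>

definition bperp :: "(complex^'n) set \<Rightarrow> (complex^'n) set" where
  "bperp V = {x. \<forall>v\<in>V. bil x v = 0}"

lemma subspace_bperp: "vec.subspace (bperp V)"
  by (auto simp: vec.subspace_def bperp_def bil_add_left bil_scale_left)

lemma bperp_antimono: "V \<subseteq> W \<Longrightarrow> bperp W \<subseteq> bperp V"
  by (auto simp: bperp_def)

lemma subspace_eq_unitary_image:
  fixes V :: "(complex^'n::{finite,linorder}) set"
  assumes V: "vec.subspace V"
  obtains u :: "'n cmat" where "unitary u" "V = (*v) u ` coord_space (vec.dim V)"
proof -
  obtain B where B: "B \<subseteq> V" "vec.independent B" "V \<subseteq> vec.span B" "card B = vec.dim V"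
    using vec.basis_exists by metis
  obtain B' where B': "B \<subseteq> B'" "vec.independent B'" "UNIV \<subseteq> vec.span B'"
    using vec.maximal_independent_subset_extend[OF subset_UNIV B(2)] by metis
  have fin: "finite B'" using B'(2) by (rule vec.finiteI_independent)
  obtain us where us: "set us = B" "distinct us"
    using finite_distinct_list finite_subset[OF B'(1) fin] by metis
  obtain ws where ws: "set ws = B' - B" "distinct ws" using finite_distinct_list fin by (metis finite_Diff)
  have all: "set (us @ ws) = B'" "distinct (us @ ws)" using us ws B'(1) by auto
  have lu: "length us = vec.dim V" using us B(4) by (metis distinct_card)
  have "vec.dim (vec.span B') = CARD('n)"
    using B'(3) dim_coord_space[of "CARD('n)", where 'n='n] by (simp add: coord_space_CARD top.extremum_unique)
  then have "card B' = CARD('n)" using vec.dim_span_eq_card_independent[OF B'(2)] by simp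
  then have "length (us @ ws) = CARD('n)" using all by (metis distinct_card)
  then obtain M :: "'n cmat" where M: "invertible M"
    "\<And>k. k \<le> CARD('n) \<Longrightarrow> (*v) M ` coord_space k = vec.span (set (take k (us @ ws)))"
    using matrix_of_list[of "us @ ws"] all B'(2) by metis
  obtain u where u: "unitary u" "\<And>k. (*v) u ` coord_space k = (*v) M ` coord_space k"
    using gram_schmidt[OF M(1)] by metis
  have "vec.dim V \<le> CARD('n)"
    using lu \<open>length (us @ ws) = CARD('n)\<close> by simp
  then have "(*v) u ` coord_space (vec.dim V) = vec.span B"
    using M(2)[of "vec.dim V"] u(2) us(1) lu by simp
  also have "\<dots> = V" using B(1,3) V by (rule vec.span_subspace)
  finally show ?thesis using that u(1) by metis
qed

lemma dim_le_CARD: "vec.dim (V :: (complex^'n::{finite,linorder}) set) \<le> CARD('n)"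
  using vec.dim_subset[OF subset_UNIV, of V] dim_coord_space[of "CARD('n)", where 'n='n]
  by (simp add: coord_space_CARD)

lemma dim_UNIV_CARD: "vec.dim (UNIV :: (complex^'n::{finite,linorder}) set) = CARD('n)"
  using dim_coord_space[of "CARD('n)", where 'n='n] by (simp add: coord_space_CARD)

lemma invertible_transpose: "invertible M \<Longrightarrow> invertible (transpose M)" for M :: "complex^'n^'n"
  by (simp add: invertible_det_nz)

text \<open>Write V as the image under a unitary u of the first k coordinates. Then x lies in
  \<open>bperp V\<close> iff \<open>transpose u\<close> maps x to a vector whose first k coordinates
  vanish.\<close>

lemma dim_bperp:
  fixes V :: "(complex^'n::{finite,linorder}) set"
  assumes V: "vec.subspace V" shows "vec.dim (bperp V) = CARD('n) - vec.dim V"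
proof -
  let ?k = "vec.dim V"
  obtain u :: "'n cmat" where u: "unitary u" "V = (*v) u ` coord_space ?k"
    using subspace_eq_unitary_image[OF V] .
  let ?T = "transpose u"
  have iT: "invertible ?T" by (rule invertible_transpose[OF unitary_invertible[OF u(1)]])
  let ?Y = "{y :: (complex, 'n) vec. \<forall>i. i \<notin> - {i. rk i < ?k} \<longrightarrow> y $ i = 0}"
  have e1: "x \<in> bperp V \<longleftrightarrow> ?T *v x \<in> ?Y" for x
  proof -
    have T: "bil x (u *v v) = bil (?T *v x) v" for v
    proof -
      have "bil x (u *v v) = bil (u *v v) x" by (rule bil_commute)
      also have "\<dots> = bil v (?T *v x)" by (rule bil_mult_left)
      also have "\<dots> = bil (?T *v x) v" by (rule bil_commute)
      finally show ?thesis .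
    qed
    have "x \<in> bperp V \<longleftrightarrow> (\<forall>v\<in>coord_space ?k. bil x (u *v v) = 0)"
      by (subst u(2)) (auto simp: bperp_def)
    then have "x \<in> bperp V \<longleftrightarrow> (\<forall>v\<in>coord_space ?k. bil (?T *v x) v = 0)" by (simp only: T)
    also have "\<dots> \<longleftrightarrow> ?T *v x \<in> ?Y"
    proof
      assume *: "\<forall>v\<in>coord_space ?k. bil (?T *v x) v = 0"
      have "(?T *v x) $ i = 0" if "rk i < ?k" for i
        using *[rule_format, OF axis_in_coord_space[OF that]]
        by (simp add: bil_def axis_def if_distrib cong: if_cong del: transpose_matrix_vector)
      then show "?T *v x \<in> ?Y" by simp
    next
      assume *: "?T *v x \<in> ?Y"
      show "\<forall>v\<in>coord_space ?k. bil (?T *v x) v = 0"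
      proof
        fix v :: "(complex, 'n) vec" assume v: "v \<in> coord_space ?k"
        have z: "(?T *v x) $ i * v $ i = 0" for i
          using * v by (cases "rk i < ?k") (auto simp: coord_space_def simp del: transpose_matrix_vector)
        show "bil (?T *v x) v = 0" unfolding bil_def by (rule sum.neutral) (use z in blast)
      qed
    qed
    finally show ?thesis .
  qed
  have e2: "?T *v x \<in> ?Y \<longleftrightarrow> x \<in> (*v) (matrix_inv ?T) ` ?Y" for x
  proof
    assume "?T *v x \<in> ?Y"
    moreover have "x = matrix_inv ?T *v (?T *v x)"
      by (simp add: matrix_vector_mul_assoc matrix_inv_left[OF iT] del: transpose_matrix_vector)
    ultimately show "x \<in> (*v) (matrix_inv ?T) ` ?Y" by blast
  next
    assume "x \<in> (*v) (matrix_inv ?T) ` ?Y"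
    then obtain y where "y \<in> ?Y" "x = matrix_inv ?T *v y" by blast
    moreover from this(2) have "?T *v x = y"
      by (simp add: matrix_vector_mul_assoc matrix_inv_right[OF iT] del: transpose_matrix_vector)
    ultimately show "?T *v x \<in> ?Y" by metis
  qed
  have "bperp V = (*v) (matrix_inv ?T) ` ?Y" by (rule set_eqI) (simp only: e1 e2)
  then have "vec.dim (bperp V) = vec.dim ?Y" by (simp only: dim_image_mat[OF invertible_matrix_inv[OF iT]])
  also have "\<dots> = card (- {i::'n. rk i < ?k})" by (rule dim_supported)
  also have "\<dots> = CARD('n) - ?k" by (simp add: Compl_eq_Diff_UNIV card_Diff_subset card_rk_less[OF dim_le_CARD])
  finally show ?thesis .
qed

lemma bperp_bperp:
  fixes V :: "(complex^'n::{finite,linorder}) set"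
  assumes V: "vec.subspace V" shows "bperp (bperp V) = V"
proof (rule sym, rule vec.subspace_dim_equal[OF V subspace_bperp])
  show "V \<subseteq> bperp (bperp V)" by (auto simp: bperp_def bil_commute)
  show "vec.dim V \<ge> vec.dim (bperp (bperp V))"
    using dim_bperp[OF V] dim_bperp[OF subspace_bperp, of V] dim_le_CARD[of V] by simp
qed

lemma bperp_0: "bperp {0} = UNIV" by (simp add: bperp_def)

section \<open>Chains closed under orthogonal complements\<close>

text \<open>Comparability applies to A and \<open>bperp A\<close> in particular, so each member is
  isotropic or coisotropic. The zero space is included so that its complement, the whole space,
  belongs to the chain too.\<close>

definition isotropic_chain :: "(complex^'n) set set \<Rightarrow> bool" where
  "isotropic_chain \<F> \<longleftrightarrow> (\<forall>A\<in>\<F>. vec.subspace A) \<and> (\<forall>A\<in>\<F>. \<forall>B\<in>\<F>. A \<subseteq> B \<or> B \<subseteq> A) \<and>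
     (\<forall>A\<in>\<F>. bperp A \<in> \<F>) \<and> {0} \<in> \<F>"

lemma isotropic_chain_dim_inj:
  assumes F: "isotropic_chain \<F>" and AB: "A \<in> \<F>" "B \<in> \<F>" and le: "vec.dim A \<le> vec.dim B"
  shows "A \<subseteq> B"
proof -
  have s: "vec.subspace A" "vec.subspace B" "A \<subseteq> B \<or> B \<subseteq> A" using F AB by (auto simp: isotropic_chain_def)
  then show ?thesis using vec.subspace_dim_equal[OF s(2,1)] le by auto
qed

lemma isotropic_chain_finite:
  fixes \<F> :: "(complex^'n::{finite,linorder}) set set"
  assumes F: "isotropic_chain \<F>" shows "finite \<F>" "card \<F> \<le> CARD('n) + 1"
proof -
  have "inj_on vec.dim \<F>"
    using isotropic_chain_dim_inj[OF F] by (intro inj_onI) (metis order_refl subset_antisym)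
  moreover have "vec.dim ` \<F> \<subseteq> {..CARD('n)}" using dim_le_CARD by auto
  ultimately show "finite \<F>" "card \<F> \<le> CARD('n) + 1"
    using inj_on_finite[of vec.dim \<F> "{..CARD('n)}"] card_inj_on_le[of vec.dim \<F> "{..CARD('n)}"] by auto
qed

lemma isotropic_chain_insert:
  fixes C :: "(complex^'n::{finite,linorder}) set"
  assumes F: "isotropic_chain \<F>" and C: "vec.subspace C" "\<And>A. A \<in> \<F> \<Longrightarrow> A \<subseteq> C \<or> C \<subseteq> A"
    "C \<subseteq> bperp C \<or> bperp C \<subseteq> C"
  shows "isotropic_chain (insert C (insert (bperp C) \<F>))"
proof -
  have s: "vec.subspace A" "bperp A \<in> \<F>" if "A \<in> \<F>" for A using F that by (auto simp: isotropic_chain_def)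
  have C': "A \<subseteq> bperp C \<or> bperp C \<subseteq> A" if A: "A \<in> \<F>" for A
    using C(2)[OF s(2)[OF A]] bperp_antimono[of C "bperp A"] bperp_antimono[of "bperp A" C]
      bperp_bperp[OF s(1)[OF A]] by auto
  show ?thesis
    using F C C' subspace_bperp[of C] bperp_bperp[OF C(1)] unfolding isotropic_chain_def by auto
qed

lemma dim_span_insert:
  assumes "vec.subspace A" "x \<notin> A" shows "vec.dim (vec.span (insert x A)) = vec.dim A + 1"
  using assms by (simp add: vec.dim_insert vec.span_eq_iff[THEN iffD2])

text \<open>Two vectors x and y of B, independent modulo A, span a plane on which the quadratic form
  has a zero, since the complex numbers are algebraically closed. \<open>s\<close> below is the
  quadratic formula for bil(x + sy, x + sy) = 0.\<close>

lemma exists_isotropic_vector: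
  assumes A: "vec.subspace A" and B: "vec.subspace B" and AB: "A \<subseteq> B" and dim: "vec.dim A + 2 \<le> vec.dim B"
  obtains c where "c \<in> B" "c \<notin> A" "bil c c = 0"
proof -
  have "A \<noteq> B" using dim by auto
  then obtain y where y: "y \<in> B" "y \<notin> A" using AB by blast
  have "vec.span (insert y A) \<subseteq> B" using y AB B by (intro vec.span_minimal) auto
  moreover have "vec.span (insert y A) \<noteq> B" using dim_span_insert[OF A y(2)] dim by auto
  ultimately obtain x where x: "x \<in> B" "x \<notin> vec.span (insert y A)" by blast
  show ?thesis
  proof (cases "bil y y = 0")
    case True then show ?thesis using that y by blast
  next
    case False
    define D where "D = csqrt ((bil x y)\<^sup>2 - bil x x * bil y y)"
    define s where "s = (D - bil x y) / bil y y"
    have D: "D\<^sup>2 = (bil x y)\<^sup>2 - bil x x * bil y y" by (simp add: D_def)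
    have "bil (x + s *s y) (x + s *s y) = bil x x + 2 * s * bil x y + s\<^sup>2 * bil y y"
      by (simp add: bil_add_left bil_add_right bil_scale_left bil_scale_right bil_commute[of y x]
          power2_eq_square algebra_simps)
    also have "\<dots> = ((s * bil y y + bil x y)\<^sup>2 - D\<^sup>2) / bil y y"
      unfolding D using False by (simp add: field_simps power2_eq_square)
    also have "s * bil y y + bil x y = D" using False by (simp add: s_def)
    finally have "bil (x + s *s y) (x + s *s y) = 0" by simp
    moreover have "x + s *s y \<in> B" using x y B by (intro vec.subspace_add vec.subspace_scale)
    moreover have "x + s *s y \<notin> A"
    proof
      assume "x + s *s y \<in> A"
      then have "x + s *s y - s *s y \<in> vec.span (insert y A)"
        by (intro vec.span_diff vec.span_scale vec.span_base) auto
      then show False using x(2) by simp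
    qed
    ultimately show ?thesis using that by blast
  qed
qed

text \<open>The missing dimension k lies in a gap between neighbours A and B, and one vector c of B
  is added to A. If the gap is its own mirror image, that is \<open>bperp A = B\<close>, c has to be
  isotropic, and the gap is wide enough to contain such a vector. Otherwise the gap and its mirror
  image are different and any c works.\<close>

lemma isotropic_chain_refine:
  fixes \<F> :: "(complex^'n::{finite,linorder}) set set"
  assumes F: "isotropic_chain \<F>" and k: "k \<le> CARD('n)" "k \<notin> vec.dim ` \<F>"
  obtains \<G> where "isotropic_chain \<G>" "\<F> \<subset> \<G>"
proof -
  have fin: "finite \<F>" using isotropic_chain_finite[OF F] by simp
  have zero: "{0} \<in> \<F>" and sub: "\<And>A. A \<in> \<F> \<Longrightarrow> vec.subspace A" and perp: "\<And>A. A \<in> \<F> \<Longrightarrow> bperp A \<in> \<F>"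
    and chain: "\<And>A B. A \<in> \<F> \<Longrightarrow> B \<in> \<F> \<Longrightarrow> A \<subseteq> B \<or> B \<subseteq> A"
    using F by (auto simp: isotropic_chain_def)
  have UNIV: "UNIV \<in> \<F>" using perp[OF zero] by (simp add: bperp_0)
  have kne: "vec.dim X \<noteq> k" if "X \<in> \<F>" for X using k(2) that by auto
  let ?L = "{X \<in> \<F>. vec.dim X < k}" and ?R = "{X \<in> \<F>. k < vec.dim X}"
  have "{0} \<in> ?L" using zero kne[OF zero] by simp
  then obtain A where A: "A \<in> ?L" "\<And>X. X \<in> ?L \<Longrightarrow> vec.dim X \<le> vec.dim A"
  proof -
    have "\<exists>A. A \<in> ?L \<and> (\<forall>X. X \<in> ?L \<longrightarrow> vec.dim X \<le> vec.dim A)"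
      by (rule ex_has_greatest_nat[of _ "{0}" _ k]) (use \<open>{0} \<in> ?L\<close> in auto)
    then show ?thesis using that by blast
  qed
  have "UNIV \<in> ?R" using UNIV kne[OF UNIV] k(1) dim_UNIV_CARD[where 'n='n] by (simp del: vec.dim_UNIV)
  then obtain B where B: "B \<in> ?R" "\<And>X. X \<in> ?R \<Longrightarrow> vec.dim B \<le> vec.dim X"
    using arg_min_nat_lemma[of "\<lambda>X. X \<in> ?R" UNIV vec.dim] by blast
  have AF: "A \<in> \<F>" "vec.dim A < k" and BF: "B \<in> \<F>" "k < vec.dim B" using A B by auto
  have split: "X \<subseteq> A \<or> B \<subseteq> X" if X: "X \<in> \<F>" for X
    using A(2)[of X] B(2)[of X] X kne[OF X] isotropic_chain_dim_inj[OF F X AF(1)]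
      isotropic_chain_dim_inj[OF F BF(1) X] by (cases "vec.dim X < k") auto
  have AB: "A \<subseteq> B" using isotropic_chain_dim_inj[OF F AF(1) BF(1)] AF(2) BF(2) by simp
  have sA: "vec.subspace A" and sB: "vec.subspace B" using sub AF BF by auto
  have "\<exists>c. c \<in> B \<and> c \<notin> A \<and> (vec.span (insert c A) \<subseteq> bperp (vec.span (insert c A)) \<or>
      bperp (vec.span (insert c A)) \<subseteq> vec.span (insert c A))"
  proof (cases "bperp A = B")
    case True
    obtain c where c: "c \<in> B" "c \<notin> A" "bil c c = 0"
    proof (rule exists_isotropic_vector[OF sA sB AB])
      show "vec.dim A + 2 \<le> vec.dim B" using AF(2) BF(2) by linarith
    qed
    have "A \<subseteq> bperp A" "c \<in> bperp A" using True AB c by auto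
    then have "bil x v = 0" if "x \<in> insert c A" "v \<in> insert c A" for x v
      using that c(3) bil_commute[of x v] by (auto simp: bperp_def)
    then have "insert c A \<subseteq> bperp (insert c A)" by (auto simp: bperp_def)
    moreover have "bperp (insert c A) = bperp (vec.span (insert c A))"
    proof (rule subset_antisym)
      show "bperp (insert c A) \<subseteq> bperp (vec.span (insert c A))"
      proof
        fix x assume x: "x \<in> bperp (insert c A)"
        have "vec.span (insert c A) \<subseteq> bperp {x}"
          by (rule vec.span_minimal[OF _ subspace_bperp]) (use x in \<open>auto simp: bperp_def bil_commute[of x]\<close>)
        then show "x \<in> bperp (vec.span (insert c A))" by (auto simp: bperp_def bil_commute[of x])
      qed
      show "bperp (vec.span (insert c A)) \<subseteq> bperp (insert c A)"
        by (intro bperp_antimono vec.span_superset)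
    qed
    ultimately have "vec.span (insert c A) \<subseteq> bperp (vec.span (insert c A))"
      by (intro vec.span_minimal subspace_bperp) simp
    then show ?thesis using c by blast
  next
    case False
    \<comment> \<open>No condition on c: either \<open>bperp A\<close> is contained in A, or B is
      contained in \<open>bperp B\<close>, and the new space between A and B inherits the
      inclusion.\<close>
    obtain c where c: "c \<in> B" "c \<notin> A" using AF BF AB by (metis order_less_trans order_less_irrefl subsetI subset_antisym)
    let ?C = "vec.span (insert c A)"
    have CB: "?C \<subseteq> B" using c(1) AB sB by (intro vec.span_minimal) auto
    have AC: "A \<subseteq> ?C" using vec.span_superset[of "insert c A"] by auto
    have "?C \<subseteq> bperp ?C \<or> bperp ?C \<subseteq> ?C"
    proof (cases "bperp A \<subseteq> A")
      case True then show ?thesis using bperp_antimono[OF AC] AC by blast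
    next
      case False1: False
      then have BA: "B \<subseteq> bperp A" using split[OF perp[OF AF(1)]] by blast
      have "\<not> bperp B \<subseteq> A"
      proof
        assume "bperp B \<subseteq> A"
        then have "bperp A \<subseteq> B" using bperp_antimono bperp_bperp[OF sB] by metis
        then show False using BA False by blast
      qed
      then have "B \<subseteq> bperp B" using split[OF perp[OF BF(1)]] by blast
      then show ?thesis using bperp_antimono[OF CB] CB by blast
    qed
    then show ?thesis using c by blast
  qed
  then obtain c where c: "c \<in> B" "c \<notin> A" and iso: "vec.span (insert c A) \<subseteq> bperp (vec.span (insert c A)) \<or>
      bperp (vec.span (insert c A)) \<subseteq> vec.span (insert c A)" by blast
  let ?C = "vec.span (insert c A)"
  have CB: "?C \<subseteq> B" using c(1) AB sB by (intro vec.span_minimal) auto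
  have AC: "A \<subseteq> ?C" using vec.span_superset[of "insert c A"] by auto
  have dimC: "vec.dim ?C = vec.dim A + 1" by (rule dim_span_insert[OF sA c(2)])
  have "isotropic_chain (insert ?C (insert (bperp ?C) \<F>))"
    using split AC CB iso by (intro isotropic_chain_insert[OF F]) auto
  moreover have "?C \<notin> \<F>"
  proof
    assume "?C \<in> \<F>"
    then have "?C \<subseteq> A \<or> B \<subseteq> ?C" by (rule split)
    then have "vec.dim ?C \<le> vec.dim A \<or> vec.dim B \<le> vec.dim ?C" using vec.dim_subset by blast
    then show False using dimC AF(2) BF(2) by linarith
  qed
  ultimately show ?thesis using that[of "insert ?C (insert (bperp ?C) \<F>)"] by blast
qed

lemma isotropic_chain_full:
  fixes \<F> :: "(complex^'n::{finite,linorder}) set set"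
  assumes F: "isotropic_chain \<F>"
  obtains \<G> where "isotropic_chain \<G>" "\<F> \<subseteq> \<G>" "vec.dim ` \<G> = {..CARD('n)}"
proof -
  let ?P = "\<lambda>\<G>. isotropic_chain \<G> \<and> \<F> \<subseteq> \<G>"
  obtain \<G> where G: "?P \<G>" "\<And>\<H>. ?P \<H> \<Longrightarrow> card \<H> \<le> card \<G>"
    using ex_has_greatest_nat[of ?P \<F> card "CARD('n) + 2"] F isotropic_chain_finite(2)
    by (metis add_2_eq_Suc' le_imp_less_Suc Suc_eq_plus1 order_refl)
  have "k \<in> vec.dim ` \<G>" if k: "k \<le> CARD('n)" for k
  proof (rule ccontr)
    assume "k \<notin> vec.dim ` \<G>"
    then obtain \<H> where H: "isotropic_chain \<H>" "\<G> \<subset> \<H>"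
      using isotropic_chain_refine[OF _ k] G(1) by metis
    then have "card \<G> < card \<H>" using isotropic_chain_finite(1) psubset_card_mono by blast
    then show False using G(2)[of \<H>] H G(1) by auto
  qed
  then have "vec.dim ` \<G> = {..CARD('n)}" using dim_le_CARD by auto
  then show ?thesis using that G(1) by blast
qed

definition rv :: "'n::{finite,linorder} \<Rightarrow> 'n" where
  "rv a = inv rk (CARD('n) - 1 - rk a)"

lemma rk_rv: "rk (rv a) = CARD('n) - 1 - rk (a :: 'n::{finite,linorder})"
  unfolding rv_def using rk_surj[of "CARD('n) - 1 - rk a", where 'n='n]
  by (intro f_inv_into_f) (auto simp: image_iff intro: sym)

lemma rv_rv [simp]: "rv (rv a) = a"
proof -
  have "rk (rv (rv a)) = rk a" unfolding rk_rv using rk_less_CARD[of a] by linarith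
  then show ?thesis by simp
qed

text \<open>In a full chain F with F(k) complementary to F(n-k), conjugation maps the line
  orthogonal to F(k) in F(k+1) to the line of the mirrored step. So unit vectors are chosen for the
  lower half and their conjugates taken for the upper half; only a middle line needs extra
  care.\<close>

lemma isotropic_chain_adapted_unitary:
  fixes \<F> :: "(complex^'n::{finite,linorder}) set set"
  assumes F0: "isotropic_chain \<F>"
  obtains U :: "'n cmat" where "unitary U" "\<And>a. cnjv (column a U) = column (rv a) U"
    "\<And>A. A \<in> \<F> \<Longrightarrow> A = (*v) U ` coord_space (vec.dim A)"
proof -
  obtain \<G> where G: "isotropic_chain \<G>" "\<F> \<subseteq> \<G>" "vec.dim ` \<G> = {..CARD('n)}"
    using isotropic_chain_full[OF F0] .
  have sub: "\<And>A. A \<in> \<G> \<Longrightarrow> vec.subspace A" and perp: "\<And>A. A \<in> \<G> \<Longrightarrow> bperp A \<in> \<G>"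
    and zero: "{0} \<in> \<G>" using G(1) by (auto simp: isotropic_chain_def)
  have UNIV: "UNIV \<in> \<G>" using perp[OF zero] by (simp add: bperp_0)
  \<comment> \<open>Choosing the whole space beyond n makes the chain monotone for all natural
    numbers, as \<open>adapted_unitary\<close> demands.\<close>
  have "\<forall>k. \<exists>A. A \<in> \<G> \<and> (k \<le> CARD('n) \<longrightarrow> vec.dim A = k) \<and> (CARD('n) < k \<longrightarrow> A = UNIV)"
  proof
    fix k show "\<exists>A. A \<in> \<G> \<and> (k \<le> CARD('n) \<longrightarrow> vec.dim A = k) \<and> (CARD('n) < k \<longrightarrow> A = UNIV)"
    proof (cases "k \<le> CARD('n)")
      case True
      then have "k \<in> vec.dim ` \<G>" using G(3) by simp
      then show ?thesis using True by auto
    qed (use UNIV in auto)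
  qed
  then obtain F where F: "\<And>k. F k \<in> \<G>" "\<And>k. k \<le> CARD('n) \<Longrightarrow> vec.dim (F k) = k"
    "\<And>k. CARD('n) < k \<Longrightarrow> F k = UNIV" by metis
  have FA: "F (vec.dim A) = A" if "A \<in> \<G>" for A
    using isotropic_chain_dim_inj[OF G(1) that F(1)] isotropic_chain_dim_inj[OF G(1) F(1) that]
      F(2)[OF dim_le_CARD, of A] by (metis order_refl subset_antisym)
  have sF: "vec.subspace (F k)" for k using sub F(1) by blast
  have mF: "F k \<subseteq> F (Suc k)" for k
  proof (cases "Suc k \<le> CARD('n)")
    case True
    then show ?thesis using F(2)[of k] F(2)[of "Suc k"] by (intro isotropic_chain_dim_inj[OF G(1) F(1) F(1)]) auto
  next
    case False
    then show ?thesis using F(3)[of "Suc k"] by simp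
  qed
  have pF: "bperp (F k) = F (CARD('n) - k)" if "k \<le> CARD('n)" for k
    using FA[OF perp[OF F(1)[of k]]] dim_bperp[OF sF] F(2)[OF that] by metis
  obtain r where r: "\<And>a::'n. r a \<in> F (Suc (rk a))" "\<And>a v. v \<in> F (rk a) \<Longrightarrow> herm (r a) v = 0"
    "\<And>a. norm (r a) = 1" using orthonormal_adapted[of F, OF sF mF F(2)] by metis
  have cr: "cnjv (r a) \<in> F (Suc (rk (rv a)))" "v \<in> F (rk (rv a)) \<Longrightarrow> herm (cnjv (r a)) v = 0" for a :: 'n and v
  proof -
    have n: "Suc (rk (rv a)) = CARD('n) - rk a" "rk (rv a) = CARD('n) - Suc (rk a)" "Suc (rk a) \<le> CARD('n)"
      unfolding rk_rv using rk_less_CARD[of a] by linarith+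
    have "bil (cnjv (r a)) v = 0" if "v \<in> F (rk a)" for v
      using r(2)[OF that] by (simp add: bil_eq_herm herm_cnjv)
    then have "cnjv (r a) \<in> bperp (F (rk a))" by (simp add: bperp_def)
    then show "cnjv (r a) \<in> F (Suc (rk (rv a)))" using n(1) pF[of "rk a"] by (simp add: order_less_imp_le)
    assume "v \<in> F (rk (rv a))"
    then have "v \<in> bperp (F (Suc (rk a)))" using n(2) pF[OF n(3)] by simp
    then have "bil v (r a) = 0" using r(1)[of a] by (simp add: bperp_def)
    then show "herm (cnjv (r a)) v = 0" by (metis bil_commute bil_eq_herm cnjv_cnjv complex_cnj_zero herm_cnjv)
  qed
  have norm_cnjv: "norm (cnjv v) = norm v" for v :: "(complex, 'n) vec" by (simp add: norm_vec_def)
  \<comment> \<open>For odd n the middle line is invariant under conjugation, so conjugation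
    multiplies its unit vector by a phase.\<close>
  have phase: "\<exists>\<theta>. norm \<theta> = 1 \<and> cnjv (r a) = \<theta> *s r a" if a: "rv a = a" for a :: 'n
  proof -
    let ?\<theta> = "herm (cnjv (r a)) (r a)" and ?z = "cnjv (r a) - herm (cnjv (r a)) (r a) *s r a"
    have "r a \<notin> F (rk a)" using r(2)[of "r a" a] r(3)[of a] by (auto simp: herm_self)
    then have d: "vec.dim (vec.span (insert (r a) (F (rk a)))) = Suc (rk a)"
      using dim_span_insert[OF sF] F(2)[of "rk a"] by (simp add: order_less_imp_le)
    have "vec.span (insert (r a) (F (rk a))) = F (Suc (rk a))"
    proof (rule vec.subspace_dim_equal)
      show "vec.span (insert (r a) (F (rk a))) \<subseteq> F (Suc (rk a))"
        using r(1)[of a] mF[of "rk a"] sF by (intro vec.span_minimal) auto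
      show "vec.dim (F (Suc (rk a))) \<le> vec.dim (vec.span (insert (r a) (F (rk a))))"
        using d F(2)[of "Suc (rk a)"] by (simp add: Suc_leI)
    qed (auto simp: sF)
    moreover have "?z \<in> F (Suc (rk a))"
      using cr(1)[of a] r(1)[of a] a sF by (intro vec.subspace_diff vec.subspace_scale) auto
    ultimately obtain k where k: "?z - k *s r a \<in> F (rk a)"
      using vec.span_breakdown_eq[of ?z "r a" "F (rk a)"] sF vec.span_eq_iff by metis
    have hz: "herm ?z v = 0" if "v \<in> F (rk a)" for v
      using cr(2)[of v a] r(2)[of v a] that a by (simp add: herm_diff_left herm_scale_left)
    have hr: "herm ?z (r a) = 0" by (simp add: herm_diff_left herm_scale_left herm_self r(3))
    have "?z = (?z - k *s r a) + k *s r a" by simp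
    then have "herm ?z ?z = herm ?z (?z - k *s r a) + herm ?z (k *s r a)" by (metis herm_add_right)
    then have "herm ?z ?z = 0" using hz[OF k] hr by (simp add: herm_scale_right)
    then have eq: "cnjv (r a) = ?\<theta> *s r a" by simp
    have "herm (cnjv (r a)) (cnjv (r a)) = 1" by (simp add: herm_self norm_cnjv r(3))
    then have "?\<theta> * cnj ?\<theta> = 1"
      using eq by (metis herm_scale_left herm_scale_right herm_self r(3) mult.right_neutral of_real_1 power_one mult.commute)
    then have "norm ?\<theta> = 1"
      by (metis complex_mod_sqrt_Re_mult_cnj one_complex.simps(1) real_sqrt_one)
    then show ?thesis using eq by blast
  qed
  \<comment> \<open>A square root of this phase, used as a factor below, makes the middle vector
    real.\<close>
  then obtain \<theta> where \<theta>: "\<And>a::'n. rv a = a \<Longrightarrow> norm (\<theta> a) = 1 \<and> cnjv (r a) = \<theta> a *s r a" by metis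
  define q :: "'n \<Rightarrow> (complex, 'n) vec" where "q a = (if rk a < rk (rv a) then r a
      else if rk (rv a) < rk a then cnjv (r (rv a)) else csqrt (\<theta> a) *s r a)" for a
  have mid: "rv a = a" if "\<not> rk a < rk (rv a)" "\<not> rk (rv a) < rk a" for a :: 'n using that by simp
  have norm_scale: "norm (c *s v) = cmod c * norm v" for c and v :: "(complex, 'n) vec"
  proof -
    have "herm (c *s v) (c *s v) = c * cnj c * herm v v"
      by (simp only: herm_scale_left herm_scale_right mult_ac)
    then have "complex_of_real ((norm (c *s v))\<^sup>2) = c * cnj c * complex_of_real ((norm v)\<^sup>2)"
      unfolding herm_self .
    also have "\<dots> = complex_of_real ((cmod c * norm v)\<^sup>2)"
      by (simp add: complex_norm_square[symmetric] power_mult_distrib)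
    finally have "(norm (c *s v))\<^sup>2 = (cmod c * norm v)\<^sup>2" using of_real_eq_iff by blast
    then show ?thesis by (simp add: power2_eq_iff_nonneg)
  qed
  have q: "q a \<in> F (Suc (rk a))" "\<And>v. v \<in> F (rk a) \<Longrightarrow> herm (q a) v = 0" "norm (q a) = 1" for a
    using r(1)[of a] r(3)[of a] r(2)[of _ a] cr(1)[of "rv a"] cr(2)[of _ "rv a"] r(3)[of "rv a"] \<theta>[of a] mid[of a] sF[of "Suc (rk a)"]
    by (auto simp: q_def norm_cnjv norm_scale herm_scale_left norm_csqrt vec.subspace_scale)
  have qc: "cnjv (q a) = q (rv a)" for a
  proof (cases "rv a = a")
    case True
    have "cnj (csqrt (\<theta> a)) * \<theta> a = cnj (csqrt (\<theta> a)) * csqrt (\<theta> a) * csqrt (\<theta> a)"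
      by (metis mult.assoc power2_csqrt power2_eq_square)
    also have "cnj (csqrt (\<theta> a)) * csqrt (\<theta> a) = of_real ((cmod (csqrt (\<theta> a)))\<^sup>2)"
      by (metis complex_norm_square mult.commute)
    finally have "cnj (csqrt (\<theta> a)) * \<theta> a = csqrt (\<theta> a)" using \<theta>[OF True] by (simp add: norm_csqrt)
    then show ?thesis using True \<theta>[OF True] by (simp add: q_def)
  next
    case False
    then have "rk a \<noteq> rk (rv a)" by (metis rk_inject)
    then show ?thesis by (auto simp: q_def)
  qed
  obtain U :: "'n cmat" where U: "unitary U" "\<And>a. column a U = q a"
    "\<And>k. k \<le> CARD('n) \<Longrightarrow> (*v) U ` coord_space k = F k"
    using adapted_unitary[of F q, OF sF mF F(2) q] by metis
  show ?thesis
  proof (rule that[OF U(1)])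
    show "cnjv (column a U) = column (rv a) U" for a by (simp add: U(2) qc)
    show "A = (*v) U ` coord_space (vec.dim A)" if "A \<in> \<F>" for A
      using that G(2) FA[of A] U(3)[OF dim_le_CARD, of A] by auto
  qed
qed

section \<open>Genericity of open orbits\<close>

section \<open>Flags in open orbits are generic\<close>

text \<open>Transversality of every member to the conjugate of every member, itself included: they
  intersect trivially or span everything, according to their dimensions.\<close>

definition generic_flag :: "'n::{finite,linorder} flag \<Rightarrow> bool" where
  "generic_flag V \<longleftrightarrow> (\<forall>A\<in>set V. \<forall>B\<in>set V.
     (vec.dim A + vec.dim B \<le> CARD('n) \<longrightarrow> A \<inter> cnjv ` B \<subseteq> {0}) \<and>
     (CARD('n) \<le> vec.dim A + vec.dim B \<longrightarrow> (\<forall>x. \<exists>a\<in>A. \<exists>b\<in>B. x = a + cnjv b)))"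

text \<open>Its first \<open>k\<close> columns are those of \<open>g\<close>, the others are conjugates of the first columns of \<open>g\<close>;
  it is invertible iff \<open>V\<^sub>k\<close> and the conjugate of \<open>V\<^bsub>n-k\<^esub>\<close> are complementary for the full flag
  \<open>V\<close> determined by \<open>g\<close>.\<close>

definition half_conjugate :: "nat \<Rightarrow> 'n::{finite,linorder} cmat \<Rightarrow> 'n cmat" where
  "half_conjugate k g = (\<chi> x a. if rk a < k then g $ x $ a else cnj (g $ x $ rv a))"

lemma bij_rv: "bij rv"
  by (rule o_bij[of rv]) auto

lemma half_conjugate_mult:
  fixes g :: "'n::{finite,linorder} cmat"
  assumes k: "k \<le> CARD('n)"
  shows "half_conjugate k g *v z = g *v (\<chi> a. if rk a < k then z $ a else 0) +
    cnjm g *v (\<chi> b. if rk b < CARD('n) - k then z $ rv b else 0)"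
proof (simp add: vec_eq_iff matrix_vector_mult_def, intro allI)
  fix x :: 'n
  have "(\<Sum>a\<in>UNIV. half_conjugate k g $ x $ a * z $ a) =
      (\<Sum>a\<in>UNIV. g $ x $ a * (if rk a < k then z $ a else 0) +
        (if rk a < k then 0 else cnj (g $ x $ rv a) * z $ a))"
    by (rule sum.cong) (auto simp: half_conjugate_def)
  also have "\<dots> = (\<Sum>a\<in>UNIV. g $ x $ a * (if rk a < k then z $ a else 0)) +
      (\<Sum>a\<in>UNIV. if rk a < k then 0 else cnj (g $ x $ rv a) * z $ a)" by (rule sum.distrib)
  also have "(\<Sum>a\<in>UNIV. if rk a < k then 0 else cnj (g $ x $ rv a) * z $ a) =
      (\<Sum>b\<in>UNIV. if rk (rv b) < k then 0 else cnj (g $ x $ rv (rv b)) * z $ rv b)"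
    by (rule sum.reindex_bij_betw[symmetric]) (rule bij_rv)
  also have "\<dots> = (\<Sum>b\<in>UNIV. cnj (g $ x $ b) * (if rk b < CARD('n) - k then z $ rv b else 0))"
  proof (rule sum.cong)
    fix b :: 'n
    have "rk (rv b) < k \<longleftrightarrow> \<not> rk b < CARD('n) - k"
      using rk_less_CARD[of b] k unfolding rk_rv by linarith
    then show "(if rk (rv b) < k then 0 else cnj (g $ x $ rv (rv b)) * z $ rv b) =
      cnj (g $ x $ b) * (if rk b < CARD('n) - k then z $ rv b else 0)" by simp
  qed simp
  finally show "(\<Sum>a\<in>UNIV. half_conjugate k g $ x $ a * z $ a) =
      (\<Sum>a\<in>UNIV. g $ x $ a * (if rk a < k then z $ a else 0)) +
      (\<Sum>b\<in>UNIV. cnj (g $ x $ b) * (if rk b < CARD('n) - k then z $ rv b else 0))" .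
qed

text \<open>Invertibility is the statement for the complementary dimension l = n - k. A smaller l
  shrinks the intersection and a larger one enlarges the sum.\<close>

lemma half_conjugate_generic:
  fixes g :: "'n::{finite,linorder} cmat"
  assumes k: "k \<le> CARD('n)" and inv: "invertible (half_conjugate k g)"
  shows "k + l \<le> CARD('n) \<Longrightarrow> (*v) g ` coord_space k \<inter> cnjv ` (*v) g ` coord_space l \<subseteq> {0}"
    "CARD('n) \<le> k + l \<Longrightarrow> \<exists>a\<in>(*v) g ` coord_space k. \<exists>b\<in>(*v) g ` coord_space l. x = a + cnjv b"
proof -
  assume l: "k + l \<le> CARD('n)"
  show "(*v) g ` coord_space k \<inter> cnjv ` (*v) g ` coord_space l \<subseteq> {0}"
  proof
    fix v assume "v \<in> (*v) g ` coord_space k \<inter> cnjv ` (*v) g ` coord_space l"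
    then obtain p q where p: "p \<in> coord_space k" "v = g *v p" and q: "q \<in> coord_space l" "v = cnjv (g *v q)" by auto
    \<comment> \<open>Combines p and the mirrored conjugate of -q into one vector; equality of the
      two descriptions of v puts it into the kernel of \<open>half_conjugate k g\<close>.\<close>
    define z :: "(complex, 'n) vec" where "z = (\<chi> a. if rk a < k then p $ a else - cnj (q $ rv a))"
    have "(\<chi> a. if rk a < k then z $ a else 0) = p"
      using p(1) by (auto simp: vec_eq_iff z_def coord_space_def)
    moreover have "(\<chi> b. if rk b < CARD('n) - k then z $ rv b else 0) = - cnjv q"
    proof -
      have "(if rk b < CARD('n) - k then z $ rv b else 0) = - cnj (q $ b)" for b
      proof (cases "rk b < CARD('n) - k")
        case True
        then have "\<not> rk (rv b) < k" using k unfolding rk_rv by linarith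
        then show ?thesis using True by (simp add: z_def)
      next
        case False
        then have "l \<le> rk b" using l by linarith
        then show ?thesis using False q(1) by (simp add: coord_space_def)
      qed
      then show ?thesis by (simp add: vec_eq_iff)
    qed
    ultimately have "half_conjugate k g *v z = g *v p + cnjm g *v (- cnjv q)"
      by (simp add: half_conjugate_mult[OF k])
    also have "cnjm g *v (- cnjv q) = - cnjv (g *v q)"
      by (metis cnjv_mult vector_sneg_minus1 vector_scalar_commute)
    finally have "half_conjugate k g *v z = 0" using p(2) q(2) by simp
    then have z0: "z = 0" using inv by (metis inj_matrix_vector_mult injD matrix_vector_mult_0_right)
    have "p $ a = 0" for a
    proof (cases "rk a < k")
      case True
      have "z $ a = 0" using z0 by simp
      then show ?thesis using True by (simp add: z_def)
    qed (use p(1) in \<open>auto simp: coord_space_def\<close>)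
    then have "p = 0" by (simp add: vec_eq_iff)
    then show "v \<in> {0}" using p(2) by simp
  qed
next
  assume l: "CARD('n) \<le> k + l"
  let ?z = "matrix_inv (half_conjugate k g) *v x"
  let ?p = "\<chi> a. if rk a < k then ?z $ a else 0" and ?q = "\<chi> b. if rk b < CARD('n) - k then ?z $ rv b else 0"
  have "x = half_conjugate k g *v ?z"
    using inv by (simp add: matrix_vector_mul_assoc matrix_inv_right)
  also have "\<dots> = g *v ?p + cnjv (g *v cnjv ?q)" by (simp add: half_conjugate_mult[OF k] cnjv_mult)
  finally have "x = g *v ?p + cnjv (g *v cnjv ?q)" .
  moreover have "?p \<in> coord_space k" by (simp add: coord_space_def)
  moreover have "cnjv ?q \<in> coord_space l" using l by (auto simp: coord_space_def)
  ultimately show "\<exists>a\<in>(*v) g ` coord_space k. \<exists>b\<in>(*v) g ` coord_space l. x = a + cnjv b" by blast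
qed

text \<open>Along the line the determinant is a polynomial in s, and it is nonzero at s = 1.\<close>

lemma finite_singular_on_line:
  fixes A B :: "complex^'n^'n"
  assumes B: "invertible B"
  shows "finite {s::real. \<not> invertible ((1 - s) *\<^sub>R A + s *\<^sub>R B)}"
proof -
  define p :: "complex poly" where
    "p = (\<Sum>\<sigma> | \<sigma> permutes UNIV. of_int (sign \<sigma>) * (\<Prod>i\<in>UNIV. [:A $ i $ \<sigma> i, B $ i $ \<sigma> i - A $ i $ \<sigma> i:]))"
  have p: "poly p (of_real s) = det ((1 - s) *\<^sub>R A + s *\<^sub>R B)" for s
    unfolding p_def det_def poly_sum poly_mult poly_prod
    by (intro sum.cong arg_cong2[where f="(*)"] prod.cong) (auto simp: complex_eq_iff algebra_simps)
  have "poly p 1 \<noteq> 0" using p[of 1] B by (simp add: invertible_det_nz)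
  then have "p \<noteq> 0" by auto
  then have "finite {z. poly p z = 0}" by (rule poly_roots_finite)
  then have "finite (complex_of_real -` {z. poly p z = 0})" by (rule finite_vimageI) (simp add: inj_on_def)
  then show ?thesis by (simp add: vimage_def p invertible_det_nz)
qed

lemma SL_real_cnjm: "h \<in> SL_real \<Longrightarrow> cnjm h = h"
  by (auto simp: SL_real_def vec_eq_iff Reals_cnj_iff)

lemma generic_flag_act:
  assumes h: "invertible h" "cnjm h = h" and V: "generic_flag V" shows "generic_flag (act h V)"
proof -
  have cn: "cnjv (h *v b) = h *v cnjv b" for b by (simp add: cnjv_mult h(2))
  have inj: "inj ((*v) h)" by (rule inj_matrix_vector_mult[OF h(1)])
  show ?thesis
    unfolding generic_flag_def
  proof (intro ballI conjI impI allI)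
    fix A B x assume AB: "A \<in> set (act h V)" "B \<in> set (act h V)"
    then obtain A0 B0 where A0: "A0 \<in> set V" "A = (*v) h ` A0" and B0: "B0 \<in> set V" "B = (*v) h ` B0"
      by (auto simp: act_def)
    have d: "vec.dim A = vec.dim A0" "vec.dim B = vec.dim B0" by (simp_all add: A0 B0 dim_image_mat[OF h(1)])
    {
      assume "vec.dim A + vec.dim B \<le> CARD('a)"
      then have "A0 \<inter> cnjv ` B0 \<subseteq> {0}" using V A0(1) B0(1) by (simp add: generic_flag_def d)
      moreover have "A \<inter> cnjv ` B = (*v) h ` (A0 \<inter> cnjv ` B0)"
        by (simp add: A0 B0 image_image cn image_Int[OF inj])
      ultimately show "A \<inter> cnjv ` B \<subseteq> {0}" by auto
    next
      assume "CARD('a) \<le> vec.dim A + vec.dim B"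
      then obtain a b where ab: "a \<in> A0" "b \<in> B0" "matrix_inv h *v x = a + cnjv b"
        using V A0(1) B0(1) unfolding generic_flag_def d by meson
      have "x = h *v (matrix_inv h *v x)" by (simp add: matrix_vector_mul_assoc matrix_inv_right[OF h(1)])
      also have "\<dots> = h *v a + cnjv (h *v b)" by (simp add: ab(3) matrix_vector_right_distrib cn)
      finally show "\<exists>a\<in>A. \<exists>b\<in>B. x = a + cnjv b" using ab A0(2) B0(2) by blast
    }
  qed
qed

text \<open>Real matrices commute with conjugation and preserve genericity, so one generic flag in D
  suffices. It is found on the segment from g to a matrix U with all
  \<open>half_conjugate k U\<close> invertible: small s > 0 stay in the open orbit, and only
  finitely many parameters are bad.\<close>

lemma open_orbit_generic:
  fixes V :: "'n::{finite,linorder} flag"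
  assumes c: "dim_seq TYPE('n) c" and D: "open_orbit c D" and V: "V \<in> D"
  shows "generic_flag V"
proof -
  obtain V0 where V0: "V0 \<in> flags c" "D = orbit SL_real V0" and o: "openin (flag_topology c) D"
    using D by (auto simp: open_orbit_def)
  \<comment> \<open>The trivial chain suffices to produce a unitary matrix whose columns are
    interchanged in mirrored pairs by conjugation; \<open>half_conjugate k\<close> leaves it
    unchanged for every k.\<close>
  have triv: "isotropic_chain {{0 :: (complex, 'n) vec}, UNIV}"
    by (auto simp: isotropic_chain_def bperp_def) (metis bil_eq_herm cnjv_cnjv herm_self_eq_0)+
  obtain U :: "'n cmat" where U: "unitary U" "\<And>a. cnjv (column a U) = column (rv a) U"
    using isotropic_chain_adapted_unitary[OF triv] by metis
  have "cnj (U $ x $ rv a) = U $ x $ a" for x a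
    using U(2)[of "rv a"] by (simp add: vec_eq_iff column_def)
  then have HU: "half_conjugate k U = U" for k by (simp add: half_conjugate_def vec_eq_iff)
  have "V0 \<in> D"
  proof -
    have "mat 1 \<in> SL_real" by (simp add: SL_real_def SL_complex_def) (simp add: mat_def)
    then show ?thesis unfolding V0(2) orbit_def by (metis act_mat_1 image_eqI)
  qed
  obtain g where g: "invertible g" "V0 = act g (base_flag c)" by (rule flags_transitive[OF c V0(1)])
  let ?O = "{M :: 'n cmat. invertible M \<and> act M (base_flag c) \<in> D}"
  let ?g = "\<lambda>s::real. (1 - s) *\<^sub>R g + s *\<^sub>R U"
  have "open ?O" using o by (simp add: openin_flag_topology_iff[OF c])
  moreover have "continuous_on UNIV ?g" by (intro continuous_intros)
  ultimately have "open (?g -` ?O)" using open_vimage by blast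
  moreover have "0 \<in> ?g -` ?O" using g \<open>V0 \<in> D\<close> by simp
  ultimately obtain e where e: "e > 0" "ball 0 e \<subseteq> ?g -` ?O" using open_contains_ball by blast
  let ?bad = "\<Union>k\<le>CARD('n). {s. \<not> invertible ((1 - s) *\<^sub>R half_conjugate k g + s *\<^sub>R U)}"
  have "finite ?bad" using finite_singular_on_line[OF unitary_invertible[OF U(1)]] by blast
  moreover have "infinite {0<..<e}" using e(1) by (simp add: infinite_Ioo)
  ultimately obtain s where s: "s \<in> {0<..<e}" "s \<notin> ?bad" by (meson finite_subset subsetI)
  let ?V = "act (?g s) (base_flag c)"
  have "s \<in> ball 0 e" using s(1) by simp
  then have VD: "?V \<in> D" "invertible (?g s)" using e(2) by auto
  have Hs: "invertible (half_conjugate k (?g s))" if "k \<le> CARD('n)" for k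
  proof -
    have "half_conjugate k (?g s) = (1 - s) *\<^sub>R half_conjugate k g + s *\<^sub>R half_conjugate k U"
      by (simp add: half_conjugate_def vec_eq_iff)
    then show ?thesis using s(2) that HU by auto
  qed
  have comp: "\<exists>k\<le>CARD('n). A = (*v) (?g s) ` coord_space k \<and> vec.dim A = k" if "A \<in> set ?V" for A
  proof -
    obtain i where i: "i < length c" "A = (*v) (?g s) ` coord_space (partial_sum c (Suc i))"
      using \<open>A \<in> set ?V\<close> by (auto simp: in_set_conv_nth base_flag_nth[OF c])
    then show ?thesis
      using partial_sum_le_CARD[OF c] dim_coord_space dim_image_mat[OF VD(2)] by metis
  qed
  have "generic_flag ?V"
    unfolding generic_flag_def
  proof (intro ballI conjI impI allI)
    fix A B x assume A: "A \<in> set ?V" and B: "B \<in> set ?V"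
    obtain k where k: "k \<le> CARD('n)" "A = (*v) (?g s) ` coord_space k" "vec.dim A = k"
      using comp[OF A] by blast
    obtain l where l: "l \<le> CARD('n)" "B = (*v) (?g s) ` coord_space l" "vec.dim B = l"
      using comp[OF B] by blast
    show "A \<inter> cnjv ` B \<subseteq> {0}" if "vec.dim A + vec.dim B \<le> CARD('n)"
      using half_conjugate_generic(1)[OF k(1) Hs[OF k(1)], of l] that k l by simp
    show "\<exists>a\<in>A. \<exists>b\<in>B. x = a + cnjv b" if "CARD('n) \<le> vec.dim A + vec.dim B"
      using half_conjugate_generic(2)[OF k(1) Hs[OF k(1)], of l] that k l by simp
  qed
  moreover obtain h1 where h1: "h1 \<in> SL_real" "?V = act h1 V0" using VD(1) V0(2) by (auto simp: orbit_def)
  moreover obtain h2 where h2: "h2 \<in> SL_real" "V = act h2 V0" using V V0(2) by (auto simp: orbit_def)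
  have i1: "invertible h1" "cnjm h1 = h1" and i2: "invertible h2" "cnjm h2 = h2"
    using h1 h2 SL_real_cnjm by (auto simp: SL_real_def SL_invertible)
  have "cnjm (matrix_inv h1) = matrix_inv h1"
    by (metis cnjm_mat cnjm_mult i1 matrix_inv_right matrix_inv_unique)
  then have "cnjm (h2 ** matrix_inv h1) = h2 ** matrix_inv h1" by (simp add: cnjm_mult i2)
  moreover have "V = act (h2 ** matrix_inv h1) ?V"
    using h1(2) h2(2) i1 by (simp add: act_act matrix_mul_assoc[symmetric] matrix_inv_left)
  moreover have "invertible (h2 ** matrix_inv h1)" using i1 i2 by (simp add: invertible_mult_iff invertible_matrix_inv)
  ultimately show ?thesis using generic_flag_act by metis
qed

section \<open>The moment map argument: tangent spaces, rotations, variation of projections\<close>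

section \<open>Tangent spaces\<close>

lemma has_vector_derivative_quotient:
  fixes l :: "real \<Rightarrow> 'a::real_normed_vector"
  assumes d: "(l has_vector_derivative v) (at 0)"
  shows "((\<lambda>t. (1 / t) *\<^sub>R (l t - l 0)) \<longlongrightarrow> v) (at 0)"
proof -
  have "((\<lambda>t. (l t - l 0 - t *\<^sub>R v) /\<^sub>R \<bar>t\<bar>) \<longlongrightarrow> 0) (at 0)"
    using d unfolding has_vector_derivative_def has_derivative_at_within by simp
  \<comment> \<open>The Frechet derivative divides by the absolute value of t; the sign turns this
    into division by t itself.\<close>
  then have "((\<lambda>t. sgn t *\<^sub>R ((l t - l 0 - t *\<^sub>R v) /\<^sub>R \<bar>t\<bar>)) \<longlongrightarrow> 0) (at 0)"
    by (rule tendsto_0_le[where K=1]) (auto simp: sgn_if)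
  then have "((\<lambda>t. sgn t *\<^sub>R ((l t - l 0 - t *\<^sub>R v) /\<^sub>R \<bar>t\<bar>) + v) \<longlongrightarrow> 0 + v) (at 0)"
    by (intro tendsto_intros)
  then have "((\<lambda>t. sgn t *\<^sub>R ((l t - l 0 - t *\<^sub>R v) /\<^sub>R \<bar>t\<bar>) + v) \<longlongrightarrow> v) (at 0)" by simp
  then show ?thesis
  proof (rule Lim_transform_eventually)
    show "\<forall>\<^sub>F t in at 0. sgn t *\<^sub>R ((l t - l 0 - t *\<^sub>R v) /\<^sub>R \<bar>t\<bar>) + v = (1 / t) *\<^sub>R (l t - l 0)"
    proof (rule eventually_at_filter[THEN iffD2], intro always_eventually allI impI)
      fix t :: real assume t: "t \<noteq> 0"
      have "sgn t / \<bar>t\<bar> = 1 / t" using t by (auto simp: sgn_if field_simps)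
      then have "sgn t *\<^sub>R ((l t - l 0 - t *\<^sub>R v) /\<^sub>R \<bar>t\<bar>) = (1 / t) *\<^sub>R (l t - l 0 - t *\<^sub>R v)"
        by (simp add: divide_inverse)
      also have "\<dots> = (1 / t) *\<^sub>R (l t - l 0) - v" using t by (simp add: scaleR_diff_right)
      finally show "sgn t *\<^sub>R ((l t - l 0 - t *\<^sub>R v) /\<^sub>R \<bar>t\<bar>) + v = (1 / t) *\<^sub>R (l t - l 0)" by simp
    qed
  qed
qed

lemma has_vector_derivative_in_subspace:
  fixes l :: "real \<Rightarrow> 'a::euclidean_space"
  assumes L: "subspace L" and e: "e > 0" and l: "\<And>t. t \<in> ball 0 e \<Longrightarrow> l t \<in> L"
    and d: "(l has_vector_derivative v) (at 0)"
  shows "v \<in> L"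
proof -
  have "\<forall>\<^sub>F t in at 0. (1 / t) *\<^sub>R (l t - l 0) \<in> L"
    unfolding eventually_at
    by (rule exI[of _ e]) (use e l L in \<open>auto intro!: subspace_scale subspace_diff simp: dist_real_def\<close>)
  then show ?thesis
    using Lim_in_closed_set[OF closed_subspace[OF L] _ _ has_vector_derivative_quotient[OF d]] by simp
qed

text \<open>Velocities of real curves, read in the chart at g. Curves in a group orbit thus give
  tangent vectors immediately, while closure under complex scalars is a theorem about complex
  submanifolds.\<close>

definition tangent_space :: "nat list \<Rightarrow> 'n::{finite,linorder} cmat \<Rightarrow> 'n flag set \<Rightarrow> (complex^('n \<times> 'n)) set" where
  "tangent_space c g S = {v. \<exists>x e. e > 0 \<and> (x has_vector_derivative v) (at 0) \<and> x 0 = 0 \<and>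
     (\<forall>t\<in>ball 0 e. x t \<in> nil_lower c \<and> flag_chart c g (x t) \<in> S)}"

text \<open>The tangent space is the image of L under the derivative of the inverse coordinate
  change, which is complex linear. Derivatives exist only within W and W', so they are composed with
  curves that stay inside these sets.\<close>

lemma subspace_tangent_space:
  fixes S :: "'n::{finite,linorder} flag set"
  assumes S: "complex_submanifold c k S" and g: "g \<in> SL_complex" "act g (base_flag c) \<in> S"
  shows "vec.subspace (tangent_space c g S)"
proof -
  obtain W W' h L where W: "0 \<in> W" "openin (top_of_set (nil_lower c)) W"
      "openin (top_of_set (nil_lower c)) W'" "biholomorphic_map W W' h"
      "vec.subspace L" "L \<subseteq> nil_lower c" "vec.dim L = k"
      "h ` {x \<in> W. flag_chart c g x \<in> S} = W' \<inter> L"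
    by (rule complex_submanifoldE[OF S g])
  define q where "q = inv_into W h"
  have bij: "bij_betw h W W'" and holh: "holomorphic_map_on h W" and holq: "holomorphic_map_on q W'"
    using W(4) by (auto simp: biholomorphic_map_def q_def)
  have qh: "q (h x) = x" if "x \<in> W" for x using bij that by (simp add: q_def bij_betw_inv_into_left)
  have sL: "subspace L" by (rule vec_subspace_imp_subspace[OF W(5)])
  have WN: "W \<subseteq> nil_lower c" using openin_subset[OF W(2)] by simp
  have h0: "h 0 \<in> W' \<inter> L" using W(1,8) g(2) by (auto simp flip: W(8))
  obtain h' where h': "(h has_derivative h') (at 0 within W)"
    using holh W(1) unfolding holomorphic_map_on_def by blast
  obtain q' where q': "(q has_derivative q') (at (h 0) within W')" "\<And>a v. q' (a *s v) = a *s q' v"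
    using holq h0 unfolding holomorphic_map_on_def by blast
  interpret q': bounded_linear q' using q'(1) by (rule has_derivative_bounded_linear)
  have "tangent_space c g S = q' ` L"
  proof (intro set_eqI iffI)
    fix v assume "v \<in> tangent_space c g S"
    then obtain x e where e: "e > 0" and x: "(x has_vector_derivative v) (at 0)" "x 0 = 0"
      and xS: "\<And>t. t \<in> ball 0 e \<Longrightarrow> x t \<in> nil_lower c \<and> flag_chart c g (x t) \<in> S"
      unfolding tangent_space_def by blast
    obtain O' where O': "open O'" "W = nil_lower c \<inter> O'" using W(2) unfolding openin_open by blast
    have "isCont x 0" using x(1) has_vector_derivative_continuous by blast
    then have "\<forall>\<^sub>F t in at 0. x t \<in> O'"
      using O' W(1) x(2) unfolding isCont_def by (intro topological_tendstoD) auto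
    then obtain e' where e': "e' > 0" "\<And>t. t \<noteq> 0 \<Longrightarrow> dist t 0 < e' \<Longrightarrow> x t \<in> O'"
      unfolding eventually_at by auto
    define J where "J = ball (0::real) (min e e')"
    have J: "open J" "0 \<in> J" using e e'(1) by (auto simp: J_def)
    have xW: "x t \<in> W" "h (x t) \<in> W' \<inter> L" if "t \<in> J" for t
    proof -
      show "x t \<in> W"
        using that xS[of t] e'(2)[of t] O'(2) W(1) x(2) by (cases "t = 0") (auto simp: J_def dist_commute)
      then show "h (x t) \<in> W' \<inter> L" using xS[of t] that W(8) by (auto simp: J_def simp flip: W(8))
    qed
    have xd: "(x has_derivative (\<lambda>t. t *\<^sub>R v)) (at 0 within J)"
      using x(1) has_derivative_at_withinI unfolding has_vector_derivative_def by blast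
    have hd: "(h has_derivative h') (at (x 0) within x ` J)"
      using h' xW(1) x(2) has_derivative_subset by (metis image_subsetI)
    have ld: "((\<lambda>t. h (x t)) has_derivative (\<lambda>t. h' (t *\<^sub>R v))) (at 0 within J)"
      using has_derivative_in_compose[OF xd hd] .
    interpret h': bounded_linear h' using h' by (rule has_derivative_bounded_linear)
    have lv: "((\<lambda>t. h (x t)) has_vector_derivative h' v) (at 0)"
      using ld at_within_open[OF J(2,1)] by (simp add: has_vector_derivative_def h'.scaleR)
    have "h' v \<in> L"
      by (rule has_vector_derivative_in_subspace[OF sL _ _ lv, of "min e e'"])
        (use e e'(1) xW(2) in \<open>auto simp: J_def\<close>)
    have qd: "(q has_derivative q') (at (h (x 0)) within (\<lambda>t. h (x t)) ` J)"
      using q'(1) xW(2) x(2) has_derivative_subset by (metis (no_types, lifting) IntD1 image_subsetI)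
    have "((\<lambda>t. q (h (x t))) has_derivative (\<lambda>t. q' (h' (t *\<^sub>R v)))) (at 0 within J)"
      using has_derivative_in_compose[OF ld qd] .
    then have "(x has_derivative (\<lambda>t. q' (h' (t *\<^sub>R v)))) (at 0 within J)"
      by (rule has_derivative_transform[OF J(2), rotated]) (simp add: qh xW(1))
    then have "(x has_vector_derivative q' (h' v)) (at 0)"
      using at_within_open[OF J(2,1)] by (simp add: has_vector_derivative_def h'.scaleR q'.scaleR)
    then have "v = q' (h' v)" using x(1) vector_derivative_unique_at by blast
    then show "v \<in> q' ` L" using \<open>h' v \<in> L\<close> by blast
  next
    fix v assume "v \<in> q' ` L"
    then obtain l where l: "l \<in> L" "v = q' l" by blast
    obtain O' where O': "open O'" "W' = nil_lower c \<inter> O'" using W(3) unfolding openin_open by blast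
    define y where "y t = h 0 + t *\<^sub>R l" for t :: real
    have "open (y -` O')" unfolding y_def by (rule open_vimage[OF O'(1)]) (intro continuous_intros)
    moreover have "0 \<in> y -` O'" using h0 O' by (simp add: y_def)
    ultimately obtain e where e: "e > 0" "ball 0 e \<subseteq> y -` O'" using open_contains_ball by blast
    have yW: "y t \<in> W' \<inter> L" if "t \<in> ball 0 e" for t
    proof -
      have "y t \<in> L" using h0 l(1) sL unfolding y_def by (auto intro: subspace_add subspace_scale)
      then show ?thesis using e(2) that O' W(6) by auto
    qed
    have yd: "(y has_derivative (\<lambda>t. t *\<^sub>R l)) (at 0 within ball 0 e)"
      unfolding y_def by (auto intro!: derivative_eq_intros)
    have qd: "(q has_derivative q') (at (y 0) within y ` ball 0 e)"
    proof -
      have "y ` ball 0 e \<subseteq> W'" using yW by blast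
      then show ?thesis using has_derivative_subset[OF q'(1)] by (simp add: y_def)
    qed
    have eq: "at (0::real) within ball 0 e = at 0" using e(1) by (intro at_within_open) auto
    have "((\<lambda>t. q (y t)) has_derivative (\<lambda>t. q' (t *\<^sub>R l))) (at 0)"
      using has_derivative_in_compose[OF yd qd] unfolding eq .
    then have "((\<lambda>t. q (y t)) has_vector_derivative v) (at 0)"
      by (simp add: has_vector_derivative_def q'.scaleR l(2))
    moreover have "q (y 0) = 0" using qh[OF W(1)] by (simp add: y_def)
    moreover have "q (y t) \<in> nil_lower c \<and> flag_chart c g (q (y t)) \<in> S" if t: "t \<in> ball 0 e" for t
    proof -
      obtain x where "x \<in> W" "flag_chart c g x \<in> S" "y t = h x" using yW[OF t] W(8) by blast
      then show ?thesis using qh WN by auto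
    qed
    ultimately show "v \<in> tangent_space c g S"
      unfolding tangent_space_def using e(1) by (intro CollectI exI[of _ "\<lambda>t. q (y t)"] exI[of _ e]) auto
  qed
  moreover have "vec.subspace (q' ` L)"
  proof (rule vec.subspaceI)
    show "0 \<in> q' ` L" using vec.subspace_0[OF W(5)] q'.zero by (metis image_eqI)
    show "x + y \<in> q' ` L" if "x \<in> q' ` L" "y \<in> q' ` L" for x y
      using that vec.subspace_add[OF W(5)] q'.add by (metis (no_types, lifting) imageE image_eqI)
    show "a *s x \<in> q' ` L" if "x \<in> q' ` L" for a x
      using that vec.subspace_scale[OF W(5)] q'(2) by (metis (no_types, lifting) imageE image_eqI)
  qed
  ultimately show ?thesis by simp
qed

section \<open>Plane rotations\<close>

definition skew_unit :: "'n \<Rightarrow> 'n \<Rightarrow> complex^'n^'n" where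
  "skew_unit a b = (\<chi> i j. if i = a \<and> j = b then 1 else if i = b \<and> j = a then -1 else 0)"

text \<open>The exponential of t X for X = \<open>skew_unit a b\<close>, written in closed form by
  means of the cubic relation for X in \<open>skew_unit_cube\<close>.\<close>

definition rotation :: "'n \<Rightarrow> 'n \<Rightarrow> real \<Rightarrow> complex^'n^'n" where
  "rotation a b t = mat 1 + (1 - cos t) *\<^sub>R (skew_unit a b ** skew_unit a b) + sin t *\<^sub>R skew_unit a b"

lemma skew_unit_cube:
  assumes "a \<noteq> b"
  shows "skew_unit a b ** (skew_unit a b ** skew_unit a b) = - skew_unit a b"
proof -
  have 1: "(skew_unit a b ** M) $ i $ j = (if i = a then M $ b $ j else if i = b then - M $ a $ j else 0)" for M i j
  proof -
    have "(skew_unit a b ** M) $ i $ j =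
        (\<Sum>k\<in>UNIV. if i = a \<and> k = b then M $ k $ j else if i = b \<and> k = a then - M $ k $ j else 0)"
      by (auto simp: skew_unit_def matrix_matrix_mult_def intro!: sum.cong)
    also have "\<dots> = (if i = a then M $ b $ j else if i = b then - M $ a $ j else 0)"
      using assms by (cases "i = a"; cases "i = b") (simp_all cong: if_cong)
    finally show ?thesis .
  qed
  show ?thesis
    using assms by (auto simp: vec_eq_iff 1) (auto simp: skew_unit_def)
qed

lemma rotation_add:
  assumes "a \<noteq> b" shows "rotation a b s ** rotation a b t = rotation a b (s + t)"
proof -
  let ?X = "skew_unit a b" and ?Y = "skew_unit a b ** skew_unit a b"
  have XY: "?X ** ?Y = - ?X" "?Y ** ?X = - ?X" "?Y ** ?Y = - ?Y"
    using skew_unit_cube[OF assms] by (simp_all add: matrix_mul_assoc[symmetric] matrix_mult.minus_right)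
  have "rotation a b s ** rotation a b t = mat 1 + (1 - (cos s * cos t - sin s * sin t)) *\<^sub>R ?Y
      + (sin s * cos t + cos s * sin t) *\<^sub>R ?X"
    unfolding rotation_def
    by (simp add: matrix_mult.add_left matrix_mult.add_right matrix_mult.scaleR_left matrix_mult.scaleR_right XY)
      (simp add: algebra_simps)
  then show ?thesis by (simp add: rotation_def cos_add sin_add)
qed

lemma rotation_0 [simp]: "rotation a b 0 = mat 1" by (simp add: rotation_def)

lemma rotation_SO:
  assumes "a \<noteq> b" shows "rotation a b t \<in> SO_real"
proof -
  have skt: "transpose (skew_unit a b) = - skew_unit a b"
    using assms by (auto simp: skew_unit_def transpose_def vec_eq_iff)
  have orth: "transpose (rotation a b t) ** rotation a b t = mat 1" for t
  proof -
    have "transpose (rotation a b t) = rotation a b (- t)"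
    proof -
      have "transpose (rotation a b t) = mat 1 + (1 - cos t) *\<^sub>R transpose (skew_unit a b ** skew_unit a b)
          + sin t *\<^sub>R transpose (skew_unit a b)"
        by (simp add: rotation_def transpose_def vec_eq_iff mat_def) 
      then show ?thesis
        by (simp add: matrix_transpose_mul skt matrix_mult.minus_left matrix_mult.minus_right) (simp add: rotation_def)
    qed
    then show ?thesis using rotation_add[OF assms, of "- t" t] by simp
  qed
  \<comment> \<open>Orthogonality gives only the square of a determinant. The rotation by t is the
    square of the rotation by t/2, so its determinant is such a square.\<close>
  have "(det (rotation a b (t / 2)))\<^sup>2 = 1"
    using arg_cong[OF orth[of "t / 2"], of det] by (simp add: det_mul power2_eq_square)
  moreover have "det (rotation a b t) = (det (rotation a b (t / 2)))\<^sup>2"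
    using arg_cong[OF rotation_add[OF assms, of "t / 2" "t / 2"], of det] by (simp add: det_mul power2_eq_square)
  moreover have "rotation a b t $ i $ j \<in> \<real>" for i j
  proof -
    have s: "skew_unit a b $ i $ j \<in> \<real>" for i j by (simp add: skew_unit_def)
    then have "(skew_unit a b ** skew_unit a b) $ i $ j \<in> \<real>"
      by (auto simp: matrix_matrix_mult_def intro!: sum_in_Reals Reals_mult)
    then show ?thesis
      using s by (simp add: rotation_def mat_def complex_is_Real_iff)
  qed
  ultimately show ?thesis using orth by (simp add: SO_real_def SL_real_def SL_complex_def)
qed

lemma rotation_derivative: "(rotation a b has_vector_derivative skew_unit a b) (at 0)"
  unfolding rotation_def by (auto intro!: derivative_eq_intros)

text \<open>Real rotations span all complex skew matrices over the complex numbers. The sum runs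
  over ordered pairs, so each plane is counted twice with equal contributions; hence the factor
  1/2.\<close>

lemma skew_decomposition:
  fixes Z :: "complex^'n^'n"
  assumes "transpose Z = - Z"
  shows "Z = (\<Sum>(a, b)\<in>{(a, b). a \<noteq> b}. mat (Z $ a $ b / 2) ** skew_unit a b)"
proof -
  have Zs: "Z $ j $ i = - Z $ i $ j" for i j
    using arg_cong[OF assms, of "\<lambda>M. M $ i $ j"] by (simp add: transpose_def)
  have "(\<Sum>(a, b)\<in>{(a, b). a \<noteq> b}. mat (Z $ a $ b / 2) ** skew_unit a b) $ i $ j = Z $ i $ j" for i j
  proof (cases "i = j")
    case True
    have "Z $ i $ i = 0" using Zs[of i i] by (simp add: complex_eq_iff)
    moreover have "(mat (Z $ fst p $ snd p / 2) ** skew_unit (fst p) (snd p)) $ i $ j = 0" if "fst p \<noteq> snd p" for p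
      using that True by (auto simp: matrix_scale_nth skew_unit_def)
    ultimately show ?thesis using True by (simp add: case_prod_beta sum.neutral)
  next
    case False
    let ?f = "\<lambda>p. Z $ fst p $ snd p / 2 * skew_unit (fst p) (snd p) $ i $ j"
    have "(\<Sum>(a, b)\<in>{(a, b). a \<noteq> b}. mat (Z $ a $ b / 2) ** skew_unit a b) $ i $ j =
        (\<Sum>p\<in>{(a, b). a \<noteq> b}. ?f p)"
      by (simp add: matrix_scale_nth case_prod_beta)
    also have "\<dots> = (\<Sum>p\<in>{(i, j), (j, i)}. ?f p)"
    proof (rule sum.mono_neutral_right)
      show "\<forall>p\<in>{(a, b). a \<noteq> b} - {(i, j), (j, i)}. ?f p = 0"
      proof
        fix p assume "p \<in> {(a, b). a \<noteq> b} - {(i, j), (j, i)}"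
        then show "?f p = 0" by (cases p) (auto simp: skew_unit_def)
      qed
      show "{(i, j), (j, i)} \<subseteq> {(a, b). a \<noteq> b}" using False by simp
    qed simp
    also have "\<dots> = Z $ i $ j" using False Zs[of j i] by (simp add: skew_unit_def)
    finally show ?thesis .
  qed
  then show ?thesis by (simp add: vec_eq_iff)
qed

text \<open>Rotating the flag gives a curve in S whose velocity in the chart is the lower part of
  the conjugated generator, because \<open>low\<close> is the derivative of
  \<open>low_factor\<close> at the identity. Since the tangent space is complex, the claim extends
  from real plane rotations to every complex skew matrix.\<close>

lemma SO_orbit_tangent:
  fixes S :: "'n::{finite,linorder} flag set"
  assumes c: "dim_seq TYPE('n) c" and g: "invertible g"
    and S: "\<And>k. k \<in> SO_real \<Longrightarrow> act k (act g (base_flag c)) \<in> S"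
    and T: "vec.subspace (tangent_space c g S)" and Z: "transpose Z = - Z"
  shows "mvec (low (block_index c) (matrix_inv g ** Z ** g)) \<in> tangent_space c g S"
proof -
  let ?T = "tangent_space c g S"
  let ?b = "block_index c :: 'n \<Rightarrow> nat"
  define \<Lambda> where "\<Lambda> X = mvec (low ?b (matrix_inv g ** X ** g))" for X
  have lin: "linear (\<lambda>X. matrix_inv g ** X ** g)"
    by (rule linearI) (simp_all add: matrix_mult.add_left matrix_mult.add_right matrix_mult.scaleR_left matrix_mult.scaleR_right)
  have lin\<Lambda>: "linear \<Lambda>"
    unfolding \<Lambda>_def using linear_compose[OF linear_compose[OF lin linear_low] linear_mvec] by (simp add: o_def)
  have sc: "\<Lambda> (mat a ** X) = a *s \<Lambda> X" for a X
  proof -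
    have "matrix_inv g ** (mat a ** X) ** g = mat a ** (matrix_inv g ** X ** g)"
      by (metis matrix_mul_assoc matrix_scale_commute)
    then show ?thesis by (simp add: \<Lambda>_def low_scale mvec_scale)
  qed
  have gen: "\<Lambda> (skew_unit a b) \<in> ?T" if ab: "a \<noteq> b" for a b
  proof -
    let ?R = "\<lambda>t. matrix_inv g ** rotation a b t ** g"
    define x where "x t = mvec (low_factor ?b (?R t))" for t
    have R0: "?R 0 = mat 1" by (simp add: matrix_inv_left[OF g])
    have "bounded_linear (\<lambda>X. matrix_inv g ** X ** g)" by (rule bounded_linear_matrix[OF lin])
    then have Rd: "(?R has_vector_derivative matrix_inv g ** skew_unit a b ** g) (at 0)"
      using rotation_derivative by (rule bounded_linear.has_vector_derivative)
    have lf: "(low_factor ?b has_derivative low ?b) (at (?R 0))" unfolding R0 by (rule low_factor_local(2))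
    have "((\<lambda>t. low_factor ?b (?R t)) has_derivative (\<lambda>t. low ?b (t *\<^sub>R (matrix_inv g ** skew_unit a b ** g)))) (at 0)"
      using Rd lf unfolding has_vector_derivative_def by (rule has_derivative_compose)
    then have "((\<lambda>t. low_factor ?b (?R t)) has_vector_derivative low ?b (matrix_inv g ** skew_unit a b ** g)) (at 0)"
      by (simp add: has_vector_derivative_def linear_scale[OF linear_low])
    then have xd: "(x has_vector_derivative \<Lambda> (skew_unit a b)) (at 0)"
      unfolding x_def \<Lambda>_def by (rule bounded_linear.has_vector_derivative[OF bounded_linear_mvec])
    have "low_factor ?b (mat 1) = 0" using low_factor_eq[of 0 ?b "mat 1"] by simp
    then have x0: "x 0 = 0" unfolding x_def R0 by (simp add: linear_0[OF linear_mvec])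
    have "isCont ?R 0" using Rd has_vector_derivative_continuous by blast
    then have "\<forall>\<^sub>F t in at 0. ?R t \<in> big_cell ?b"
      unfolding isCont_def using open_big_cell R0 big_cellI[of 0 ?b "mat 1"] by (intro topological_tendstoD) auto
    then obtain e where e: "e > 0" "\<And>t. t \<noteq> 0 \<Longrightarrow> dist t 0 < e \<Longrightarrow> ?R t \<in> big_cell ?b"
      unfolding eventually_at by auto
    have R: "?R t \<in> big_cell ?b" if "t \<in> ball 0 e" for t
      using e(2)[of t] that R0 big_cellI[of 0 ?b "mat 1"] by (cases "t = 0") (auto simp: dist_commute)
    show ?thesis
      unfolding tangent_space_def
    proof (intro CollectI exI[of _ x] exI[of _ e] conjI ballI e(1) xd x0)
      fix t :: real assume t: "t \<in> ball 0 e"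
      have xN: "x t \<in> nil_lower c"
        using big_cellE[OF R[OF t]] by (auto simp: x_def intro: mvec_nil_lower)
      have SO: "rotation a b t \<in> SO_real" by (rule rotation_SO[OF ab])
      then have inv: "invertible (rotation a b t ** g)"
        using g by (auto simp: SO_real_def SL_real_def SL_invertible invertible_mult_iff)
      have "act (rotation a b t ** g) (base_flag c) = flag_chart c g (x t)"
        using act_base_eq_flag_chart_iff[OF c g inv xN] R[OF t] by (simp add: x_def matrix_mul_assoc)
      then show "x t \<in> nil_lower c" "flag_chart c g (x t) \<in> S"
        using xN S[OF SO] by (simp_all add: act_act)
    qed
  qed
  have "\<Lambda> Z = (\<Sum>p\<in>{(a, b). a \<noteq> b}. \<Lambda> (mat (Z $ fst p $ snd p / 2) ** skew_unit (fst p) (snd p)))"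
    by (subst skew_decomposition[OF Z]) (simp add: linear_sum[OF lin\<Lambda>] case_prod_beta)
  also have "\<dots> \<in> ?T"
    by (rule vec.subspace_sum[OF T]) (auto simp: sc gen intro!: vec.subspace_scale[OF T])
  finally show ?thesis by (simp add: \<Lambda>_def)
qed

section \<open>Orthogonal projections\<close>

lemma inner_matrix_eq: "A \<bullet> B = (\<Sum>i\<in>UNIV. \<Sum>j\<in>UNIV. Re (A $ i $ j * cnj (B $ i $ j)))"
  for A B :: "complex^'n^'n"
  by (simp add: inner_vec_def inner_complex_def)

lemma inner_adj: "adj A \<bullet> adj B = A \<bullet> B" for A B :: "complex^'n^'n"
  unfolding inner_matrix_eq adj_nth by (subst sum.swap) (simp add: algebra_simps)

lemma inner_cnjm: "cnjm A \<bullet> B = A \<bullet> cnjm B" for A B :: "complex^'n^'n"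
  by (simp add: inner_matrix_eq)

lemma inner_mult_left: "(A ** B) \<bullet> C = B \<bullet> (adj A ** C)" for A B C :: "complex^'n^'n"
proof -
  have "(A ** B) \<bullet> C = Re (\<Sum>i\<in>UNIV. \<Sum>j\<in>UNIV. \<Sum>k\<in>UNIV. A $ i $ k * B $ k $ j * cnj (C $ i $ j))"
    by (simp only: inner_matrix_eq matrix_matrix_mult_def vec_lambda_beta Re_sum sum_distrib_right)
  also have "(\<Sum>i\<in>UNIV. \<Sum>j\<in>UNIV. \<Sum>k\<in>UNIV. A $ i $ k * B $ k $ j * cnj (C $ i $ j)) =
      (\<Sum>i\<in>UNIV. \<Sum>k\<in>UNIV. \<Sum>j\<in>UNIV. A $ i $ k * B $ k $ j * cnj (C $ i $ j))"
    by (rule sum.cong[OF refl], rule sum.swap)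
  also have "\<dots> = (\<Sum>k\<in>UNIV. \<Sum>i\<in>UNIV. \<Sum>j\<in>UNIV. A $ i $ k * B $ k $ j * cnj (C $ i $ j))"
    by (rule sum.swap)
  also have "\<dots> = (\<Sum>k\<in>UNIV. \<Sum>j\<in>UNIV. \<Sum>i\<in>UNIV. A $ i $ k * B $ k $ j * cnj (C $ i $ j))"
    by (rule sum.cong[OF refl], rule sum.swap)
  also have "Re \<dots> = B \<bullet> (adj A ** C)"
    by (simp only: inner_matrix_eq matrix_matrix_mult_def vec_lambda_beta Re_sum sum_distrib_left cnj_sum
        adj_nth complex_cnj_mult complex_cnj_cnj mult_ac)
  finally show ?thesis .
qed

lemma inner_mult_right: "(A ** B) \<bullet> C = A \<bullet> (C ** adj B)" for A B C :: "complex^'n^'n"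
  using inner_mult_left[of "adj B" "adj A" "adj C"] inner_adj[of "A ** B" C] inner_adj[of A "C ** adj B"]
  by (simp add: adj_mult)

definition is_projection :: "complex^'n^'n \<Rightarrow> (complex^'n) set \<Rightarrow> bool" where
  "is_projection P A \<longleftrightarrow> adj P = P \<and> P ** P = P \<and> range ((*v) P) = A"

definition projection :: "(complex^'n) set \<Rightarrow> complex^'n^'n" where
  "projection A = (SOME P. is_projection P A)"

lemma is_projection_fixes: "is_projection P A \<Longrightarrow> v \<in> A \<Longrightarrow> P *v v = v"
  unfolding is_projection_def by (auto simp: matrix_vector_mul_assoc)

lemma is_projection_in: "is_projection P A \<Longrightarrow> P *v v \<in> A"
  unfolding is_projection_def by auto

lemma is_projection_mult:
  fixes M :: "complex^'n^'n"
  assumes P: "is_projection P A" and M: "\<And>v. M *v v \<in> A" shows "P ** M = M"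
  using is_projection_fixes[OF P M] by (simp add: matrix_eq flip: matrix_vector_mul_assoc)

lemma is_projection_unique:
  assumes P: "is_projection P A" and Q: "is_projection Q A" shows "P = Q"
proof -
  have PQ: "P ** Q = Q" and QP: "Q ** P = P"
    using is_projection_mult[OF P is_projection_in[OF Q]] is_projection_mult[OF Q is_projection_in[OF P]] .
  have "P = adj (Q ** P)" using QP P by (simp add: is_projection_def)
  also have "\<dots> = P ** Q" using P Q by (simp add: adj_mult is_projection_def)
  finally show ?thesis using PQ by simp
qed

lemma is_projection_exists:
  fixes A :: "(complex^'n::{finite,linorder}) set"
  assumes "vec.subspace A" shows "\<exists>P. is_projection P A"
proof -
  let ?k = "vec.dim A"
  obtain u :: "'n cmat" where u: "unitary u" "A = (*v) u ` coord_space ?k"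
    using subspace_eq_unitary_image[OF assms] .
  define D :: "'n cmat" where "D = (\<chi> i j. if i = j \<and> rk i < ?k then 1 else 0)"
  have Dv: "(D *v v) $ i = (if rk i < ?k then v $ i else 0)" for v i
    by (simp add: D_def matrix_vector_mult_def if_distrib if_distribR cong: if_cong)
  have adjD: "adj D = D" by (auto simp: D_def vec_eq_iff)
  have DD: "D ** D = D" by (simp add: matrix_eq vec_eq_iff Dv flip: matrix_vector_mul_assoc)
  have rangeD: "range ((*v) D) = coord_space ?k"
  proof (intro set_eqI iffI)
    fix v :: "(complex, 'n) vec" assume "v \<in> coord_space ?k"
    then have "v = D *v v" by (auto simp: vec_eq_iff Dv coord_space_def)
    then show "v \<in> range ((*v) D)" by blast
  qed (auto simp: coord_space_def Dv)
  have "range ((*v) (adj u)) = UNIV"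
    using u(1) unfolding unitary_def by (metis matrix_right_invertible_surjective)
  moreover have "range ((*v) (u ** D ** adj u)) = (*v) u ` (*v) D ` range ((*v) (adj u))"
    by (simp only: image_image_mat matrix_mul_assoc)
  ultimately have "range ((*v) (u ** D ** adj u)) = A" using u(2) rangeD by simp
  then have "is_projection (u ** D ** adj u) A"
    using u(1) by (simp add: is_projection_def adj_mult adjD matrix_mul_assoc)
      (metis DD matrix_mul_assoc matrix_mul_rid unitary_def)
  then show ?thesis by blast
qed

lemma is_projection_projection:
  fixes A :: "(complex^'n::{finite,linorder}) set"
  assumes "vec.subspace A" shows "is_projection (projection A) A"
  unfolding projection_def using is_projection_exists[OF assms] by (rule someI_ex)

lemma projection_eq: "is_projection P A \<Longrightarrow> projection A = P"
  unfolding projection_def by (metis is_projection_unique someI)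

lemma is_projection_image:
  assumes u: "unitary u" and P: "is_projection P A"
  shows "is_projection (u ** P ** adj u) ((*v) u ` A)"
proof -
  have "range ((*v) (adj u)) = UNIV"
    using u unfolding unitary_def by (metis matrix_right_invertible_surjective)
  moreover have "range ((*v) (u ** P ** adj u)) = (*v) u ` (*v) P ` range ((*v) (adj u))"
    by (simp only: image_image_mat matrix_mul_assoc)
  ultimately have "range ((*v) (u ** P ** adj u)) = (*v) u ` range ((*v) P)" by simp
  moreover have "u ** P ** adj u ** (u ** P ** adj u) = u ** P ** adj u"
  proof -
    have "u ** P ** adj u ** (u ** P ** adj u) = u ** (P ** (adj u ** u) ** P) ** adj u"
      by (simp only: matrix_mul_assoc)
    then show ?thesis using u P by (simp add: unitary_def is_projection_def)
  qed
  ultimately show ?thesis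
    using P by (simp add: is_projection_def adj_mult matrix_mul_assoc)
qed

text \<open>A bound independent of the subspace, available before any continuity of projections is
  known.\<close>

lemma norm_projection_le:
  fixes P :: "complex^'n^'n"
  assumes P: "is_projection P A" shows "norm P \<le> norm (mat 1 :: complex^'n^'n)"
proof -
  have "P \<bullet> P = P \<bullet> mat 1"
    using inner_mult_left[of P "mat 1" P] P by (simp add: is_projection_def inner_commute)
  then have "(norm P)\<^sup>2 \<le> norm P * norm (mat 1 :: complex^'n^'n)"
    by (metis norm_cauchy_schwarz power2_norm_eq_inner)
  then show ?thesis by (cases "P = 0") (auto simp: power2_eq_square)
qed

text \<open>The first variation of the projection onto the moving space M(t)A. The identity
  \<open>decomp\<close> is exact and has in each term a factor M - 1 or 1 - K. Boundedness of
  projections then gives continuity, and division by t gives the derivative.\<close>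

lemma projection_variation:
  fixes M P :: "real \<Rightarrow> complex^'n^'n"
  assumes P0: "is_projection P0 A" and P: "\<forall>\<^sub>F t in at 0. is_projection (P t) ((*v) (M t) ` A)"
    and M: "((\<lambda>t. (1 / t) *\<^sub>R (M t - mat 1)) \<longlongrightarrow> Y) (at 0)"
  shows "((\<lambda>t. (1 / t) *\<^sub>R (P t - P0)) \<longlongrightarrow> (mat 1 - P0) ** Y ** P0 + P0 ** adj Y ** (mat 1 - P0)) (at 0)"
proof -
  let ?I = "mat 1 :: complex^'n^'n"
  have M1: "(M \<longlongrightarrow> ?I) (at 0)"
  proof -
    have "((\<lambda>t. t *\<^sub>R ((1 / t) *\<^sub>R (M t - ?I)) + ?I) \<longlongrightarrow> 0 *\<^sub>R Y + ?I) (at 0)"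
      by (intro tendsto_intros M)
    then have "((\<lambda>t. t *\<^sub>R ((1 / t) *\<^sub>R (M t - ?I)) + ?I) \<longlongrightarrow> ?I) (at 0)" by simp
    then show ?thesis
      by (rule Lim_transform_eventually) (auto simp: eventually_at_filter)
  qed
  define K where "K t = matrix_inv (M t)" for t
  have K1: "(K \<longlongrightarrow> ?I) (at 0)" unfolding K_def by (rule tendsto_matrix_inv_1[OF M1])
  have inv: "\<forall>\<^sub>F t in at 0. invertible (M t)" using topological_tendstoD[OF M1 open_invertible] by simp
  have KY: "((\<lambda>t. (1 / t) *\<^sub>R (?I - K t)) \<longlongrightarrow> Y) (at 0)"
  proof -
    have "((\<lambda>t. K t ** ((1 / t) *\<^sub>R (M t - ?I))) \<longlongrightarrow> ?I ** Y) (at 0)"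
      by (intro matrix_mult.tendsto K1 M)
    then have "((\<lambda>t. K t ** ((1 / t) *\<^sub>R (M t - ?I))) \<longlongrightarrow> Y) (at 0)" by simp
    then show ?thesis
    proof (rule Lim_transform_eventually)
      show "\<forall>\<^sub>F t in at 0. K t ** ((1 / t) *\<^sub>R (M t - ?I)) = (1 / t) *\<^sub>R (?I - K t)"
        using inv by eventually_elim
          (simp add: K_def matrix_mult.scaleR_right matrix_mult.diff_right matrix_inv_left)
    qed
  qed
  have adjt: "((\<lambda>t. adj (X t)) \<longlongrightarrow> adj L) F" if "(X \<longlongrightarrow> L) F" for X :: "real \<Rightarrow> complex^'n^'n" and L F
    unfolding adj_def by (intro tendsto_intros that)
  have adj_scale: "adj (r *\<^sub>R X) = r *\<^sub>R adj X" for r and X :: "complex^'n^'n"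
    by (simp add: vec_eq_iff)
  \<comment> \<open>The first term uses that the inverse K of M maps the moving space back into A,
    the second is the adjoint of the relation saying that M maps A into the moving space.\<close>
  have decomp: "\<forall>\<^sub>F t in at 0. P t - P0 =
      (?I - P0) ** (?I - K t) ** P t + P0 ** adj (M t - ?I) ** (?I - P t)"
    using P inv
  proof eventually_elim
    case (elim t)
    have "K t *v (P t *v v) \<in> A" for v
    proof -
      obtain a where a: "a \<in> A" "P t *v v = M t *v a" using is_projection_in[OF elim(1)] by blast
      then show ?thesis using elim(2) by (simp add: K_def matrix_vector_mul_assoc matrix_inv_left)
    qed
    then have "P0 ** (K t ** P t) = K t ** P t"
      by (intro is_projection_mult[OF P0]) (simp flip: matrix_vector_mul_assoc)
    then have 1: "(?I - P0) ** (?I - K t) ** P t = P t - P0 ** P t"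
      by (simp add: matrix_mult.diff_left matrix_mult.diff_right matrix_mul_assoc)
    have "P t ** (M t ** P0) = M t ** P0"
      by (intro is_projection_mult[OF elim(1)]) (use is_projection_in[OF P0] in \<open>simp flip: matrix_vector_mul_assoc\<close>)
    then have "(?I - P t) ** (M t - ?I) ** P0 = P t ** P0 - P0"
      by (simp add: matrix_mult.diff_left matrix_mult.diff_right matrix_mul_assoc)
    then have "adj ((?I - P t) ** (M t - ?I) ** P0) = adj (P t ** P0 - P0)" by simp
    then have 2: "P0 ** adj (M t - ?I) ** (?I - P t) = P0 ** P t - P0"
      using P0 elim(1) by (simp add: adj_mult adj_diff is_projection_def matrix_mul_assoc)
    show ?case using 1 2 by simp
  qed
  have Pb: "Bfun P (at 0)"
    by (rule BfunI[where K="norm ?I"], rule eventually_mono[OF P norm_projection_le])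
  have "((\<lambda>t. (?I - P0) ** (?I - K t) ** P t + P0 ** adj (M t - ?I) ** (?I - P t)) \<longlongrightarrow> 0) (at 0)"
  proof -
    have a: "((\<lambda>t. (?I - P0) ** (?I - K t)) \<longlongrightarrow> (?I - P0) ** (?I - ?I)) (at 0)"
      by (intro matrix_mult.tendsto tendsto_intros K1)
    have b: "((\<lambda>t. P0 ** adj (M t - ?I)) \<longlongrightarrow> P0 ** adj (?I - ?I)) (at 0)"
      by (intro matrix_mult.tendsto tendsto_intros adjt M1)
    have z: "adj (0 :: complex^'n^'n) = 0" by (simp add: vec_eq_iff)
    have Qb: "Bfun (\<lambda>t. ?I - P t) (at 0)"
    proof (rule BfunI[where K="norm ?I + norm ?I"])
      show "\<forall>\<^sub>F t in at 0. norm (?I - P t) \<le> norm ?I + norm ?I"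
        using P
      proof eventually_elim
        case (elim t)
        have "norm (?I - P t) \<le> norm ?I + norm (P t)" by (rule norm_triangle_ineq4)
        then show ?case using norm_projection_le[OF elim] by simp
      qed
    qed
    have "Zfun (\<lambda>t. (?I - P0) ** (?I - K t) ** P t) (at 0)"
      by (rule matrix_mult.Zfun_prod_Bfun[OF _ Pb]) (use a in \<open>simp add: tendsto_Zfun_iff\<close>)
    moreover have "Zfun (\<lambda>t. P0 ** adj (M t - ?I) ** (?I - P t)) (at 0)"
      by (rule matrix_mult.Zfun_prod_Bfun[OF _ Qb]) (use b z in \<open>simp add: tendsto_Zfun_iff\<close>)
    ultimately show ?thesis using Zfun_add by (fastforce simp: tendsto_Zfun_iff)
  qed
  then have "((\<lambda>t. P t - P0) \<longlongrightarrow> 0) (at 0)"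
    by (rule Lim_transform_eventually) (use decomp in \<open>eventually_elim, simp\<close>)
  then have PP: "(P \<longlongrightarrow> P0) (at 0)" by (simp add: LIM_zero_iff)
  have "((\<lambda>t. (?I - P0) ** ((1 / t) *\<^sub>R (?I - K t)) ** P t + P0 ** adj ((1 / t) *\<^sub>R (M t - ?I)) ** (?I - P t))
      \<longlongrightarrow> (?I - P0) ** Y ** P0 + P0 ** adj Y ** (?I - P0)) (at 0)"
    by (intro tendsto_add matrix_mult.tendsto tendsto_diff tendsto_const PP KY adjt M)
  then show ?thesis
  proof (rule Lim_transform_eventually)
    show "\<forall>\<^sub>F t in at 0. (?I - P0) ** ((1 / t) *\<^sub>R (?I - K t)) ** P t + P0 ** adj ((1 / t) *\<^sub>R (M t - ?I)) ** (?I - P t)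
        = (1 / t) *\<^sub>R (P t - P0)"
      using decomp by eventually_elim
        (simp add: matrix_mult.scaleR_left matrix_mult.scaleR_right adj_scale scaleR_add_right)
  qed
qed

section \<open>Base cycles consist of isotropic flags\<close>

text \<open>The dimensions decide which of the two inclusions is possible; when they add up to n,
  both hold and A is the complement of B.\<close>

definition isotropic_flag :: "'n::{finite,linorder} flag \<Rightarrow> bool" where
  "isotropic_flag V \<longleftrightarrow> (\<forall>A\<in>set V. \<forall>B\<in>set V.
     (vec.dim A + vec.dim B \<le> CARD('n) \<longrightarrow> A \<subseteq> bperp B) \<and>
     (CARD('n) \<le> vec.dim A + vec.dim B \<longrightarrow> bperp B \<subseteq> A))"

lemma SO_real_unitary:
  assumes k: "k \<in> SO_real" shows "unitary k" "cnjm k = k" "adj k = transpose k" "invertible k"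
proof -
  show c: "cnjm k = k" using k by (auto simp: SO_real_def intro: SL_real_cnjm)
  then show a: "adj k = transpose k" by (simp add: adj_eq)
  then show "unitary k" using k by (simp add: unitary_def SO_real_def)
  then show "invertible k" by (rule unitary_invertible)
qed

lemma SL_real_mult:
  assumes "k \<in> SL_real" "l \<in> SL_real" shows "k ** l \<in> SL_real"
proof -
  have "(k ** l) $ i $ j \<in> \<real>" for i j
    using assms by (auto simp: matrix_matrix_mult_def SL_real_def intro!: sum_in_Reals Reals_mult)
  then show ?thesis using assms by (simp add: SL_real_def SL_complex_def det_mul)
qed

lemma SO_real_mult:
  assumes "k \<in> SO_real" "l \<in> SO_real" shows "k ** l \<in> SO_real"
proof -
  have "unitary (k ** l)" "adj (k ** l) = transpose (k ** l)"
    using assms SO_real_unitary[of k] SO_real_unitary[of l]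
    by (auto simp: unitary_mult adj_mult matrix_transpose_mul)
  then show ?thesis using assms SL_real_mult by (auto simp: SO_real_def unitary_def)
qed

lemma SO_real_transpose:
  assumes "k \<in> SO_real" shows "transpose k \<in> SO_real"
proof -
  have "transpose k $ i $ j = k $ j $ i" for i j by (simp add: transpose_def)
  then show ?thesis
    using assms matrix_left_right_inverse1[of "transpose k" k]
    by (auto simp: SO_real_def SL_real_def SL_complex_def)
qed

text \<open>The moment map argument: among the flags of an \<open>SO(n,\<real>)\<close>-orbit, \<open>V\<close> maximizes the pairing of the
  weighted sum of projections with its own imaginary part \<open>Z\<close>, and the direction \<open>Z\<close> is tangent to the
  orbit at \<open>V\<close> because the tangent space is complex.\<close>

lemma base_cycle_stable:
  fixes V :: "'n::{finite,linorder} flag" and wt :: "nat \<Rightarrow> real"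
  assumes c: "dim_seq TYPE('n) c" and S: "S = orbit SO_real V0" "complex_submanifold c k S" and V: "V \<in> S"
    and wt: "\<And>i. wt i > 0" and i: "i < length c"
    and Z: "Z = (1 / 2) *\<^sub>R (\<Sum>j<length c. wt j *\<^sub>R (projection (V ! j) - cnjm (projection (V ! j))))"
  shows "(mat 1 - projection (V ! i)) ** Z ** projection (V ! i) = 0"
proof -
  let ?I = "mat 1 :: 'n cmat" and ?b = "block_index c :: 'n \<Rightarrow> nat"
  define P where "P j = projection (V ! j)" for j
  have Sf: "S \<subseteq> flags c" using S(2) by (simp add: complex_submanifold_def)
  have Vf: "V \<in> flags c" using V Sf by blast
  have lenV: "length V = length c" using Vf by (simp add: flags_def)
  have sub: "vec.subspace (V ! j)" if "j < length c" for j using Vf that by (simp add: flags_def)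
  have P: "is_projection (P j) (V ! j)" if "j < length c" for j
    unfolding P_def by (rule is_projection_projection[OF sub[OF that]])
  have SV: "S = orbit SO_real V"
  proof -
    obtain l where l: "l \<in> SO_real" "V = act l V0" using V S(1) by (auto simp: orbit_def)
    have l': "transpose l \<in> SO_real" by (rule SO_real_transpose[OF l(1)])
    have ll: "transpose l ** l = mat 1" using l(1) by (simp add: SO_real_def)
    show ?thesis
    proof (intro set_eqI iffI)
      fix W assume "W \<in> S"
      then obtain m where m: "m \<in> SO_real" "W = act m V0" using S(1) by (auto simp: orbit_def)
      have "act (m ** transpose l) V = W"
        by (simp add: l(2) m(2) act_act matrix_mul_assoc[symmetric] ll)
      then show "W \<in> orbit SO_real V" using SO_real_mult[OF m(1) l'] by (auto simp: orbit_def)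
    next
      fix W assume "W \<in> orbit SO_real V"
      then show "W \<in> S" using S(1) l SO_real_mult by (auto simp: orbit_def act_act)
    qed
  qed
  obtain M0 where M0: "invertible M0" "V = act M0 (base_flag c)" by (rule flags_transitive[OF c Vf])
  define g where "g = normalize_det M0"
  have g: "g \<in> SL_complex" "act g (base_flag c) = V" "invertible g"
    using M0 by (auto simp: g_def normalize_det_SL act_normalize_det[OF c] SL_invertible)
  have gS: "act g (base_flag c) \<in> S" using g(2) V by simp
  have cZ: "cnjm Z = - Z" by (simp add: Z vec_eq_iff sum_subtractf algebra_simps)
  have aZ: "adj Z = Z"
  proof -
    have "adj (projection (V ! j)) = projection (V ! j)" if "j < length c" for j
      using P[OF that] by (simp add: is_projection_def P_def)
    then have "cnj (projection (V ! j) $ b $ a) = projection (V ! j) $ a $ b" if "j < length c" for j a b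
      using that by (metis adj_nth)
    then show ?thesis by (simp add: Z vec_eq_iff)
  qed
  \<comment> \<open>Z is Hermitian and purely imaginary, hence skew-symmetric: it is i times an
    element of so(n,R). The complex tangent space therefore contains its direction.\<close>
  have tZ: "transpose Z = - Z"
    using aZ cZ unfolding adj_eq by (simp add: vec_eq_iff transpose_def)
  have "mvec (low ?b (matrix_inv g ** Z ** g)) \<in> tangent_space c g S"
  proof (rule SO_orbit_tangent[OF c g(3) _ subspace_tangent_space[OF S(2) g(1) gS] tZ])
    show "act k (act g (base_flag c)) \<in> S" if "k \<in> SO_real" for k
      using that by (auto simp: SV g(2) orbit_def)
  qed
  then obtain x e where x: "e > 0"
    "(x has_vector_derivative mvec (low ?b (matrix_inv g ** Z ** g))) (at 0)" "x 0 = 0"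
    "\<And>t. t \<in> ball 0 e \<Longrightarrow> x t \<in> nil_lower c \<and> flag_chart c g (x t) \<in> S"
    unfolding tangent_space_def by blast
  define M where "M t = g ** (?I + vmat (x t)) ** matrix_inv g" for t
  define Y where "Y = g ** low ?b (matrix_inv g ** Z ** g) ** matrix_inv g"
  have MV: "flag_chart c g (x t) = act (M t) V" for t
    using g by (simp add: flag_chart_eq M_def g(2)[symmetric] act_act matrix_mul_assoc[symmetric] matrix_inv_left)
  have gx: "M t - ?I = g ** vmat (x t) ** matrix_inv g" for t
    using g(3) by (simp add: M_def matrix_mult.add_right matrix_mult.add_left matrix_inv_right)
  have Mlim: "((\<lambda>t. (1 / t) *\<^sub>R (M t - ?I)) \<longlongrightarrow> Y) (at 0)"
  proof -
    have bl: "bounded_linear (\<lambda>v. g ** vmat v ** matrix_inv g)"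
      by (intro bounded_linear_compose[OF matrix_mult.bounded_linear_left]
          bounded_linear_compose[OF matrix_mult.bounded_linear_right] bounded_linear_vmat)
    have "((\<lambda>t. g ** vmat ((1 / t) *\<^sub>R (x t - x 0)) ** matrix_inv g) \<longlongrightarrow>
        g ** vmat (mvec (low ?b (matrix_inv g ** Z ** g))) ** matrix_inv g) (at 0)"
      by (rule bounded_linear.tendsto[OF bl has_vector_derivative_quotient[OF x(2)]])
    then show ?thesis
      by (simp add: x(3) gx Y_def linear_scale[OF linear_vmat] matrix_mult.scaleR_left matrix_mult.scaleR_right)
  qed
  \<comment> \<open>The chart moves along Y instead of Z. Their difference is conjugate by g to a
    block upper matrix, so it preserves every member of the flag and does not change the part that
    leads out of it.\<close>
  have YZ: "(?I - P j) ** Y ** P j = (?I - P j) ** Z ** P j" if j: "j < length c" for j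
  proof -
    let ?G = "matrix_inv g ** Z ** g"
    have Vj: "V ! j = (*v) g ` block_space ?b j"
      using j base_flag_nth[OF c j] by (simp add: g(2)[symmetric] coord_space_partial_sum[OF c])
    have ZY: "Z - Y = g ** (?G - low ?b ?G) ** matrix_inv g"
      using g(3) by (simp add: Y_def matrix_mult.diff_left matrix_mult.diff_right matrix_mul_assoc matrix_inv_right)
        (simp add: matrix_mul_assoc[symmetric] matrix_inv_right)
    have "(Z - Y) *v (P j *v v) \<in> V ! j" for v
    proof -
      obtain w where w: "w \<in> block_space ?b j" "P j *v v = g *v w"
        using is_projection_in[OF P[OF j]] Vj by blast
      have "(?G - low ?b ?G) *v w \<in> block_space ?b j"
        using diff_low_upper upper_iff_image_subset w(1) by blast
      moreover have "(Z - Y) *v (P j *v v) = g *v ((?G - low ?b ?G) *v w)"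
        unfolding w(2) ZY using g(3)
        by (simp only: matrix_vector_mul_assoc matrix_mul_assoc[symmetric] matrix_inv_left matrix_mul_rid)
      ultimately show ?thesis using Vj by blast
    qed
    then have "P j ** ((Z - Y) ** P j) = (Z - Y) ** P j"
      by (intro is_projection_mult[OF P[OF j]]) (simp flip: matrix_vector_mul_assoc)
    then show ?thesis
      by (simp add: matrix_mult.diff_left matrix_mult.diff_right matrix_mul_assoc algebra_simps)
  qed
  define u where "u W = (\<Sum>j<length c. wt j *\<^sub>R projection (W ! j)) \<bullet> Z" for W :: "'n flag"
  define F where "F = (\<Sum>j<length c. wt j *\<^sub>R P j)"
  have FZ: "F - cnjm F = 2 *\<^sub>R Z"
    by (simp add: F_def Z P_def vec_eq_iff sum_subtractf algebra_simps)
  \<comment> \<open>Z is imaginary, so pairing with it sees only the imaginary part of a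
    matrix.\<close>
  have imag: "2 * (X \<bullet> Z) = (X - cnjm X) \<bullet> Z" for X
    using inner_cnjm[of X Z] by (simp add: inner_diff_left cZ)
  have uV: "u V = Z \<bullet> Z"
  proof -
    have "u V = F \<bullet> Z" by (simp add: u_def F_def P_def)
    then show ?thesis using imag[of F] unfolding FZ by simp
  qed
  \<comment> \<open>Along the orbit the imaginary part of the weighted sum is only conjugated by a
    real orthogonal matrix and keeps its norm. Cauchy-Schwarz bounds the pairing by the norm of Z
    squared, its value at V.\<close>
  have umax: "u W \<le> u V" if W: "W \<in> S" for W
  proof -
    obtain k where k: "k \<in> SO_real" "W = act k V" using W SV by (auto simp: orbit_def)
    note ku = SO_real_unitary[OF k(1)]
    have "projection (W ! j) = k ** P j ** adj k" if "j < length c" for j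
      using that lenV by (simp add: k(2) projection_eq[OF is_projection_image[OF ku(1) P]])
    then have uW: "u W = (k ** F ** adj k) \<bullet> Z"
      by (simp add: u_def F_def matrix_mult.sum_left matrix_mult.sum_right matrix_mult.scaleR_left matrix_mult.scaleR_right)
    have "cnjm (adj k) = adj k" by (simp add: cnjm_adj ku(2))
    then have "k ** F ** adj k - cnjm (k ** F ** adj k) = k ** (F - cnjm F) ** adj k"
      by (simp add: cnjm_mult ku(2) matrix_mult.diff_left matrix_mult.diff_right)
    then have "k ** F ** adj k - cnjm (k ** F ** adj k) = 2 *\<^sub>R (k ** Z ** adj k)"
      by (simp add: FZ matrix_mult.scaleR_left matrix_mult.scaleR_right)
    moreover have "2 * u W = (k ** F ** adj k - cnjm (k ** F ** adj k)) \<bullet> Z"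
      unfolding uW by (rule imag)
    ultimately have "u W = (k ** Z ** adj k) \<bullet> Z" by simp
    then have "u W \<le> norm (k ** Z ** adj k) * norm Z" by (simp add: norm_cauchy_schwarz)
    also have "norm (k ** Z ** adj k) = norm Z"
    proof -
      have "(k ** Z ** adj k) \<bullet> (k ** Z ** adj k) = Z \<bullet> Z"
      proof -
        have kk: "adj k ** k = mat 1" using ku(1) by (simp add: unitary_def)
        have "(k ** (Z ** adj k)) \<bullet> (k ** (Z ** adj k)) = (Z ** adj k) \<bullet> (adj k ** k ** (Z ** adj k))"
          by (subst inner_mult_left) (simp only: matrix_mul_assoc)
        also have "\<dots> = (Z ** adj k) \<bullet> (Z ** adj k)" by (simp add: kk)
        also have "\<dots> = Z \<bullet> (Z ** (adj k ** k))"
          by (subst inner_mult_right) (simp only: matrix_mul_assoc adj_adj)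
        finally show ?thesis by (simp add: kk matrix_mul_assoc)
      qed
      then show ?thesis by (simp add: norm_eq_sqrt_inner)
    qed
    finally show ?thesis by (simp add: uV power2_norm_eq_inner[symmetric] power2_eq_square)
  qed
  define K where "K j = (?I - P j) ** Z ** P j" for j
  define N where "N j = (?I - P j) ** Y ** P j + P j ** adj Y ** (?I - P j)" for j
  have adjK: "adj (K j) = P j ** adj Y ** (?I - P j)" if "j < length c" for j
    using YZ[OF that] P[OF that] by (simp add: K_def is_projection_def flip: YZ[OF that])
      (simp add: adj_mult adj_diff matrix_mul_assoc is_projection_def)
  have NZ: "N j \<bullet> Z = 2 * (K j \<bullet> K j)" if j: "j < length c" for j
  proof -
    have "N j = K j + adj (K j)" using YZ[OF j] adjK[OF j] by (simp add: N_def K_def)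
    then have "N j \<bullet> Z = 2 * (K j \<bullet> Z)" using inner_adj[of "K j" Z] by (simp add: inner_add_left aZ)
    moreover have "K j \<bullet> Z = K j \<bullet> K j"
    proof -
      have PP: "P j ** P j = P j" "adj (P j) = P j" using P[OF j] by (auto simp: is_projection_def)
      have QQ: "(?I - P j) ** (?I - P j) = ?I - P j" "adj (?I - P j) = ?I - P j"
        by (simp_all add: matrix_mult.diff_left matrix_mult.diff_right PP adj_diff)
      have "K j = (?I - P j) ** K j ** P j"
        unfolding K_def by (metis PP(1) QQ(1) matrix_mul_assoc)
      then have "K j \<bullet> Z = ((?I - P j) ** K j ** P j) \<bullet> Z" by simp
      also have "\<dots> = ((?I - P j) ** K j) \<bullet> (Z ** P j)"
        by (subst inner_mult_right) (simp only: PP)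
      also have "\<dots> = K j \<bullet> ((?I - P j) ** (Z ** P j))"
        by (subst inner_mult_left) (simp only: QQ)
      finally show ?thesis by (simp add: K_def matrix_mul_assoc)
    qed
    ultimately show ?thesis by simp
  qed
  have lim: "((\<lambda>t. (1 / t) * (u (flag_chart c g (x t)) - u V)) \<longlongrightarrow> (\<Sum>j<length c. wt j *\<^sub>R N j) \<bullet> Z) (at 0)"
  proof -
    have "((\<lambda>t. (1 / t) *\<^sub>R (projection (flag_chart c g (x t) ! j) - P j)) \<longlongrightarrow> N j) (at 0)" if j: "j < length c" for j
      unfolding N_def
    proof (rule projection_variation[OF P[OF j] _ Mlim])
      show "\<forall>\<^sub>F t in at 0. is_projection (projection (flag_chart c g (x t) ! j)) ((*v) (M t) ` (V ! j))"
        unfolding eventually_at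
      proof (intro exI[of _ e] conjI x(1) ballI impI)
        fix t :: real assume t: "t \<noteq> 0 \<and> dist t 0 < e"
        then have "flag_chart c g (x t) \<in> flags c" using x(4)[of t] Sf by (auto simp: dist_commute)
        then have "vec.subspace (flag_chart c g (x t) ! j)" using j by (simp add: flags_def)
        moreover have "flag_chart c g (x t) ! j = (*v) (M t) ` (V ! j)" using j lenV by (simp add: MV)
        ultimately show "is_projection (projection (flag_chart c g (x t) ! j)) ((*v) (M t) ` (V ! j))"
          using is_projection_projection by metis
      qed
    qed
    then have "((\<lambda>t. (\<Sum>j<length c. wt j *\<^sub>R ((1 / t) *\<^sub>R (projection (flag_chart c g (x t) ! j) - P j))) \<bullet> Z) \<longlongrightarrow>
        (\<Sum>j<length c. wt j *\<^sub>R N j) \<bullet> Z) (at 0)"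
      by (intro tendsto_intros) auto
    moreover have "(\<Sum>j<length c. wt j *\<^sub>R ((1 / t) *\<^sub>R (projection (W ! j) - P j))) \<bullet> Z = (1 / t) * (u W - u V)" for t W
      by (simp add: u_def P_def inner_sum_left sum_subtractf sum_distrib_left algebra_simps inner_diff_left)
    ultimately show ?thesis by simp
  qed
  \<comment> \<open>From the right of 0 the difference quotients are nonpositive by maximality,
    whereas the limit is a positive combination of the squared norms of the
    \<open>K j\<close>.\<close>
  have "(\<Sum>j<length c. wt j *\<^sub>R N j) \<bullet> Z \<le> 0"
  proof (rule tendsto_upperbound[OF tendsto_within_subset[OF lim, of "{0<..}"]])
    show "\<forall>\<^sub>F t in at_right 0. (1 / t) * (u (flag_chart c g (x t)) - u V) \<le> 0"
      unfolding eventually_at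
      by (rule exI[of _ e]) (use x(1,4) umax in \<open>auto simp: dist_commute divide_le_0_iff\<close>)
  qed auto
  moreover have "(\<Sum>j<length c. wt j *\<^sub>R N j) \<bullet> Z = (\<Sum>j<length c. 2 * wt j * (K j \<bullet> K j))"
    by (simp add: inner_sum_left NZ mult.left_commute mult.assoc)
  moreover have "0 \<le> (\<Sum>j<length c. 2 * wt j * (K j \<bullet> K j))"
    by (rule sum_nonneg) (use wt in \<open>simp add: less_imp_le\<close>)
  moreover have nonneg: "0 \<le> 2 * wt j * (K j \<bullet> K j)" for j using wt[of j] by simp
  ultimately have "(\<Sum>j<length c. 2 * wt j * (K j \<bullet> K j)) = 0"
    by linarith
  then have "2 * wt i * (K i \<bullet> K i) = 0"
    using nonneg i by (simp add: sum_nonneg_eq_0_iff)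
  then have "K i = 0" using wt[of i] by simp
  then show ?thesis by (simp add: K_def P_def)
qed

text \<open>The conjugates of the projections onto members preserve all members. Genericity then
  forces such a conjugate projection to vanish on A when the dimensions are small, and allows a
  vector of \<open>bperp B\<close> to be moved into A when they are large.\<close>

lemma base_cycle_isotropic:
  fixes V :: "'n::{finite,linorder} flag"
  assumes c: "dim_seq TYPE('n) c" and D: "open_orbit c D" and C: "base_cycle c D C" and V: "V \<in> C"
  shows "isotropic_flag V"
proof -
  let ?I = "mat 1 :: 'n cmat"
  obtain V0 k where V0: "V0 \<in> D" "C = orbit SO_real V0" "complex_submanifold c k C"
    using C by (auto simp: base_cycle_def)
  obtain V1 where V1: "D = orbit SL_real V1" using D by (auto simp: open_orbit_def)
  have "V \<in> D"
  proof -
    obtain h l where "h \<in> SL_real" "V0 = act h V1" "l \<in> SO_real" "V = act l V0"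
      using V V0(1,2) V1 by (auto simp: orbit_def)
    moreover from this have "l ** h \<in> SL_real" by (intro SL_real_mult) (auto simp: SO_real_def)
    ultimately show ?thesis unfolding V1 orbit_def by (auto simp: act_act)
  qed
  then have gen: "generic_flag V" by (rule open_orbit_generic[OF c D])
  have Vf: "V \<in> flags c" using V V0(3) by (auto simp: complex_submanifold_def)
  have lenV: "length V = length c" using Vf by (simp add: flags_def)
  have sub: "vec.subspace (V ! j)" if "j < length c" for j using Vf that by (simp add: flags_def)
  define P where "P j = projection (V ! j)" for j
  have P: "is_projection (P j) (V ! j)" if "j < length c" for j
    unfolding P_def by (rule is_projection_projection[OF sub[OF that]])
  have nest: "V ! i \<subseteq> V ! j \<or> V ! j \<subseteq> V ! i" if "i < length c" "j < length c" for i j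
    using Vf that by (cases i j rule: linorder_cases) (auto simp: flags_def sorted_wrt_iff_nth_less)
  have stable: "cnjm (P j) *v v \<in> V ! i" if i: "i < length c" and j: "j < length c" and v: "v \<in> V ! i" for i j v
  proof -
    let ?Q = "\<lambda>m. projection (V ! m) - cnjm (projection (V ! m))"
    \<comment> \<open>Two systems of weights that differ only at j; subtracting the two statements
      isolates the projection onto the member with index j.\<close>
    let ?\<mu> = "\<lambda>m. if m = j then 2 else 1 :: real"
    have 1: "(?I - P i) ** ((1 / 2) *\<^sub>R (\<Sum>m<length c. 1 *\<^sub>R ?Q m)) ** P i = 0"
      unfolding P_def by (rule base_cycle_stable[OF c V0(2,3) V _ i refl]) simp
    have 2: "(?I - P i) ** ((1 / 2) *\<^sub>R (\<Sum>m<length c. ?\<mu> m *\<^sub>R ?Q m)) ** P i = 0"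
      unfolding P_def by (rule base_cycle_stable[OF c V0(2,3) V _ i refl]) simp
    have "(\<Sum>m<length c. ?\<mu> m *\<^sub>R ?Q m) = (\<Sum>m<length c. 1 *\<^sub>R ?Q m + (if m = j then ?Q j else 0))"
      by (rule sum.cong) (auto simp: scaleR_2)
    also have "\<dots> = (\<Sum>m<length c. 1 *\<^sub>R ?Q m) + ?Q j" using j by (simp add: sum.distrib)
    finally have "(1 / 2) *\<^sub>R (\<Sum>m<length c. ?\<mu> m *\<^sub>R ?Q m) =
        (1 / 2) *\<^sub>R (\<Sum>m<length c. 1 *\<^sub>R ?Q m) + (1 / 2) *\<^sub>R ?Q j" by (simp only: scaleR_add_right)
    then have "(?I - P i) ** ((1 / 2) *\<^sub>R ?Q j) ** P i = 0"
      using 1 2 by (simp add: matrix_mult.add_left matrix_mult.add_right)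
    then have 0: "(?I - P i) ** ?Q j ** P i = 0"
      by (simp add: matrix_mult.scaleR_left matrix_mult.scaleR_right)
    have "((?I - P i) ** ?Q j ** P i) *v v = ?Q j *v v - P i *v (?Q j *v v)"
      using is_projection_fixes[OF P[OF i] v]
      by (simp add: matrix_vector_mul_assoc[symmetric] matrix_vector_mult_diff_rdistrib)
    then have "?Q j *v v = P i *v (?Q j *v v)" using 0 by simp
    then have "?Q j *v v \<in> V ! i" using is_projection_in[OF P[OF i]] by metis
    \<comment> \<open>Members are nested, so the projection onto one of them preserves the other;
      only the conjugate projection carries information.\<close>
    moreover have "P j *v v \<in> V ! i"
      using nest[OF i j] is_projection_in[OF P[OF j], of v] is_projection_fixes[OF P[OF j], of v] v by auto
    ultimately have "P j *v v - ?Q j *v v \<in> V ! i" using sub[OF i] by (intro vec.subspace_diff)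
    then show ?thesis by (simp add: P_def matrix_vector_mult_diff_rdistrib)
  qed
  show ?thesis
    unfolding isotropic_flag_def
  proof (intro ballI conjI impI)
    fix A B assume AB: "A \<in> set V" "B \<in> set V"
    then obtain i j where ij: "i < length c" "A = V ! i" "j < length c" "B = V ! j"
      by (metis in_set_conv_nth lenV)
    have cP: "cnjm (P j) *v cnjv w = cnjv (P j *v w)" for w by (simp add: cnjv_mult)
    have PB: "cnjm (P j) *v w \<in> cnjv ` B" for w
      using cP[of "cnjv w"] is_projection_in[OF P[OF ij(3)], of "cnjv w"] ij(4) by (metis cnjv_cnjv imageI)
    have Pfix: "cnjm (P j) *v cnjv b = cnjv b" if "b \<in> B" for b
      using is_projection_fixes[OF P[OF ij(3)]] that ij(4) by (simp add: cP)
    have adjP: "adj (cnjm (P j)) = cnjm (P j)"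
      using P[OF ij(3)] by (simp add: is_projection_def flip: cnjm_adj)
    {
      assume "vec.dim A + vec.dim B \<le> CARD('n)"
      then have disj: "A \<inter> cnjv ` B \<subseteq> {0}" using gen AB by (simp add: generic_flag_def)
      show "A \<subseteq> bperp B"
      proof
        fix v assume v: "v \<in> A"
        have "cnjm (P j) *v v \<in> A" using stable[OF ij(1,3)] v ij(2) by simp
        then have z: "cnjm (P j) *v v = 0" using PB disj by blast
        have "bil v b = 0" if b: "b \<in> B" for b
        proof -
          have "bil v b = herm v (cnjm (P j) *v cnjv b)" by (simp add: Pfix[OF b] bil_eq_herm)
          also have "\<dots> = herm (cnjm (P j) *v v) (cnjv b)" by (simp add: herm_mult_left adjP)
          finally show ?thesis by (simp add: z)
        qed
        then show "v \<in> bperp B" by (simp add: bperp_def)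
      qed
    next
      assume "CARD('n) \<le> vec.dim A + vec.dim B"
      then have tot: "\<exists>a\<in>A. \<exists>b\<in>B. y = a + cnjv b" for y using gen AB by (simp add: generic_flag_def)
      show "bperp B \<subseteq> A"
      proof
        fix y assume y: "y \<in> bperp B"
        obtain b' where b': "b' \<in> B" "cnjm (P j) *v y = cnjv b'" using PB by blast
        have "cnjm (P j) *v (cnjm (P j) *v y) = cnjm (P j) *v y" using Pfix b' by metis
        then have "herm (cnjm (P j) *v y) (cnjm (P j) *v y) = herm y (cnjm (P j) *v y)"
          by (simp add: herm_mult_left adjP)
        also have "\<dots> = bil y b'" by (simp add: b'(2) bil_eq_herm)
        also have "\<dots> = 0" using y b'(1) by (simp add: bperp_def)
        finally have z: "cnjm (P j) *v y = 0" by simp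
        obtain a b where ab: "a \<in> A" "b \<in> B" "y = a + cnjv b" using tot by blast
        \<comment> \<open>The conjugate projection annihilates y and fixes the conjugate of b, so
          that conjugate is expressed through a, and y lands in A by stability.\<close>
        have "cnjm (P j) *v a + cnjv b = 0" using z ab Pfix[OF ab(2)] by (simp add: matrix_vector_right_distrib)
        then have "y = a - cnjm (P j) *v a" using ab(3) by (metis add_diff_cancel_left' diff_0 add_uminus_conv_diff add.commute eq_neg_iff_add_eq_0)
        moreover have "a - cnjm (P j) *v a \<in> A"
          using stable[OF ij(1,3)] ab(1) ij(2) sub[OF ij(1)] by (auto intro: vec.subspace_diff)
        ultimately show "y \<in> A" by simp
      qed
    }
  qed
qed

section \<open>Orthogonal conjugacy and comparison of the two base cycles\<close>

section \<open>Isotropic flags in one open orbit are conjugate under the orthogonal group\<close>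

lemma isotropic_chain_of_flag:
  fixes V :: "'n::{finite,linorder} flag"
  assumes V: "V \<in> flags c" and iso: "isotropic_flag V"
  shows "isotropic_chain ({{0}, UNIV} \<union> set V \<union> bperp ` set V)"
proof -
  have sub: "vec.subspace A" if "A \<in> set V" for A
    using V that by (auto simp: flags_def in_set_conv_nth)
  have nest: "A \<subseteq> B \<or> B \<subseteq> A" if "A \<in> set V" "B \<in> set V" for A B
  proof -
    obtain i j where "i < length V" "A = V ! i" "j < length V" "B = V ! j"
      using \<open>A \<in> set V\<close> \<open>B \<in> set V\<close> by (metis in_set_conv_nth)
    then show ?thesis
      using V by (cases i j rule: linorder_cases) (auto simp: flags_def sorted_wrt_iff_nth_less)
  qed
  have perp: "A \<subseteq> bperp B \<or> bperp B \<subseteq> A" if "A \<in> set V" "B \<in> set V" for A B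
    using iso that unfolding isotropic_flag_def by (meson linorder_linear)
  have U: "bperp (UNIV :: (complex, 'n) vec set) = {0}"
    using bperp_bperp[of "{0 :: (complex, 'n) vec}"] by (simp add: bperp_0)
  let ?F = "{{0}, UNIV} \<union> set V \<union> bperp ` set V"
  have s0: "0 \<in> A" if "A \<in> ?F" for A
    using that sub subspace_bperp vec.subspace_0 by auto
  have comp: "A \<subseteq> B \<or> B \<subseteq> A" if AB: "A \<in> ?F" "B \<in> ?F" for A B
  proof -
    consider "A = {0} \<or> B = {0} \<or> A = UNIV \<or> B = UNIV" | "A \<in> set V" "B \<in> set V"
      | A' where "A' \<in> set V" "A = bperp A'" "B \<in> set V" | B' where "A \<in> set V" "B' \<in> set V" "B = bperp B'"
      | A' B' where "A' \<in> set V" "A = bperp A'" "B' \<in> set V" "B = bperp B'"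
      using AB by blast
    then show ?thesis
    proof cases
      case 1 then show ?thesis using s0[OF AB(1)] s0[OF AB(2)] by auto
    next
      case 2 then show ?thesis by (rule nest)
    next
      case 3 then show ?thesis using perp by blast
    next
      case 4 then show ?thesis using perp by blast
    next
      case 5 then show ?thesis using nest bperp_antimono by metis
    qed
  qed
  show ?thesis
    unfolding isotropic_chain_def
  proof (intro conjI ballI)
    show "vec.subspace A" if "A \<in> ?F" for A
      using that sub subspace_bperp by auto
    show "bperp A \<in> ?F" if "A \<in> ?F" for A
      using that sub bperp_bperp by (auto simp: U bperp_0)
  qed (use comp in auto)
qed

text \<open>The matrix of conjugation in a basis whose mirrored vectors are conjugate. For such
  bases a real matrix is one that satisfies
  \<open>cnjm X = reversal ** X ** reversal\<close>.\<close>

definition reversal :: "'n::{finite,linorder} cmat" where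
  "reversal = (\<chi> i j. if i = rv j then 1 else 0)"

lemma mult_reversal: "(M ** reversal) $ i $ j = M $ i $ rv j"
  by (simp add: reversal_def matrix_matrix_mult_def if_distrib cong: if_cong)

lemma reversal_mult: "(reversal ** M) $ i $ j = M $ rv i $ j"
proof -
  have "(i = rv k) = (k = rv i)" for k by (metis rv_rv)
  then show ?thesis by (simp add: reversal_def matrix_matrix_mult_def if_distrib if_distribR cong: if_cong)
qed

lemma reversal_reversal: "reversal ** reversal = mat 1"
  by (simp add: vec_eq_iff reversal_mult) (metis (no_types, lifting) mat_def mult_reversal matrix_mul_lid reversal_mult rv_rv vec_lambda_beta)

lemma adj_reversal: "adj reversal = reversal"
proof -
  have "(i = rv j) = (j = rv i)" for i j :: 'a by (metis rv_rv)
  then show ?thesis by (simp add: reversal_def vec_eq_iff)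
qed

lemma det_cnjm: "det (cnjm M) = cnj (det M)"
  by (simp add: det_def)

lemma isotropic_flag_adapted:
  fixes V :: "'n::{finite,linorder} flag"
  assumes c: "dim_seq TYPE('n) c" and V: "V \<in> flags c" and iso: "isotropic_flag V"
  obtains U :: "'n cmat" where "unitary U" "cnjm U = U ** reversal" "V = act U (base_flag c)"
proof -
  obtain U :: "'n cmat" where U: "unitary U" "\<And>a. cnjv (column a U) = column (rv a) U"
    "\<And>A. A \<in> {{0}, UNIV} \<union> set V \<union> bperp ` set V \<Longrightarrow> A = (*v) U ` coord_space (vec.dim A)"
    using isotropic_chain_adapted_unitary[OF isotropic_chain_of_flag[OF V iso]] by metis
  have "cnj (U $ x $ a) = U $ x $ rv a" for x a
    using U(2)[of a] by (simp add: vec_eq_iff column_def)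
  then have "cnjm U = U ** reversal" by (simp add: vec_eq_iff mult_reversal)
  moreover have "V = act U (base_flag c)"
  proof (rule nth_equalityI)
    show "length V = length (act U (base_flag c))" using V by (simp add: flags_def)
    fix i assume i: "i < length V"
    then have "vec.dim (V ! i) = partial_sum c (Suc i)" "i < length c" using V by (auto simp: flags_def)
    then show "V ! i = act U (base_flag c) ! i"
      using U(3)[of "V ! i"] i by (simp add: base_flag_nth[OF c])
  qed
  ultimately show ?thesis using that U(1) by blast
qed

lemma real_unitary_SO:
  assumes "unitary k" "cnjm k = k" "det k = 1" shows "k \<in> SO_real"
proof -
  have "k $ i $ j \<in> \<real>" for i j using assms(2) by (metis Reals_cnj_iff cnjm_nth)
  then show ?thesis
    using assms by (simp add: SO_real_def SL_real_def SL_complex_def unitary_def adj_eq)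
qed

text \<open>A real matrix that preserves a subspace of half the dimension complementary to its conjugate has
  determinant \<open>\<bar>z\<bar>\<^sup>2\<close>, where \<open>z\<close> is its determinant on that subspace.\<close>

lemma det_half_split_pos:
  fixes X :: "'n::{finite,linorder} cmat"
  assumes n: "2 * m = CARD('n)" and X: "(*v) X ` coord_space m \<subseteq> coord_space m"
    and conj: "cnjm X = reversal ** X ** reversal"
  shows "\<exists>z. det X = z * cnj z"
proof -
  define X1 where "X1 = (\<chi> i j. if rk i < m \<and> rk j < m then X $ i $ j else if i = j then 1 else 0)"
  define X2 where "X2 = (\<chi> i j. if m \<le> rk i \<and> m \<le> rk j then X $ i $ j else if i = j then 1 else 0)"
  have rv: "rk (rv i) < m \<longleftrightarrow> m \<le> rk i" for i :: 'n
    using n rk_less_CARD[of i] unfolding rk_rv by linarith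
  have cX: "X $ rv i $ rv j = cnj (X $ i $ j)" for i j
    using arg_cong[OF conj, of "\<lambda>M. M $ i $ j"] by (simp add: mult_reversal reversal_mult)
  have z1: "X $ i $ j = 0" if "rk j < m" "m \<le> rk i" for i j
  proof -
    have "X *v axis j 1 \<in> coord_space m" using X axis_in_coord_space[OF that(1)] by blast
    then show ?thesis using that(2) by (simp add: mult_axis coord_space_def column_def)
  qed
  \<comment> \<open>The reality condition exchanges the two halves of the indices, so the vanishing
    block has a vanishing mirror image and X is block diagonal.\<close>
  have z2: "X $ i $ j = 0" if "rk i < m" "m \<le> rk j" for i j
    using z1[of "rv j" "rv i"] rv[of i] rv[of j] that cX[of i j] by (simp add: not_le)
  have "X1 ** X2 = X"
  proof -
    have "(X1 ** X2) $ i $ j = X $ i $ j" for i j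
    proof (cases "rk i < m")
      case True
      have "(X1 ** X2) $ i $ j = (\<Sum>k\<in>UNIV. if k = j then X1 $ i $ j * X2 $ j $ j else 0)"
        unfolding matrix_matrix_mult_def vec_lambda_beta
        by (rule sum.cong) (use True in \<open>auto simp: X1_def X2_def\<close>)
      also have "\<dots> = X $ i $ j" using True z2[of i j] by (auto simp: X1_def X2_def)
      finally show ?thesis .
    next
      case False
      have "(X1 ** X2) $ i $ j = (\<Sum>k\<in>UNIV. if k = i then X2 $ i $ j else 0)"
        unfolding matrix_matrix_mult_def vec_lambda_beta
        by (rule sum.cong) (use False in \<open>auto simp: X1_def\<close>)
      also have "\<dots> = X $ i $ j" using False z1[of j i] by (auto simp: X2_def)
      finally show ?thesis .
    qed
    then show ?thesis by (simp add: vec_eq_iff)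
  qed
  moreover have "X2 = reversal ** cnjm X1 ** reversal"
  proof -
    have "rv i = rv j \<longleftrightarrow> i = j" for i j :: 'n by (metis rv_rv)
    then show ?thesis
      using rv cX by (auto simp: vec_eq_iff mult_reversal reversal_mult X1_def X2_def not_le)
  qed
  moreover have "det (reversal :: 'n cmat) * det (reversal :: 'n cmat) = 1"
  proof -
    have "(reversal :: 'n cmat) ** reversal = mat 1" by (rule reversal_reversal)
    then show ?thesis by (metis det_I det_mul)
  qed
  ultimately have "det X = det X1 * cnj (det X1)"
    by (metis (no_types, lifting) det_cnjm det_mul mult.commute mult.left_commute mult.right_neutral)
  then show ?thesis by blast
qed

text \<open>For odd n the sign of the middle coordinate is changed. For even n the two middle
  coordinates are swapped; this moves only the coordinate space of dimension n/2, which is excluded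
  as a member of the base flag.\<close>

lemma coordinate_reflection:
  fixes c :: "nat list"
  assumes c: "dim_seq TYPE('n) c" and half: "\<And>i. i < length c \<Longrightarrow> 2 * partial_sum c (Suc i) \<noteq> CARD('n)"
  obtains R :: "'n::{finite,linorder} cmat" where "unitary R" "cnjm R = reversal ** R ** reversal" "det R = -1"
    "act R (base_flag c) = base_flag c"
proof (cases "\<exists>a::'n. rv a = a")
  case True
  then obtain a :: 'n where a: "rv a = a" by blast
  define R :: "'n cmat" where "R = (\<chi> i j. if i = j then if i = a then -1 else 1 else 0)"
  have Rv: "(R *v v) $ i = (if i = a then - v $ i else v $ i)" for v i
  proof -
    have "(R *v v) $ i = (\<Sum>j\<in>UNIV. if j = i then if i = a then - v $ i else v $ i else 0)"
      unfolding matrix_vector_mult_def vec_lambda_beta by (rule sum.cong) (auto simp: R_def)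
    then show ?thesis by simp
  qed
  have RR: "R ** R = mat 1" by (simp add: matrix_eq vec_eq_iff Rv flip: matrix_vector_mul_assoc)
  have aR: "adj R = R" by (auto simp: R_def vec_eq_iff)
  have cR: "cnjm R = reversal ** R ** reversal"
  proof -
    have "rv i = rv j \<longleftrightarrow> i = j" "rv i = a \<longleftrightarrow> i = a" for i j :: 'n using a by (metis rv_rv)+
    then show ?thesis by (simp add: vec_eq_iff mult_reversal reversal_mult R_def)
  qed
  have "det R = (\<Prod>i\<in>UNIV. R $ i $ i)" by (rule det_diagonal) (simp add: R_def)
  also have "\<dots> = (\<Prod>i\<in>UNIV. if i = a then -1 else 1)" by (simp add: R_def)
  also have "\<dots> = -1" by simp
  finally have dR: "det R = -1" .
  have "R \<in> upper (block_index c)" by (auto simp: upper_def R_def)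
  moreover have "invertible R" using dR by (simp add: invertible_det_nz)
  ultimately have "act R (base_flag c) = base_flag c"
    using act_base_flag_upper[OF c, of R "mat 1"] by simp
  then show ?thesis using that[OF _ cR dR] RR aR by (simp add: unitary_def)
next
  case False
  define m where "m = CARD('n) div 2"
  have pos: "CARD('n) > 0" by simp
  have n: "CARD('n) = 2 * m"
  proof (rule ccontr)
    assume "CARD('n) \<noteq> 2 * m"
    then have odd: "CARD('n) = 2 * m + 1" unfolding m_def by linarith
    then obtain a :: 'n where a: "rk a = m" using rk_surj[of m, where 'n='n] by auto
    then have "rk (rv a) = rk a" using odd by (simp add: rk_rv)
    then show False using False by simp
  qed
  then have m: "m > 0" using pos by linarith
  have "m - 1 < CARD('n)" using n m by linarith
  then obtain p :: 'n where p: "rk p = m - 1" using rk_surj by blast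
  obtain q :: 'n where q: "rk q = m" using rk_surj[of m, where 'n='n] n m by auto
  have pq: "p \<noteq> q" using p q m by auto
  have "rk (rv p) = rk q" unfolding rk_rv p q using n m by linarith
  then have rp: "rv p = q" by simp
  then have rq: "rv q = p" by (metis rv_rv)
  let ?\<tau> = "Transposition.transpose p q"
  define R :: "'n cmat" where "R = (\<chi> i j. mat 1 $ i $ ?\<tau> j)"
  have R_nth: "R $ i $ j = (if i = ?\<tau> j then 1 else 0)" for i j by (simp add: R_def mat_def)
  have tt: "i = ?\<tau> j \<longleftrightarrow> j = ?\<tau> i" for i j by (metis transpose_involutory)
  have Rv: "(R *v v) $ i = v $ ?\<tau> i" for v i
    by (simp add: R_nth tt[of i] matrix_vector_mult_def if_distribR if_distrib cong: if_cong)
  have RR: "R ** R = mat 1" by (simp add: matrix_eq vec_eq_iff Rv flip: matrix_vector_mul_assoc)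
  have aR: "adj R = R" using tt by (simp add: vec_eq_iff R_nth)
  have cR: "cnjm R = reversal ** R ** reversal"
  proof -
    have "rv (?\<tau> j) = ?\<tau> (rv j)" for j
    proof (cases "j = p \<or> j = q")
      case True then show ?thesis using rp rq by auto
    next
      case False
      then have "rv j \<noteq> p" "rv j \<noteq> q" using rp rq by (metis rv_rv)+
      then show ?thesis using False by (simp add: transpose_def)
    qed
    then have "i = ?\<tau> j \<longleftrightarrow> rv i = ?\<tau> (rv j)" for i j by (metis rv_rv)
    then show ?thesis by (simp add: vec_eq_iff mult_reversal reversal_mult R_nth)
  qed
  have "det R = of_int (sign ?\<tau>) * det (mat 1 :: 'n cmat)"
    unfolding R_def by (rule det_permute_columns) (rule permutes_swap_id, auto)
  then have dR: "det R = -1" using pq by (simp add: sign_swap_id)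
  have iR: "invertible R" using dR by (simp add: invertible_det_nz)
  have "act R (base_flag c) = base_flag c"
  proof (rule nth_equalityI)
    fix i assume "i < length (act R (base_flag c))"
    then have i: "i < length c" by simp
    let ?k = "partial_sum c (Suc i)"
    have "?k \<noteq> m" using half[OF i] n by auto
    have "(*v) R ` coord_space ?k \<subseteq> coord_space ?k"
    proof (clarsimp simp: coord_space_def Rv)
      fix v :: "(complex, 'n) vec" and x :: 'n assume v: "\<forall>x. ?k \<le> rk x \<longrightarrow> v $ x = 0" and x: "?k \<le> rk x"
      show "v $ ?\<tau> x = 0"
      proof (cases "x = p \<or> x = q")
        case True
        then have "?k \<le> m - 1" using x p q \<open>?k \<noteq> m\<close> by auto
        then show ?thesis using True v p q by auto
      next
        case False then show ?thesis using v x by (simp add: transpose_def)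
      qed
    qed
    then have "(*v) R ` coord_space ?k = coord_space ?k"
      by (intro vec.subspace_dim_equal) (auto simp: subspace_image_mat subspace_coord_space dim_image_mat[OF iR])
    then show "act R (base_flag c) ! i = base_flag c ! i" using i by (simp add: base_flag_nth[OF c])
  qed simp
  then show ?thesis using that[OF _ cR dR] RR aR by (simp add: unitary_def)
qed

text \<open>Composing the adapted bases gives a real orthogonal matrix from V to V', of determinant
  1 or -1. In the second case a reflection fixing the base flag is inserted between the bases; it
  exists unless some member has half the dimension.\<close>

lemma isotropic_same_SO_orbit:
  fixes V V' :: "'n::{finite,linorder} flag"
  assumes c: "dim_seq TYPE('n) c" and V: "V \<in> flags c" "isotropic_flag V" and V': "V' \<in> flags c" "isotropic_flag V'"
    and h: "h \<in> SL_real" "V' = act h V"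
  shows "\<exists>k\<in>SO_real. V' = act k V"
proof -
  obtain U :: "'n cmat" where U: "unitary U" "cnjm U = U ** reversal" "V = act U (base_flag c)"
    by (rule isotropic_flag_adapted[OF c V])
  obtain U' :: "'n cmat" where U': "unitary U'" "cnjm U' = U' ** reversal" "V' = act U' (base_flag c)"
    by (rule isotropic_flag_adapted[OF c V'])
  have Ua: "adj U ** U = mat 1" "U ** adj U = mat 1" using U(1) unitary_adj by (auto simp: unitary_def)
  have cUa: "cnjm (adj U) = reversal ** adj U" by (simp add: cnjm_adj U(2) adj_mult adj_reversal)
  define k where "k R = U' ** R ** adj U" for R
  have kreal: "cnjm (k R) = k R" if "cnjm R = reversal ** R ** reversal" for R
  proof -
    have "cnjm (k R) = U' ** (reversal ** reversal) ** R ** (reversal ** reversal) ** adj U"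
      by (simp only: k_def cnjm_mult U'(2) that cUa matrix_mul_assoc)
    then show ?thesis by (simp add: reversal_reversal k_def)
  qed
  have uadj: "unitary (adj U)" by (simp add: unitary_def Ua)
  have kuni: "unitary (k R)" if "unitary R" for R
    unfolding k_def by (intro unitary_mult U'(1) that uadj)
  have kact: "act (k R) V = V'" if "act R (base_flag c) = base_flag c" for R
  proof -
    have "act (k R) V = act U' (act R (base_flag c))"
      using Ua(1) by (simp add: k_def U(3) act_act matrix_mul_assoc[symmetric])
    then show ?thesis by (simp add: that U'(3))
  qed
  have k1: "unitary (k (mat 1))" "cnjm (k (mat 1)) = k (mat 1)" "act (k (mat 1)) V = V'"
    using kuni kreal kact by (auto simp: unitary_def reversal_reversal)
  have "det (k (mat 1)) * det (k (mat 1)) = 1"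
  proof -
    have "det (adj (k (mat 1)) ** k (mat 1)) = 1" using k1(1) by (simp add: unitary_def)
    then show ?thesis by (simp add: det_mul adj_eq k1(2))
  qed
  then have "det (k (mat 1)) = 1 \<or> det (k (mat 1)) = -1" by (simp add: square_eq_1_iff)
  then show ?thesis
  proof
    assume "det (k (mat 1)) = 1"
    then show ?thesis using real_unitary_SO[OF k1(1,2)] k1(3) by metis
  next
    assume det: "det (k (mat 1)) = -1"
    have half: "2 * partial_sum c (Suc i) \<noteq> CARD('n)" if i: "i < length c" for i
    proof
      assume n: "2 * partial_sum c (Suc i) = CARD('n)"
      \<comment> \<open>s is real, stabilizes V and has determinant -1. In the adapted basis it
        preserves the half-dimensional member, whose conjugate is complementary, so its determinant
        would be the square of an absolute value.\<close>
      define s where "s = adj (k (mat 1)) ** h"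
      define X where "X = adj U ** s ** U"
      have hr: "cnjm h = h" "det h = 1" using h(1) SL_real_cnjm by (auto simp: SL_real_def SL_complex_def)
      have "act s V = act (adj (k (mat 1)) ** k (mat 1)) V"
        using h(2) k1(3) by (simp add: s_def flip: act_act)
      then have sV: "act s V = V" using k1(1) by (simp add: unitary_def)
      have cs: "cnjm s = s" by (simp add: s_def cnjm_mult cnjm_adj k1(2) hr)
      have "act X (base_flag c) = base_flag c"
      proof -
        have "act X (base_flag c) = act (adj U) (act s V)" by (simp add: X_def U(3) act_act matrix_mul_assoc)
        then show ?thesis using Ua(1) by (simp add: sV) (simp add: U(3) act_act)
      qed
      then have "(*v) X ` coord_space (partial_sum c (Suc i)) = coord_space (partial_sum c (Suc i))"
        using i base_flag_nth[OF c i] act_nth[of i "base_flag c" X] by simp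
      moreover have "cnjm X = reversal ** X ** reversal"
        by (simp add: X_def cnjm_mult cUa cs U(2) matrix_mul_assoc)
      ultimately obtain z where z: "det X = z * cnj z"
        using det_half_split_pos[OF n, of X] by auto
      have "det (adj U) * det U = 1" using arg_cong[OF Ua(1), of det] by (simp add: det_mul)
      then have "det X = det s" unfolding X_def det_mul by (simp add: mult_ac)
      also have "\<dots> = -1"
        using det k1(2) by (simp add: s_def det_mul hr(2) adj_eq)
      finally have "z * cnj z = -1" using z by simp
      then have "complex_of_real ((cmod z)\<^sup>2) = complex_of_real (-1)" unfolding complex_norm_square by simp
      then have "(cmod z)\<^sup>2 = -1" by (rule of_real_eq_iff[THEN iffD1])
      then show False using zero_le_power2[of "cmod z"] by linarith
    qed
    obtain R :: "'n cmat" where R: "unitary R" "cnjm R = reversal ** R ** reversal" "det R = -1"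
      "act R (base_flag c) = base_flag c"
      using coordinate_reflection[OF c half] by metis
    have "det (k R) = det (k (mat 1)) * det R" by (simp add: k_def det_mul)
    then have "det (k R) = 1" using det R(3) by simp
    then show ?thesis using real_unitary_SO[OF kuni[OF R(1)] kreal[OF R(2)]] kact[OF R(4)] by metis
  qed
qed

section \<open>The base cycles of an open orbit and of its measurable model\<close>

lemma compact_SO_real: "compact (SO_real :: 'n::{finite,linorder} cmat set)"
proof -
  have eq: "SO_real = {k :: 'n cmat. unitary k} \<inter> ({k. cnjm k = k} \<inter> {k. det k = 1})"
  proof -
    have "det k = 1" if "k \<in> SO_real" for k :: "'n cmat"
      using that by (simp add: SO_real_def SL_real_def SL_complex_def)
    then have "k \<in> SO_real \<longleftrightarrow> unitary k \<and> cnjm k = k \<and> det k = 1" for k :: "'n cmat"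
      using SO_real_unitary[of k] real_unitary_SO[of k] by blast
    then show ?thesis by blast
  qed
  have "closed {k :: 'n cmat. cnjm k = k}"
    unfolding cnjm_def by (intro closed_Collect_eq continuous_on_vec_lambda continuous_intros)
  moreover have "closed {k :: 'n cmat. det k = 1}"
    by (intro closed_Collect_eq continuous_on_det continuous_intros)
  ultimately have "closed ({k :: 'n cmat. cnjm k = k} \<inter> {k. det k = 1})" by (rule closed_Int)
  then show ?thesis unfolding eq by (rule compact_Int_closed[OF compact_unitary])
qed

lemma bperp_image:
  fixes k :: "'n::{finite,linorder} cmat"
  assumes k: "k \<in> SO_real" shows "(*v) k ` bperp A = bperp ((*v) k ` A)"
proof -
  have kk: "transpose k ** k = mat 1" "k ** transpose k = mat 1"
    using k matrix_left_right_inverse1[of "transpose k" k] by (auto simp: SO_real_def)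
  have b: "bil (k *v x) (k *v y) = bil x y" for x y
    by (subst bil_mult_left) (simp add: matrix_vector_mul_assoc kk del: transpose_matrix_vector)
  show ?thesis
  proof (intro set_eqI iffI)
    fix x assume x: "x \<in> bperp ((*v) k ` A)"
    have eq: "x = k *v (transpose k *v x)" by (simp add: matrix_vector_mul_assoc kk del: transpose_matrix_vector)
    have "bil (transpose k *v x) a = 0" if "a \<in> A" for a
      using x that b[of "transpose k *v x" a] eq by (auto simp: bperp_def simp del: transpose_matrix_vector)
    then show "x \<in> (*v) k ` bperp A"
      by (subst eq) (auto simp: bperp_def simp del: transpose_matrix_vector)
  qed (auto simp: bperp_def b)
qed

locale measurable_model = flag_fibration f d t type
  for f d t :: "nat list" and type :: "'n::{finite,linorder} itself" +
  assumes refinement: "is_common_refinement d f (rev f)"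
begin

lemma set_flag_proj:
  assumes "V \<in> flags d" shows "set (flag_proj t V) \<subseteq> set (V :: 'n flag)"
proof
  fix A assume "A \<in> set (flag_proj t V)"
  then obtain j where j: "j < length t" "A = V ! (partial_sum t (Suc j) - 1)"
    by (metis flag_proj_nth in_set_conv_nth length_flag_proj)
  then have "partial_sum t (Suc j) - 1 < length V"
    using partial_sum_t_bounds[OF j(1)] assms by (auto simp: flags_def)
  then show "A \<in> set V" using j by simp
qed

lemma isotropic_flag_proj: "V \<in> flags d \<Longrightarrow> isotropic_flag V \<Longrightarrow> isotropic_flag (flag_proj t V :: 'n flag)"
  using set_flag_proj unfolding isotropic_flag_def by blast

text \<open>An isotropic flag in the measurable model consists of the members of its projection and their
  orthogonal complements.\<close>

lemma isotropic_flag_stabilizer: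
  fixes V :: "'n flag"
  assumes V: "V \<in> flags d" "isotropic_flag V" and k: "k \<in> SO_real"
    and stab: "act k (flag_proj t V) = flag_proj t V"
  shows "act k V = V"
proof (rule nth_equalityI)
  fix i assume "i < length (act k V)"
  then have i: "i < length d" "i < length V" using V(1) by (auto simp: flags_def)
  have sub: "vec.subspace (V ! m)" and dim: "vec.dim (V ! m) = partial_sum d (Suc m)" if "m < length d" for m
    using V(1) that by (auto simp: flags_def)
  have member: "(*v) k ` (V ! (partial_sum t j - 1)) = V ! (partial_sum t j - 1)"
    and member_dim: "vec.dim (V ! (partial_sum t j - 1)) = partial_sum f j"
    and member_less: "partial_sum t j - 1 < length d" if j: "0 < j" "j \<le> length t" for j
  proof -
    obtain j' where j': "j = Suc j'" using j(1) gr0_implies_Suc by blast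
    then have l: "j' < length t" using j(2) by simp
    have "act k (flag_proj t V) ! j' = (*v) k ` (flag_proj t V ! j')" using l by simp
    then show "(*v) k ` (V ! (partial_sum t j - 1)) = V ! (partial_sum t j - 1)"
      using stab l by (simp add: flag_proj_nth j')
    show less: "partial_sum t j - 1 < length d" using partial_sum_t_bounds[OF l] unfolding j' by linarith
    show "vec.dim (V ! (partial_sum t j - 1)) = partial_sum f j"
      using dim[OF less] partial_sum_t_bounds(1)[OF l] by (simp add: partial_sum_f j')
  qed
  let ?K = "partial_sum d (Suc i)"
  have Kpos: "?K > 0" using partial_sum_strict_mono[OF d_pos, of 0 "Suc i"] i by simp
  have "?K \<in> partial_sum d ` {..length d}" using i by (auto intro!: imageI)
  \<comment> \<open>Here the common refinement enters: each dimension in the model is that of a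
    member of the projection or complementary to one, the latter identifying the space as a
    \<open>bperp\<close>.\<close>
  then have "?K \<in> partial_sum f ` {..length f} \<union> partial_sum (rev f) ` {..length (rev f)}"
    using refinement by (simp add: is_common_refinement_def)
  then consider j where "j \<le> length f" "?K = partial_sum f j" | j where "j \<le> length f" "?K = partial_sum (rev f) j"
    by auto
  then have "(*v) k ` (V ! i) = V ! i"
  proof cases
    case 1
    then have j: "0 < j" "j \<le> length t" using Kpos by (auto simp: length_f intro: gr0I)
    have eq: "partial_sum d (Suc i) = partial_sum d (partial_sum t j)" using 1 by (simp add: partial_sum_f)
    have "partial_sum t j \<le> length d" using partial_sum_le_sum[of t j] by (simp add: sum_t)
    then have "Suc i = partial_sum t j"
      using eq partial_sum_strict_mono[OF d_pos, of "Suc i" "partial_sum t j"]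
        partial_sum_strict_mono[OF d_pos, of "partial_sum t j" "Suc i"] i by (cases "Suc i" "partial_sum t j" rule: linorder_cases) auto
    then have "i = partial_sum t j - 1" by simp
    then show ?thesis using member[OF j] by simp
  next
    case 2
    define l where "l = length f - j"
    have "partial_sum f l + partial_sum (rev f) j = CARD('n)"
    proof -
      have "partial_sum (rev f) j = sum_list (drop l f)"
        by (simp add: partial_sum_def take_rev l_def)
      then show ?thesis
        unfolding partial_sum_def by (metis append_take_drop_id dim_seq_sum f sum_list_append)
    qed
    then have sum: "partial_sum f l + ?K = CARD('n)" using 2 by simp
    show ?thesis
    \<comment> \<open>A projected flag has no member of dimension 0; in this case the space in
      question is everything.\<close>
    proof (cases "l = 0")
      case True
      then have "vec.dim (V ! i) = CARD('n)" using sum dim[OF i(1)] by simp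
      then have "V ! i = UNIV"
        using sub[OF i(1)] dim_UNIV_CARD[where 'n='n] by (intro vec.subspace_dim_equal) (auto simp del: vec.dim_UNIV)
      moreover have "surj ((*v) k)"
        using SO_real_unitary(4)[OF k] by (metis invertible_right_inverse matrix_right_invertible_surjective)
      ultimately show ?thesis by simp
    next
      case False
      then have l: "0 < l" "l \<le> length t" by (auto simp: l_def length_f)
      let ?B = "V ! (partial_sum t l - 1)"
      have "V ! i \<in> set V" "?B \<in> set V" using i member_less[OF l] V(1) by (auto simp: flags_def)
      moreover have "vec.dim (V ! i) + vec.dim ?B = CARD('n)"
        using sum dim[OF i(1)] member_dim[OF l] by simp
      ultimately have "V ! i = bperp ?B"
        using V(2) unfolding isotropic_flag_def by (metis order_refl subset_antisym)
      then show ?thesis using bperp_image[OF k, of ?B] member[OF l] by simp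
    qed
  qed
  then show "act k V ! i = V ! i" using i by simp
qed simp

text \<open>Projecting the cycle of the model gives isotropic flags in D, hence flags in the
  \<open>SO_real\<close>-orbit of the given cycle. Stabilizers upstairs and downstairs agree, so the
  projection is injective there; from a compact to a Hausdorff space this gives a
  homeomorphism.\<close>

lemma base_cycles:
  fixes D Dh C Ch :: "'n flag set"
  assumes D: "open_orbit f D" and C: "base_cycle f D C" and Dh: "open_orbit d Dh" and proj: "flag_proj t ` Dh = D"
    and Ch: "base_cycle d Dh Ch"
  shows "flag_proj t ` Ch = C" "complex_dim f C = complex_dim d Ch"
proof -
  obtain V k where V: "V \<in> D" "C = orbit SO_real V" "complex_submanifold f k C"
    using C by (auto simp: base_cycle_def)
  obtain W l where W: "W \<in> Dh" "Ch = orbit SO_real W" "complex_submanifold d l Ch"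
    using Ch by (auto simp: base_cycle_def)
  have one: "mat 1 \<in> (SO_real :: 'n cmat set)"
    by (rule real_unitary_SO) (simp_all add: unitary_def)
  have VC: "V \<in> C" and WC: "W \<in> Ch" using one V(2) W(2) unfolding orbit_def by (metis act_mat_1 image_eqI)+
  have Vf: "V \<in> flags f" and Wd: "W \<in> flags d"
    using VC WC V(3) W(3) by (auto simp: complex_submanifold_def)
  have isoV: "isotropic_flag V" by (rule base_cycle_isotropic[OF f D C VC])
  have isoW: "isotropic_flag W" by (rule base_cycle_isotropic[OF d Dh Ch WC])
  have lenW: "length W = length d" using Wd by (simp add: flags_def)
  have "flag_proj t W \<in> D" using W(1) proj by blast
  then obtain h where h: "h \<in> SL_real" "flag_proj t W = act h V"
  proof -
    obtain V1 where V1: "D = orbit SL_real V1" using D by (auto simp: open_orbit_def)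
    obtain h1 h2 where h12: "h1 \<in> SL_real" "V = act h1 V1" "h2 \<in> SL_real" "flag_proj t W = act h2 V1"
      using V(1) \<open>flag_proj t W \<in> D\<close> V1 by (auto simp: orbit_def)
    have i1: "invertible h1" using h12(1) by (auto simp: SL_real_def SL_invertible)
    have "cnjm (matrix_inv h1) = matrix_inv h1"
      by (metis SL_real_cnjm cnjm_mat cnjm_mult h12(1) i1 matrix_inv_right matrix_inv_unique)
    then have "matrix_inv h1 $ i $ j \<in> \<real>" for i j by (metis Reals_cnj_iff cnjm_nth)
    moreover have "det (matrix_inv h1) = 1"
      using arg_cong[OF matrix_inv_right[OF i1], of det] h12(1) by (simp add: det_mul SL_real_def SL_complex_def)
    ultimately have "matrix_inv h1 \<in> SL_real" by (simp add: SL_real_def SL_complex_def)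
    then have "h2 ** matrix_inv h1 \<in> SL_real" using h12(3) SL_real_mult by blast
    moreover have "flag_proj t W = act (h2 ** matrix_inv h1) V"
      using i1 by (simp add: h12(2,4) act_act matrix_mul_assoc[symmetric] matrix_inv_left)
    ultimately show ?thesis using that by blast
  qed
  obtain k0 where k0: "k0 \<in> SO_real" "flag_proj t W = act k0 V"
    using isotropic_same_SO_orbit[OF f Vf isoV flag_proj_in_flags[OF Wd] isotropic_flag_proj[OF Wd isoW] h] by blast
  have "orbit SO_real (act k0 V) = orbit SO_real V"
  proof (intro set_eqI iffI)
    fix X assume "X \<in> orbit SO_real V"
    then obtain m where m: "m \<in> SO_real" "X = act m V" by (auto simp: orbit_def)
    have "X = act (m ** transpose k0) (act k0 V)"
      using k0(1) by (simp add: m(2) act_act matrix_mul_assoc[symmetric] SO_real_def)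
    then show "X \<in> orbit SO_real (act k0 V)"
      using SO_real_mult[OF m(1) SO_real_transpose[OF k0(1)]] by (auto simp: orbit_def)
  next
    fix X assume "X \<in> orbit SO_real (act k0 V)"
    then show "X \<in> orbit SO_real V" using SO_real_mult k0(1) by (auto simp: orbit_def act_act)
  qed
  then show image: "flag_proj t ` Ch = C"
    using V(2) W(2) k0(2) by (simp add: flag_proj_orbit[OF lenW])
  have inj: "inj_on (flag_proj t) Ch"
  proof (rule inj_onI)
    fix X Y assume "X \<in> Ch" "Y \<in> Ch" and eq: "flag_proj t X = flag_proj t Y"
    then obtain a b where ab: "a \<in> SO_real" "X = act a W" "b \<in> SO_real" "Y = act b W"
      using W(2) by (auto simp: orbit_def)
    have bb: "transpose b ** b = mat 1" "b ** transpose b = mat 1"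
      using ab(3) matrix_left_right_inverse1[of "transpose b" b] by (auto simp: SO_real_def)
    \<comment> \<open>If two points of the orbit have the same projection, the quotient of their
      group elements fixes the projected flag and hence the flag itself.\<close>
    have "act (transpose b ** a) (flag_proj t W) = act (transpose b) (flag_proj t X)"
      by (simp add: ab(2) flag_proj_act[OF lenW] act_act)
    also have "\<dots> = flag_proj t W" by (simp add: eq ab(4) flag_proj_act[OF lenW] act_act bb)
    finally have "act (transpose b ** a) W = W"
      by (intro isotropic_flag_stabilizer[OF Wd isoW]) (auto intro: SO_real_mult SO_real_transpose ab)
    then have "act b (act (transpose b ** a) W) = act b W" by simp
    then show "X = Y" by (simp add: ab act_act matrix_mul_assoc bb)
  qed
  have Chd: "Ch \<subseteq> flags d" and Cf: "C \<subseteq> flags f" using V(3) W(3) by (auto simp: complex_submanifold_def)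
  obtain M where M: "invertible M" "W = act M (base_flag d)" by (rule flags_transitive[OF d Wd])
  have "continuous_map (top_of_set SO_real) (flag_topology d) (\<lambda>k. act (k ** M) (base_flag d))"
    using M(1) SO_real_unitary(4)
    by (intro continuous_map_act_base[OF d] matrix_mult.continuous_on continuous_intros)
      (auto simp: invertible_mult_iff)
  then have "compactin (flag_topology d) ((\<lambda>k. act (k ** M) (base_flag d)) ` SO_real)"
    by (rule image_compactin[rotated]) (simp add: compactin_subtopology compact_SO_real)
  then have comp: "compact_space (subtopology (flag_topology d) Ch)"
    by (intro compact_space_subtopology) (simp add: W(2) M(2) orbit_def act_act)
  have hom: "homeomorphic_map (subtopology (flag_topology d) Ch) (subtopology (flag_topology f) C) (flag_proj t)"
  proof (rule continuous_imp_homeomorphic_map[OF _ comp])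
    show "continuous_map (subtopology (flag_topology d) Ch) (subtopology (flag_topology f) C) (flag_proj t)"
      using image continuous_map_from_subtopology[OF continuous_map_flag_proj]
      by (auto simp: continuous_map_in_subtopology)
    show "Hausdorff_space (subtopology (flag_topology f) C)"
      by (rule Hausdorff_space_subtopology[OF Hausdorff_flag_topology[OF f]])
    show "flag_proj t ` topspace (subtopology (flag_topology d) Ch) = topspace (subtopology (flag_topology f) C)"
      using image Chd Cf by (simp add: topspace_flag_topology[OF d] topspace_flag_topology[OF f] inf.absorb2)
    show "inj_on (flag_proj t) (topspace (subtopology (flag_topology d) Ch))"
      using inj by (rule inj_on_subset) simp
  qed
  have "l = k"
    by (rule complex_submanifold_dim_unique[OF d f W(3) WC V(3) _ hom refl]) (use image WC in blast)
  then show "complex_dim f C = complex_dim d Ch"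
    using complex_dim_submanifold[OF f V(3)] complex_dim_submanifold[OF d W(3)] VC WC by (metis empty_iff)
qed

end

section \<open>Inversions and the block criterion\<close>

section \<open>Blocks of permutations\<close>

lemma blocks_nth: "k < length c \<Longrightarrow> blocks c xs ! k = take (c ! k) (drop (partial_sum c k) xs)"
proof (induction c arbitrary: xs k)
  case (Cons a c)
  then show ?case by (cases k) (auto simp: partial_sum_def add.commute)
qed simp

lemma concat_blocks: "length xs \<le> sum_list c \<Longrightarrow> concat (blocks c xs) = xs"
  by (induction c arbitrary: xs) auto

lemma map_length_blocks: "sum_list c \<le> length xs \<Longrightarrow> map length (blocks c xs) = c"
  by (induction c arbitrary: xs) auto

lemma blocks_concat: "blocks (map length xss) (concat xss) = xss"
  by (induction xss) auto

lemma take_partial_sum_concat: "take (partial_sum (map length xss) k) (concat xss) = concat (take k xss)"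
proof (induction xss arbitrary: k)
  case (Cons xs xss)
  then show ?case by (cases k) (auto simp: partial_sum_def)
qed simp

text \<open>Sorting within blocks changes none of the sets that span the coordinate flag; this
  supplies the minimal representative that \<open>schubert_set\<close> asks for.\<close>

lemma sorted_blocks_representative:
  fixes w :: "'n::{finite,linorder} list"
  assumes c: "dim_seq TYPE('n) c" and w: "distinct w" "set w = UNIV"
  obtains v where "min_rep c v" "coord_flag c v = (coord_flag c w :: 'n flag)"
proof -
  let ?b = "blocks c w"
  define v where "v = concat (map sort ?b)"
  have lw: "length w = sum_list c" using distinct_card[OF w(1)] w(2) c by (simp add: dim_seq_sum)
  have cb: "concat ?b = w" and lb: "map length ?b = c"
    using lw by (simp_all add: concat_blocks map_length_blocks)
  have lb': "map length (map sort ?b) = c" using lb by (simp add: comp_def)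
  have bv: "blocks c v = map sort ?b" using blocks_concat[of "map sort ?b"] unfolding lb' v_def .
  have set_take: "set (take (partial_sum c k) v) = set (take (partial_sum c k) w)" for k
  proof -
    have "take (partial_sum c k) v = concat (take k (map sort ?b))"
      using take_partial_sum_concat[of "map sort ?b" k] unfolding lb' v_def .
    moreover have "take (partial_sum c k) w = concat (take k ?b)"
      using take_partial_sum_concat[of ?b k] unfolding lb cb .
    ultimately show ?thesis by (simp add: take_map)
  qed
  have "set v = set (concat ?b)" by (simp add: v_def)
  then have sv: "set v = set w" by (simp only: cb)
  have "length v = length w" using lb' lb cb unfolding v_def by (metis length_concat)
  then have "distinct v" using w(1) sv by (metis card_distinct distinct_card)
  then have "min_rep c v" using sv w(2) by (auto simp: min_rep_def bv)
  moreover have "coord_flag c v = (coord_flag c w :: 'n flag)"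
    by (simp add: coord_flag_def set_take)
  ultimately show ?thesis by (rule that)
qed

context flag_fibration
begin

lemma block_index_f_le_iff: "block_index f (i :: 'n) \<le> m \<longleftrightarrow> block_index d i < partial_sum t (Suc m)"
proof (cases "partial_sum t (Suc m)")
  case 0
  then show ?thesis using t_pos partial_sum_strict_mono[OF t_pos, of 0 "Suc m"] block_index_less_length[OF f, of i]
      block_index_le_iff[OF f, of i m] by (simp add: partial_sum_f)
next
  case (Suc l)
  then show ?thesis
    using block_index_le_iff[OF f, of i m] block_index_le_iff[OF d, of i l] by (simp add: partial_sum_f less_Suc_eq_le)
qed

lemma block_index_f_mono: "block_index d (i :: 'n) \<le> block_index d (j :: 'n) \<Longrightarrow> block_index f i \<le> block_index f j"
  using block_index_f_le_iff[of j "block_index f j"] block_index_f_le_iff[of i "block_index f j"] by simp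

lemma block_index_f_eq_iff:
  "block_index f (i :: 'n) = m \<longleftrightarrow> partial_sum t m \<le> block_index d i \<and> block_index d i < partial_sum t (Suc m)"
proof -
  have "block_index f i = m \<longleftrightarrow> block_index f i \<le> m \<and> \<not> (m > 0 \<and> block_index f i \<le> m - 1)" by linarith
  then show ?thesis
    using block_index_f_le_iff[of i m] block_index_f_le_iff[of i "m - 1"] by (cases m) auto
qed

lemma block_index_eq_iff:
  "block_index d (i :: 'n) = m \<longleftrightarrow> partial_sum d m \<le> rk i \<and> rk i < partial_sum d (Suc m)"
proof -
  have "block_index d i = m \<longleftrightarrow> block_index d i \<le> m \<and> \<not> (m > 0 \<and> block_index d i \<le> m - 1)" by linarith
  then show ?thesis
    using block_index_le_iff[OF d, of i m] block_index_le_iff[OF d, of i "m - 1"] by (cases m) auto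
qed

text \<open>The pairs of positions separated by d but not by f. Their number is the dimension of the
  fibres of the projection.\<close>

definition fibre_pairs :: "('n \<times> 'n) set" where
  "fibre_pairs = {(i, j). block_index f i = block_index f j \<and> block_index d j < block_index d i}"

lemma card_pairs_split:
  "card {(i :: 'n, j :: 'n). block_index d j < block_index d i \<and> P i j} =
    card {(i :: 'n, j :: 'n). block_index f j < block_index f i \<and> P i j} +
    card {p \<in> fibre_pairs. P (fst p) (snd p)}"
proof -
  have lt: "block_index d j < block_index d i" if "block_index f j < block_index f i" for i j :: 'n
    using block_index_f_mono[of i j] that by (meson leD leI)
  have eq: "{(i :: 'n, j :: 'n). block_index d j < block_index d i \<and> P i j} =
      {(i :: 'n, j :: 'n). block_index f j < block_index f i \<and> P i j} \<union> {p \<in> fibre_pairs. P (fst p) (snd p)}"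
    using lt block_index_f_mono by (fastforce simp: fibre_pairs_def order.order_iff_strict)
  show ?thesis
    unfolding eq by (rule card_Un_disjoint) (auto simp: fibre_pairs_def)
qed

text \<open>Passing from d to f, the dimension of the flag manifold drops by the number of all fibre
  pairs, that of the Schubert variety by the number of inverted ones. Equality of codimensions means
  that none is left uninverted.\<close>

lemma codim_eq_iff:
  fixes w :: "'n list"
  assumes w: "distinct w" "set w = UNIV"
  shows "complex_dim d (schubert_variety d w) + complex_dim f (flags f :: 'n flag set) =
      complex_dim f (schubert_variety f w) + complex_dim d (flags d :: 'n flag set) \<longleftrightarrow>
    (\<forall>(i, j)\<in>fibre_pairs. w ! rk i < w ! rk j)"
proof -
  let ?A = "{p \<in> fibre_pairs. w ! rk (fst p) < w ! rk (snd p)}"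
  have 1: "complex_dim d (schubert_variety d w) = complex_dim f (schubert_variety f w) + card ?A"
    unfolding complex_dim_schubert_variety[OF d w] complex_dim_schubert_variety[OF f w]
    by (rule card_pairs_split)
  have 2: "complex_dim d (flags d :: 'n flag set) = complex_dim f (flags f :: 'n flag set) + card fibre_pairs"
    using card_pairs_split[of "\<lambda>_ _. True"]
    by (simp add: complex_dim_flags[OF d] complex_dim_flags[OF f] dim_nil_lower)
  have "card ?A = card fibre_pairs \<longleftrightarrow> ?A = fibre_pairs"
    using card_subset_eq[of fibre_pairs ?A] by auto
  also have "\<dots> \<longleftrightarrow> (\<forall>p\<in>fibre_pairs. w ! rk (fst p) < w ! rk (snd p))" by blast
  also have "\<dots> \<longleftrightarrow> (\<forall>(i, j)\<in>fibre_pairs. w ! rk i < w ! rk j)" by (simp add: case_prod_beta)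
  finally show ?thesis using 1 2 by auto
qed

text \<open>Blocks are sorted, so inversion of all pairs from two blocks is decided by the last
  entry of the later block and the first entry of the earlier one. Within a group, neighbouring
  blocks suffice by transitivity.\<close>

lemma decreasing_iff:
  fixes w :: "'n list"
  assumes w: "min_rep d w"
  shows "(\<forall>(i, j)\<in>fibre_pairs. w ! rk i < w ! rk j) \<longleftrightarrow>
    (\<forall>j<length t. 1 < t ! j \<longrightarrow> strictly_decreasing (blocks t (blocks d w) ! j))"
proof -
  let ?B = "blocks d w"
  have perm: "distinct w" "set w = UNIV" using w by (auto simp: min_rep_def)
  have lw: "length w = CARD('n)" using perm by (metis distinct_card)
  have ps: "partial_sum d m \<le> CARD('n)" for m by (rule partial_sum_le_CARD[OF d])
  have blk: "?B ! m = take (d ! m) (drop (partial_sum d m) w)" if "m < length d" for m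
    using that by (rule blocks_nth)
  have lenB: "length (?B ! m) = d ! m" "d ! m > 0" if m: "m < length d" for m
  proof -
    show "d ! m > 0" using d_pos nth_mem[OF m] by (cases "d ! m = 0") auto
    show "length (?B ! m) = d ! m"
      using blk[OF m] ps[of "Suc m"] partial_sum_Suc[OF m] lw by simp
  qed
  have hd: "hd (?B ! m) = w ! partial_sum d m" and last: "last (?B ! m) = w ! (partial_sum d (Suc m) - 1)"
    if m: "m < length d" for m
  proof -
    have ne: "?B ! m \<noteq> []" using lenB[OF m] by auto
    have nth: "?B ! m ! x = w ! (partial_sum d m + x)" if "x < d ! m" for x
      using that blk[OF m] ps[of "Suc m"] partial_sum_Suc[OF m] lw by simp
    show "hd (?B ! m) = w ! partial_sum d m" using ne nth[of 0] lenB[OF m] by (simp add: hd_conv_nth)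
    show "last (?B ! m) = w ! (partial_sum d (Suc m) - 1)"
      using ne nth[of "d ! m - 1"] lenB[OF m] partial_sum_Suc[OF m] by (simp add: last_conv_nth)
  qed
  have bounds: "hd (?B ! block_index d i) \<le> w ! rk i" "w ! rk i \<le> last (?B ! block_index d i)" for i :: 'n
  proof -
    let ?m = "block_index d i"
    have m: "?m < length d" by (rule block_index_less_length[OF d])
    have r: "partial_sum d ?m \<le> rk i" "rk i < partial_sum d (Suc ?m)" using block_index_eq_iff by auto
    let ?x = "rk i - partial_sum d ?m"
    have x: "?x < d ! ?m" using r partial_sum_Suc[OF m] by linarith
    have nth: "?B ! ?m ! ?x = w ! rk i"
      using x r blk[OF m] ps[of "Suc ?m"] partial_sum_Suc[OF m] lw by simp
    have s: "sorted (?B ! ?m)" using w m by (simp add: min_rep_def)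
    have ne: "?B ! ?m \<noteq> []" using lenB[OF m] by auto
    show "hd (?B ! ?m) \<le> w ! rk i"
      using sorted_nth_mono[OF s, of 0 ?x] x lenB[OF m] nth ne by (simp add: hd_conv_nth)
    show "w ! rk i \<le> last (?B ! ?m)"
      using sorted_nth_mono[OF s, of ?x "d ! ?m - 1"] x lenB[OF m] nth ne by (simp add: last_conv_nth)
  qed
  have group: "strictly_decreasing (blocks t ?B ! j) \<longleftrightarrow>
      (\<forall>m. partial_sum t j \<le> m \<and> Suc m < partial_sum t (Suc j) \<longrightarrow> last (?B ! Suc m) < hd (?B ! m))"
    if j: "j < length t" for j
  proof -
    have le: "partial_sum t (Suc j) \<le> length d" using partial_sum_t_bounds[OF j] by simp
    have bj: "blocks t ?B ! j = take (t ! j) (drop (partial_sum t j) ?B)" by (rule blocks_nth[OF j])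
    have len: "length (blocks t ?B ! j) = t ! j" using bj le partial_sum_Suc[OF j] by simp
    have nth: "blocks t ?B ! j ! x = ?B ! (partial_sum t j + x)" if "x < t ! j" for x
      using that bj le partial_sum_Suc[OF j] by simp
    have "strictly_decreasing (blocks t ?B ! j) \<longleftrightarrow>
        (\<forall>x. Suc x < t ! j \<longrightarrow> last (?B ! (partial_sum t j + Suc x)) < hd (?B ! (partial_sum t j + x)))"
      by (simp add: strictly_decreasing_def successively_conv_nth len nth)
    also have "\<dots> \<longleftrightarrow> (\<forall>m. partial_sum t j \<le> m \<and> Suc m < partial_sum t (Suc j) \<longrightarrow> last (?B ! Suc m) < hd (?B ! m))"
    proof (intro iffI allI impI)
      fix m assume *: "\<forall>x. Suc x < t ! j \<longrightarrow> last (?B ! (partial_sum t j + Suc x)) < hd (?B ! (partial_sum t j + x))"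
        and m: "partial_sum t j \<le> m \<and> Suc m < partial_sum t (Suc j)"
      then have "Suc (m - partial_sum t j) < t ! j" using partial_sum_Suc[OF j] by linarith
      from *[rule_format, OF this] show "last (?B ! Suc m) < hd (?B ! m)" using m by simp
    next
      fix x assume "\<forall>m. partial_sum t j \<le> m \<and> Suc m < partial_sum t (Suc j) \<longrightarrow> last (?B ! Suc m) < hd (?B ! m)"
        and "Suc x < t ! j"
      then show "last (?B ! (partial_sum t j + Suc x)) < hd (?B ! (partial_sum t j + x))"
        using partial_sum_Suc[OF j] by simp
    qed
    finally show ?thesis .
  qed
  show ?thesis
  proof
    assume inv: "\<forall>(i, j)\<in>fibre_pairs. w ! rk i < w ! rk j"
    show "\<forall>j<length t. 1 < t ! j \<longrightarrow> strictly_decreasing (blocks t ?B ! j)"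
    proof (intro allI impI)
      fix j assume j: "j < length t"
      show "strictly_decreasing (blocks t ?B ! j)"
        unfolding group[OF j]
      proof (intro allI impI)
        fix m assume m: "partial_sum t j \<le> m \<and> Suc m < partial_sum t (Suc j)"
        have ml: "Suc m < length d" using m partial_sum_t_bounds(2)[OF j] by linarith
        have lt: "partial_sum d m < partial_sum d (Suc m)" "partial_sum d (Suc m) < partial_sum d (Suc (Suc m))"
          using ml by (auto intro!: partial_sum_strict_mono[OF d_pos])
        then have "partial_sum d m < CARD('n)" "partial_sum d (Suc (Suc m)) - 1 < CARD('n)"
          using ps[of "Suc m"] ps[of "Suc (Suc m)"] by linarith+
        \<comment> \<open>The last position of block m+1 and the first position of block m: the
          extreme pair that the definition of strict decrease compares.\<close>
        then obtain a b :: 'n where ab: "rk a = partial_sum d (Suc (Suc m)) - 1" "rk b = partial_sum d m"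
          using rk_surj by metis
        have "block_index d a = Suc m" "block_index d b = m"
          unfolding block_index_eq_iff ab using lt by linarith+
        moreover have "block_index f a = j" "block_index f b = j"
          unfolding block_index_f_eq_iff calculation using m by linarith+
        ultimately have "(a, b) \<in> fibre_pairs" by (simp add: fibre_pairs_def)
        then have "w ! rk a < w ! rk b" using inv by blast
        then show "last (?B ! Suc m) < hd (?B ! m)" using last[OF ml] hd[of m] ml by (simp add: ab)
      qed
    qed
  next
    assume dec: "\<forall>j<length t. 1 < t ! j \<longrightarrow> strictly_decreasing (blocks t ?B ! j)"
    show "\<forall>(i, j)\<in>fibre_pairs. w ! rk i < w ! rk j"
    proof clarify
      fix a b assume "(a, b) \<in> fibre_pairs"
      then have ab: "block_index f a = block_index f b" "block_index d b < block_index d a"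
        by (auto simp: fibre_pairs_def)
      define j where "j = block_index f a"
      have j: "j < length t" using block_index_less_length[OF f, of a] by (simp add: j_def length_f)
      have ra: "partial_sum t j \<le> block_index d a" "block_index d a < partial_sum t (Suc j)"
        and rb: "partial_sum t j \<le> block_index d b" "block_index d b < partial_sum t (Suc j)"
        using block_index_f_eq_iff[of a j] block_index_f_eq_iff[of b j] ab(1) by (auto simp: j_def)
      \<comment> \<open>Two different blocks in one group show that the group is not a single block,
        so the hypothesis applies to it.\<close>
      have "1 < t ! j" using partial_sum_Suc[OF j] ra rb ab(2) by linarith
      then have next_block: "last (?B ! Suc m) < hd (?B ! m)" if "partial_sum t j \<le> m" "Suc m < partial_sum t (Suc j)" for m
        using dec j group[OF j] that by blast
      have hl: "hd (?B ! m) \<le> last (?B ! m)" if "m < length d" for m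
      proof -
        have "partial_sum d m < CARD('n)"
          using partial_sum_strict_mono[OF d_pos, of m "Suc m"] that ps[of "Suc m"] by linarith
        then obtain i :: 'n where "rk i = partial_sum d m" using rk_surj by blast
        then have "block_index d i = m"
          using partial_sum_strict_mono[OF d_pos, of m "Suc m"] that by (simp add: block_index_eq_iff)
        then show ?thesis using bounds[of i] by simp
      qed
      \<comment> \<open>Starting from the block of b, the comparison is carried from block to block
        up to the block of a, without leaving the group.\<close>
      have "n < partial_sum t (Suc j) \<longrightarrow> last (?B ! n) < hd (?B ! block_index d b)"
        if "Suc (block_index d b) \<le> n" for n
        using that
      proof (induction rule: dec_induct)
        case base
        show ?case using next_block[of "block_index d b"] rb(1) by simp
      next
        case (step n)
        show ?case
        proof
          assume n: "Suc n < partial_sum t (Suc j)"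
          have "last (?B ! Suc n) < hd (?B ! n)" using next_block[of n] n rb(1) step.hyps by simp
          also have "hd (?B ! n) \<le> last (?B ! n)" using hl[of n] n partial_sum_t_bounds(2)[OF j] by simp
          also have "\<dots> < hd (?B ! block_index d b)" using step.IH n by simp
          finally show "last (?B ! Suc n) < hd (?B ! block_index d b)" .
        qed
      qed
      then have "last (?B ! block_index d a) < hd (?B ! block_index d b)" using ab(2) ra(2) by simp
      then show "w ! rk a < w ! rk b" using bounds(2)[of a] bounds(1)[of b] by (meson le_less_trans less_le_trans)
    qed
  qed
qed

end

theorem proposition18:
  fixes f d t :: "nat list"
    and D C0 Dh C0h :: "'n::{finite,linorder} flag set"
    and wh :: "'n list"
  assumes "dim_seq TYPE('n) f"
    and "open_orbit f D" and "\<not> measurable_orbit f D"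
    and "base_cycle f D C0"
    and "is_common_refinement d f (rev f)"
    and "grouping t d f"
    and "open_orbit d Dh" and "flag_proj t ` Dh = D"
    and "base_cycle d Dh C0h"
    and "min_rep d wh" and "schubert_variety d wh \<in> schubert_set d C0h"
  shows "(\<exists>w. min_rep f w \<and> flag_proj t ` schubert_variety d wh = schubert_variety f w \<and>
              schubert_variety f w \<in> schubert_set f C0) \<longleftrightarrow>
         (\<forall>j<length t. 1 < t ! j \<longrightarrow> strictly_decreasing (blocks t (blocks d wh) ! j))"
proof -
  interpret measurable_model f d t "TYPE('n)"
    by unfold_locales (use assms in \<open>auto simp: is_common_refinement_def\<close>)
  have wh: "distinct wh" "set wh = UNIV" using assms(10) by (auto simp: min_rep_def)
  have image: "flag_proj t ` schubert_variety d wh = schubert_variety f wh"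
    by (rule flag_proj_schubert_variety[OF coord_flag_in_flags[OF d wh]])
  have cycles: "flag_proj t ` C0h = C0" "complex_dim f C0 = complex_dim d C0h"
    using base_cycles[OF assms(2,4,7,8,9)] by auto
  have dim_h: "complex_dim d (schubert_variety d wh) + complex_dim d C0h = complex_dim d (flags d :: 'n flag set)"
    and meet_h: "schubert_variety d wh \<inter> C0h \<noteq> {}"
    using assms(11) by (auto simp: schubert_set_def)
  have meet: "schubert_variety f wh \<inter> C0 \<noteq> {}" using meet_h image cycles(1) by blast
  obtain v where v: "min_rep f v" "coord_flag f v = (coord_flag f wh :: 'n flag)"
    by (rule sorted_blocks_representative[OF f wh])
  have Sv: "schubert_variety f v = schubert_variety f wh" by (simp add: schubert_variety_def v(2))
  \<comment> \<open>The variety meets the cycle, as the image of an intersection point upstairs, and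
    v makes its index minimal; what remains of membership is the equation of dimensions.\<close>
  have mem: "schubert_variety f wh \<in> schubert_set f C0 \<longleftrightarrow>
      complex_dim f (schubert_variety f wh) + complex_dim f C0 = complex_dim f (flags f :: 'n flag set)"
    using meet v(1) Sv unfolding schubert_set_def by (auto; metis)
  have "(\<exists>w. min_rep f w \<and> flag_proj t ` schubert_variety d wh = schubert_variety f w \<and>
      schubert_variety f w \<in> schubert_set f C0) \<longleftrightarrow> schubert_variety f wh \<in> schubert_set f C0"
    using v(1) Sv image by metis
  \<comment> \<open>The cycles have equal dimension, so subtracting the equation valid in the model
    leaves equality of codimensions.\<close>
  also have "\<dots> \<longleftrightarrow> complex_dim d (schubert_variety d wh) + complex_dim f (flags f :: 'n flag set) =
      complex_dim f (schubert_variety f wh) + complex_dim d (flags d :: 'n flag set)"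
    unfolding mem using dim_h cycles(2) by linarith
  finally show ?thesis by (simp only: codim_eq_iff[OF wh] decreasing_iff[OF assms(10)])
qed

end
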